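(* Let $$X=\{x_1^2+x_2^2+x_3^2+x_4^2+x_5^2=0\}\subset\mathbb{P}^4.$$ The $G$-action on $X$ is stably linearizable in each of the following cases: (1) $G=\mathfrak{S}_5$, with the standard permutation action on the coordinates $x_1,\dots,x_5$; (2) $G=\mathfrak{S}_3\times C_2^2$, with the standard permutation action of $\mathfrak{S}_3$ on the first three variables $x_1,x_2,x_3$, and $C_2^2$ acting by sign changes on $x_4$ and $x_5$.
   Context: The base field $k$ is algebraically closed of characteristic zero. $\mathfrak{S}_n$ is the symmetric group, and $C_2$ is the cyclic group of order $2$; in (2), the two factors of $C_2^2$ act by $x_4\mapsto -x_4$ and $x_5\mapsto -x_5$ respectively. For a finite group $G$, a smooth variety $X$ over $k$ with a generically free regular action of $G$ is called linearizable if there is a $G$-equivariant birational map $\mathbb{P}(V)\dashrightarrow X$ for some linear representation $V$ of $G$. It is called stably linearizable if $X\times\mathbb{P}^m$, with trivial action on the second factor, is linearizable for some $m$. *)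

theory Defs
  imports
    "HOL-Analysis.Abstract_Topology"
    "HOL-Computational_Algebra.Polynomial"
    "HOL-Algebra.Sym_Groups"
    "HOL-Algebra.Group_Action"
begin

section \<open>Spaces with functions\<close>

text \<open>
  Varieties over an algebraically closed field are treated classically, as topological spaces
  together with, for every open set, a set of regular functions to the field (Serre; Kempf,
  "Algebraic Varieties"). In \<open>reg X U f\<close> only the values of \<open>f\<close> on \<open>U\<close> matter.
\<close>

record ('p, 'k) fspace =
  zar :: "'p topology"
  reg :: "'p set \<Rightarrow> ('p \<Rightarrow> 'k) \<Rightarrow> bool"

abbreviation points :: "('p, 'k) fspace \<Rightarrow> 'p set"
  where "points X \<equiv> topspace (zar X)"

definition sheaf_of_functions :: "('p, 'k) fspace \<Rightarrow> bool"
  where "sheaf_of_functions X \<longleftrightarrow>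
    (\<forall>U f g. reg X U f \<longrightarrow> (\<forall>p\<in>U. f p = g p) \<longrightarrow> reg X U g) \<and>
    (\<forall>U f. reg X U f \<longleftrightarrow>
       openin (zar X) U \<and> (\<forall>p\<in>U. \<exists>W. openin (zar X) W \<and> p \<in> W \<and> W \<subseteq> U \<and> reg X W f))"

definition morphism :: "('p, 'k) fspace \<Rightarrow> ('q, 'k) fspace \<Rightarrow> ('p \<Rightarrow> 'q) \<Rightarrow> bool"
  where "morphism X Y \<phi> \<longleftrightarrow> continuous_map (zar X) (zar Y) \<phi> \<and>
    (\<forall>V f. openin (zar Y) V \<longrightarrow> reg Y V f \<longrightarrow> reg X {p \<in> points X. \<phi> p \<in> V} (f \<circ> \<phi>))"

definition isomorphism :: "('p, 'k) fspace \<Rightarrow> ('q, 'k) fspace \<Rightarrow> ('p \<Rightarrow> 'q) \<Rightarrow> bool"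
  where "isomorphism X Y \<phi> \<longleftrightarrow> morphism X Y \<phi> \<and>
    (\<exists>\<psi>. morphism Y X \<psi> \<and> (\<forall>p\<in>points X. \<psi> (\<phi> p) = p) \<and> (\<forall>q\<in>points Y. \<phi> (\<psi> q) = q))"

text \<open>The induced structure: regular functions on a subset are those that locally extend to
  regular functions on an open subset of the ambient space.\<close>

definition subspace_of :: "('p, 'k) fspace \<Rightarrow> 'p set \<Rightarrow> ('p, 'k) fspace"
  where "subspace_of X Z = \<lparr>
    zar = subtopology (zar X) Z,
    reg = (\<lambda>U f. openin (subtopology (zar X) Z) U \<and>
      (\<forall>p\<in>U. \<exists>W g. openin (zar X) W \<and> p \<in> W \<and> W \<inter> Z \<subseteq> U \<and> reg X W g \<and>
        (\<forall>q\<in>W \<inter> Z. f q = g q))) \<rparr>"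

text \<open>The product of varieties. Its topology is finer than the product topology: basic open sets
  are the nonvanishing loci, inside open boxes, of finite sums of products of regular functions
  from the two factors, and regular functions are locally quotients of such sums.\<close>

definition box_function ::
  "('p, 'k::field) fspace \<Rightarrow> 'p set \<Rightarrow> ('q, 'k) fspace \<Rightarrow> 'q set \<Rightarrow> ('p \<times> 'q \<Rightarrow> 'k) \<Rightarrow> bool"
  where "box_function X U Y V h \<longleftrightarrow> (\<exists>(n::nat) f g.
    (\<forall>i<n. reg X U (f i) \<and> reg Y V (g i)) \<and>
    (\<forall>p\<in>U. \<forall>q\<in>V. h (p, q) = (\<Sum>i<n. f i p * g i q)))"

definition product_zar ::
  "('p, 'k::field) fspace \<Rightarrow> ('q, 'k) fspace \<Rightarrow> ('p \<times> 'q) topology"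
  where "product_zar X Y = topology_generated_by
    {{z \<in> U \<times> V. h z \<noteq> 0} |U V h.
       openin (zar X) U \<and> openin (zar Y) V \<and> box_function X U Y V h}"

definition product_of ::
  "('p, 'k::field) fspace \<Rightarrow> ('q, 'k) fspace \<Rightarrow> ('p \<times> 'q, 'k) fspace"
  where "product_of X Y = \<lparr>
    zar = product_zar X Y,
    reg = (\<lambda>O' f. openin (product_zar X Y) O' \<and>
      (\<forall>z\<in>O'. \<exists>W U V h h'. openin (product_zar X Y) W \<and> z \<in> W \<and> W \<subseteq> O' \<inter> U \<times> V \<and>
        openin (zar X) U \<and> openin (zar Y) V \<and>
        box_function X U Y V h \<and> box_function X U Y V h' \<and>
        (\<forall>w\<in>W. h' w \<noteq> 0 \<and> f w = h w / h' w))) \<rparr>"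


section \<open>Affine and projective spaces\<close>

text \<open>\<open>coord_space I\<close> is the vector space with coordinates indexed by \<open>I\<close> (in use, a finite set).
  Polynomials are represented by the functions they define; this is no loss over an infinite
  field.\<close>

definition coord_space :: "nat set \<Rightarrow> (nat \<Rightarrow> 'k::field) set"
  where "coord_space I = {x. \<forall>i. i \<notin> I \<longrightarrow> x i = 0}"

inductive poly_fun :: "nat set \<Rightarrow> ((nat \<Rightarrow> 'k::field) \<Rightarrow> 'k) \<Rightarrow> bool" for I
  where
    const: "poly_fun I (\<lambda>x. c)"
  | coord: "i \<in> I \<Longrightarrow> poly_fun I (\<lambda>x. x i)"
  | add: "poly_fun I F \<Longrightarrow> poly_fun I H \<Longrightarrow> poly_fun I (\<lambda>x. F x + H x)"
  | mult: "poly_fun I F \<Longrightarrow> poly_fun I H \<Longrightarrow> poly_fun I (\<lambda>x. F x * H x)"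

definition homogeneous_fun :: "nat set \<Rightarrow> nat \<Rightarrow> ((nat \<Rightarrow> 'k::field) \<Rightarrow> 'k) \<Rightarrow> bool"
  where "homogeneous_fun I d F \<longleftrightarrow> poly_fun I F \<and> (\<forall>c x. F (\<lambda>i. c * x i) = c ^ d * F x)"

definition affine_zar :: "nat set \<Rightarrow> (nat \<Rightarrow> 'k::field) topology"
  where "affine_zar I = topology_generated_by
    {{x \<in> coord_space I. F x \<noteq> 0} |F. poly_fun I F}"

definition affine_space :: "nat set \<Rightarrow> (nat \<Rightarrow> 'k::field, 'k) fspace"
  where "affine_space I = \<lparr>
    zar = affine_zar I,
    reg = (\<lambda>U f. openin (affine_zar I) U \<and>
      (\<forall>p\<in>U. \<exists>W F H. openin (affine_zar I) W \<and> p \<in> W \<and> W \<subseteq> U \<and>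
        poly_fun I F \<and> poly_fun I H \<and> (\<forall>x\<in>W. H x \<noteq> 0 \<and> f x = F x / H x))) \<rparr>"

text \<open>Points of projective space are the lines through the origin.\<close>

definition line :: "(nat \<Rightarrow> 'k::field) \<Rightarrow> (nat \<Rightarrow> 'k) set"
  where "line x = range (\<lambda>c i. c * x i)"

definition projective_zar :: "nat set \<Rightarrow> (nat \<Rightarrow> 'k::field) set topology"
  where "projective_zar I = topology_generated_by
    {{line x |x. x \<in> coord_space I \<and> x \<noteq> (\<lambda>_. 0) \<and> F x \<noteq> 0} |F. \<exists>d. homogeneous_fun I d F}"

definition projective_space :: "nat set \<Rightarrow> ((nat \<Rightarrow> 'k::field) set, 'k) fspace"
  where "projective_space I = \<lparr>
    zar = projective_zar I,
    reg = (\<lambda>U f. openin (projective_zar I) U \<and>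
      (\<forall>p\<in>U. \<exists>W d F H. openin (projective_zar I) W \<and> p \<in> W \<and> W \<subseteq> U \<and>
        homogeneous_fun I d F \<and> homogeneous_fun I d H \<and>
        (\<forall>x\<in>coord_space I. x \<noteq> (\<lambda>_. 0) \<longrightarrow> line x \<in> W \<longrightarrow>
           H x \<noteq> 0 \<and> f (line x) = F x / H x))) \<rparr>"


section \<open>Smooth varieties\<close>

definition partial_deriv :: "nat \<Rightarrow> ((nat \<Rightarrow> 'k::field) \<Rightarrow> 'k) \<Rightarrow> (nat \<Rightarrow> 'k) \<Rightarrow> 'k"
  where "partial_deriv i F x = poly (pderiv (THE p. \<forall>t. poly p t = F (x(i := t)))) (x i)"

text \<open>Zero loci in affine space of \<open>r\<close> polynomials whose Jacobian matrix has rank \<open>r\<close> at every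
  point. By the Jacobian criterion every point of a smooth variety has a neighbourhood isomorphic
  to such a locus (a principal open subset \<open>D(h)\<close> is again of this form, by adding a coordinate
  \<open>t\<close> and the equation \<open>h t = 1\<close>).\<close>

definition standard_smooth :: "(nat \<Rightarrow> 'k::field, 'k) fspace \<Rightarrow> bool"
  where "standard_smooth Z \<longleftrightarrow> (\<exists>(n::nat) (r::nat) F.
    (\<forall>j<r. poly_fun {1..n} (F j)) \<and>
    Z = subspace_of (affine_space {1..n}) {x \<in> coord_space {1..n}. \<forall>j<r. F j x = 0} \<and>
    (\<forall>x\<in>points Z. \<forall>c. (\<forall>i\<in>{1..n}. (\<Sum>j<r. c j * partial_deriv i (F j) x) = 0)
       \<longrightarrow> (\<forall>j<r. c j = 0)))"

definition irreducible_space :: "'p topology \<Rightarrow> bool"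
  where "irreducible_space T \<longleftrightarrow> topspace T \<noteq> {} \<and>
    (\<forall>U V. openin T U \<longrightarrow> openin T V \<longrightarrow> U \<noteq> {} \<longrightarrow> V \<noteq> {} \<longrightarrow> U \<inter> V \<noteq> {})"

definition smooth_variety :: "('p, 'k::field) fspace \<Rightarrow> bool"
  where "smooth_variety X \<longleftrightarrow>
    sheaf_of_functions X \<and>
    irreducible_space (zar X) \<and>
    closedin (zar (product_of X X)) {(p, p) |p. p \<in> points X} \<and>
    (\<exists>\<U>. finite \<U> \<and> \<Union>\<U> = points X \<and>
      (\<forall>U\<in>\<U>. openin (zar X) U \<and>
        (\<exists>Z \<phi>. standard_smooth Z \<and> isomorphism (subspace_of X U) Z \<phi>)))"


section \<open>Group actions and linearizability\<close>

definition regular_action ::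
  "('g, 'm) monoid_scheme \<Rightarrow> ('p, 'k) fspace \<Rightarrow> ('g \<Rightarrow> 'p \<Rightarrow> 'p) \<Rightarrow> bool"
  where "regular_action G X a \<longleftrightarrow>
    group_action G (points X) a \<and> (\<forall>g\<in>carrier G. morphism X X (a g))"

definition generically_free ::
  "('g, 'm) monoid_scheme \<Rightarrow> ('p, 'k) fspace \<Rightarrow> ('g \<Rightarrow> 'p \<Rightarrow> 'p) \<Rightarrow> bool"
  where "generically_free G X a \<longleftrightarrow> (\<exists>U. openin (zar X) U \<and> U \<noteq> {} \<and>
    (\<forall>p\<in>U. \<forall>g\<in>carrier G. a g p = p \<longrightarrow> g = \<one>\<^bsub>G\<^esub>))"

definition smooth_G_variety ::
  "('g, 'm) monoid_scheme \<Rightarrow> ('p, 'k::field) fspace \<Rightarrow> ('g \<Rightarrow> 'p \<Rightarrow> 'p) \<Rightarrow> bool"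
  where "smooth_G_variety G X a \<longleftrightarrow>
    finite (carrier G) \<and> smooth_variety X \<and> regular_action G X a \<and> generically_free G X a"

text \<open>For irreducible \<open>X\<close> and \<open>Y\<close>, where nonempty open sets are dense. Since \<open>U\<close> need not be
  stable under \<open>G\<close>, equivariance is required wherever both sides are defined.\<close>

definition equivariantly_birational ::
  "('g, 'm) monoid_scheme \<Rightarrow> ('p, 'k) fspace \<Rightarrow> ('g \<Rightarrow> 'p \<Rightarrow> 'p) \<Rightarrow>
     ('q, 'k) fspace \<Rightarrow> ('g \<Rightarrow> 'q \<Rightarrow> 'q) \<Rightarrow> bool"
  where "equivariantly_birational G X a Y b \<longleftrightarrow> (\<exists>U V \<phi>.
    openin (zar X) U \<and> U \<noteq> {} \<and> openin (zar Y) V \<and> V \<noteq> {} \<and>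
    isomorphism (subspace_of X U) (subspace_of Y V) \<phi> \<and>
    (\<forall>g\<in>carrier G. \<forall>p\<in>U. a g p \<in> U \<longrightarrow> \<phi> (a g p) = b g (\<phi> p)))"

definition linear_representation ::
  "('g, 'm) monoid_scheme \<Rightarrow> nat set \<Rightarrow> ('g \<Rightarrow> (nat \<Rightarrow> 'k::field) \<Rightarrow> (nat \<Rightarrow> 'k)) \<Rightarrow> bool"
  where "linear_representation G I \<rho> \<longleftrightarrow>
    (\<forall>g\<in>carrier G.
      (\<forall>x\<in>coord_space I. \<rho> g x \<in> coord_space I) \<and>
      (\<forall>x\<in>coord_space I. \<forall>y\<in>coord_space I. \<rho> g (\<lambda>i. x i + y i) = (\<lambda>i. \<rho> g x i + \<rho> g y i)) \<and>
      (\<forall>c. \<forall>x\<in>coord_space I. \<rho> g (\<lambda>i. c * x i) = (\<lambda>i. c * \<rho> g x i))) \<and>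
    (\<forall>x\<in>coord_space I. \<rho> \<one>\<^bsub>G\<^esub> x = x) \<and>
    (\<forall>g\<in>carrier G. \<forall>h\<in>carrier G. \<forall>x\<in>coord_space I. \<rho> (g \<otimes>\<^bsub>G\<^esub> h) x = \<rho> g (\<rho> h x))"

definition induced_action ::
  "('g \<Rightarrow> (nat \<Rightarrow> 'k) \<Rightarrow> (nat \<Rightarrow> 'k)) \<Rightarrow> ((nat \<Rightarrow> 'k::field) set, 'k) fspace \<Rightarrow>
     'g \<Rightarrow> (nat \<Rightarrow> 'k) set \<Rightarrow> (nat \<Rightarrow> 'k) set"
  where "induced_action \<rho> X g = (\<lambda>L\<in>points X. \<rho> g ` L)"

definition action_on_first ::
  "('p, 'k::field) fspace \<Rightarrow> ('g \<Rightarrow> 'p \<Rightarrow> 'p) \<Rightarrow> ('q, 'k) fspace \<Rightarrow> 'g \<Rightarrow> 'p \<times> 'q \<Rightarrow> 'p \<times> 'q"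
  where "action_on_first X a Y g = (\<lambda>(p, q)\<in>points (product_of X Y). (a g p, q))"

definition birational_to_representation ::
  "('g, 'm) monoid_scheme \<Rightarrow> ('p, 'k::field) fspace \<Rightarrow> ('g \<Rightarrow> 'p \<Rightarrow> 'p) \<Rightarrow> bool"
  where "birational_to_representation G X a \<longleftrightarrow>
    (\<exists>(n::nat) (\<rho> :: 'g \<Rightarrow> (nat \<Rightarrow> 'k) \<Rightarrow> (nat \<Rightarrow> 'k)). linear_representation G {1..n} \<rho> \<and>
      equivariantly_birational G
        (projective_space {1..n}) (induced_action \<rho> (projective_space {1..n})) X a)"

definition linearizable ::
  "('g, 'm) monoid_scheme \<Rightarrow> ('p, 'k::field) fspace \<Rightarrow> ('g \<Rightarrow> 'p \<Rightarrow> 'p) \<Rightarrow> bool"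
  where "linearizable G X a \<longleftrightarrow>
    smooth_G_variety G X a \<and> birational_to_representation G X a"

text \<open>The projective space of dimension \<open>m\<close> has homogeneous coordinates indexed by \<open>{1..m+1}\<close>. If
  \<open>X\<close> is a smooth variety with a generically free regular action, then so is its product with a
  projective space, so these conditions are imposed on \<open>X\<close> only.\<close>

definition stably_linearizable ::
  "('g, 'm) monoid_scheme \<Rightarrow> ('p, 'k::field) fspace \<Rightarrow> ('g \<Rightarrow> 'p \<Rightarrow> 'p) \<Rightarrow> bool"
  where "stably_linearizable G X a \<longleftrightarrow> smooth_G_variety G X a \<and>
    (\<exists>m::nat. birational_to_representation G
      (product_of X (projective_space {1..m+1} :: ((nat \<Rightarrow> 'k) set, 'k) fspace))
      (action_on_first X a (projective_space {1..m+1} :: ((nat \<Rightarrow> 'k) set, 'k) fspace)))"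


section \<open>The quadric and the two groups\<close>

definition quadric :: "((nat \<Rightarrow> 'k::field) set, 'k) fspace"
  where "quadric = subspace_of (projective_space {1..5})
    {line x |x. x \<in> coord_space {1..5} \<and> x \<noteq> (\<lambda>_. 0) \<and> (\<Sum>i=1..5. (x i)\<^sup>2) = 0}"

text \<open>The permutation \<open>\<sigma>\<close> sends the basis vector with index \<open>i\<close> to the one with index \<open>\<sigma> i\<close>; in
  coordinates this involves the inverse, which makes it a left action.\<close>

definition perm_coords :: "(nat \<Rightarrow> nat) \<Rightarrow> (nat \<Rightarrow> 'k::field) \<Rightarrow> (nat \<Rightarrow> 'k)"
  where "perm_coords \<sigma> x = (\<lambda>i. x (inv' \<sigma> i))"

text \<open>\<^const>\<open>sign_img\<close> is the multiplicative group of integers \<open>{-1, 1}\<close>, cyclic of order 2;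
  permutations in \<open>sym_group 3\<close> fix the indices 4 and 5.\<close>

definition S3_C2_C2 :: "((nat \<Rightarrow> nat) \<times> int \<times> int) monoid"
  where "S3_C2_C2 = sym_group 3 \<times>\<times> (sign_img \<times>\<times> sign_img)"

definition perm_sign_coords ::
  "(nat \<Rightarrow> nat) \<times> int \<times> int \<Rightarrow> (nat \<Rightarrow> 'k::field) \<Rightarrow> (nat \<Rightarrow> 'k)"
  where "perm_sign_coords = (\<lambda>(\<sigma>, s, t) x.
    (perm_coords \<sigma> x)(4 := of_int s * x 4, 5 := of_int t * x 5))"

end

theory Submission
  imports "Jordan_Normal_Form.Determinant" Defs
begin

text \<open>
  Let \<open>q\<close> be the sum of five squares, \<open>V\<close> the five-dimensional representation of the group \<open>G\<close>
  with \<open>q\<close> invariant, and \<open>X\<close> the quadric \<open>q = 0\<close>. The proof exhibits a \<open>G\<close>-equivariant birational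
  map between \<open>P(V + k^4)\<close>, with trivial action on \<open>k^4\<close>, and \<open>X \<times> P^5\<close>. It compares two ways of
  looking at \<open>X \<times> V\<close>.

  Suppose that polynomial equivariant maps \<open>M 1, ..., M 5\<close> from \<open>V\<close> to itself give a basis of \<open>V\<close> at
  a general point. Seen over \<open>X\<close>, the vector bundle \<open>X \<times> V\<close> is then trivial with trivial action: a
  vector \<open>v\<close> is replaced by its coordinates in the basis \<open>M i r\<close>, where \<open>r\<close> is the representative
  of the point of \<open>X\<close> on which an invariant linear form equals 1. So \<open>X \<times> V\<close> is birational to
  \<open>X \<times> k^5\<close>. Suppose also that \<open>M 5 v\<close> is isotropic for all \<open>v\<close>. Seen over \<open>V\<close>, the family
  \<open>X \<times> V\<close> is a family of quadrics with the equivariant section \<open>M 5\<close>; stereographic projection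
  from that section identifies it with \<open>V\<close> times the projective space of lines in the span of
  \<open>M 1 v, ..., M 4 v\<close>, again with trivial action on the second factor. Hence \<open>X \<times> k^5\<close> is
  birational to \<open>V \<times> k^3\<close>. These two steps make up the locale \<open>equivariant_frame\<close> and its theorem
  \<open>stably_linearizable_quadric\<close>.

  It remains to find the frames. Powers of (centred) coordinates provide equivariant maps; the
  point is the isotropic one. For the symmetric group on three letters, the map
  \<open>y \<mapsto> y_j^2 + \<kappa> (y_1^2 + y_2^2 + y_3^2)\<close> on vectors of sum zero works for a root \<open>\<kappa>\<close> of a quadratic
  equation. For five letters, the problem is to find an isotropic vector for the trace form of the
  generic quintic. Springer's theorem on odd degree extensions predicts that it exists, because the
  vectors \<open>(2\<iota>, 1, 1, 1, 1)\<close> with \<open>\<iota>^2 = -1\<close> are isotropic and form an orbit of length 5; following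
  its proof through produces the explicit formula verified in \<open>quintic_isotropic\<close>.

  Finally, linearizability as defined here includes that \<open>X\<close> is a smooth variety with a
  generically free regular action. Irreducibility is seen by joining any two points of \<open>X\<close> by a
  rational curve, and the five standard charts exhibit smoothness.
\<close>

section \<open>Sheaves of functions closed under the field operations\<close>

text \<open>
  The sheaf condition together with the closure properties of quotients of polynomials. Projective
  and affine space have them, and passing to a subset or to a product preserves them; everything
  below about morphisms is derived from these properties alone.
\<close>

definition field_sheaf :: "('p, 'k::field) fspace \<Rightarrow> bool"
  where "field_sheaf X \<longleftrightarrow> sheaf_of_functions X \<and>
    (\<forall>U W f. reg X U f \<longrightarrow> openin (zar X) W \<longrightarrow> W \<subseteq> U \<longrightarrow> reg X W f) \<and>
    (\<forall>U c. openin (zar X) U \<longrightarrow> reg X U (\<lambda>_. c)) \<and>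
    (\<forall>U f g. reg X U f \<longrightarrow> reg X U g \<longrightarrow> reg X U (\<lambda>p. f p + g p)) \<and>
    (\<forall>U f g. reg X U f \<longrightarrow> reg X U g \<longrightarrow> reg X U (\<lambda>p. f p * g p)) \<and>
    (\<forall>U f. reg X U f \<longrightarrow> openin (zar X) {p \<in> U. f p \<noteq> 0} \<and>
       reg X {p \<in> U. f p \<noteq> 0} (\<lambda>p. inverse (f p)))"

text \<open>
  In all the structures considered here, a function is regular when near every point it satisfies
  some concrete condition, such as being a quotient of two polynomials of the same degree. It
  suffices to check the closure properties for that condition.
\<close>

lemma field_sheaf_if_local:
  assumes reg: "\<And>U f. reg X U f \<longleftrightarrow> openin (zar X) U \<and>
      (\<forall>p\<in>U. \<exists>W. openin (zar X) W \<and> p \<in> W \<and> W \<subseteq> U \<and> B W f)"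
    and cong: "\<And>W f g. B W f \<Longrightarrow> (\<And>p. p \<in> W \<Longrightarrow> f p = g p) \<Longrightarrow> B W g"
    and restrict: "\<And>W W' f. B W f \<Longrightarrow> openin (zar X) W' \<Longrightarrow> W' \<subseteq> W \<Longrightarrow> B W' f"
    and const: "\<And>W c. openin (zar X) W \<Longrightarrow> B W (\<lambda>_. c)"
    and combine: "\<And>W f g. openin (zar X) W \<Longrightarrow> B W f \<Longrightarrow> B W g \<Longrightarrow>
      B W (\<lambda>p. f p + g p) \<and> B W (\<lambda>p. f p * g p)"
    and inverse: "\<And>W f. openin (zar X) W \<Longrightarrow> B W f \<Longrightarrow> openin (zar X) {p \<in> W. f p \<noteq> 0} \<and>
      B {p \<in> W. f p \<noteq> 0} (\<lambda>p. inverse (f p))"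
  shows "field_sheaf X"
proof -
  have regD: "\<exists>W. openin (zar X) W \<and> p \<in> W \<and> W \<subseteq> U \<and> B W f" if "reg X U f" "p \<in> U" for U f p
    using that(2) that(1)[unfolded reg] by blast
  have regO: "openin (zar X) U" if "reg X U f" for U f
    using that[unfolded reg] by blast
  have regI: "reg X U f" if "openin (zar X) U"
    "\<And>p. p \<in> U \<Longrightarrow> \<exists>W. openin (zar X) W \<and> p \<in> W \<and> W \<subseteq> U \<and> B W f" for U f
    unfolding reg using that by blast
  have two: "\<exists>W. openin (zar X) W \<and> p \<in> W \<and> W \<subseteq> U \<and> B W f \<and> B W g"
    if fg: "reg X U f" "reg X U g" and p: "p \<in> U" for U f g p
  proof -
    obtain W where W: "openin (zar X) W" "p \<in> W" "W \<subseteq> U" "B W f" using regD[OF fg(1) p] by blast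
    obtain W' where W': "openin (zar X) W'" "p \<in> W'" "W' \<subseteq> U" "B W' g" using regD[OF fg(2) p] by blast
    show ?thesis
      using W W' restrict[of W f "W \<inter> W'"] restrict[of W' g "W \<inter> W'"]
      by (intro exI[of _ "W \<inter> W'"]) (auto intro: openin_Int)
  qed
  have res: "reg X W f" if f: "reg X U f" and W: "openin (zar X) W" "W \<subseteq> U" for U W f
  proof (rule regI[OF W(1)])
    fix p assume p: "p \<in> W"
    obtain V where V: "openin (zar X) V" "p \<in> V" "V \<subseteq> U" "B V f"
      using regD[OF f] p W(2) by blast
    show "\<exists>W'. openin (zar X) W' \<and> p \<in> W' \<and> W' \<subseteq> W \<and> B W' f"
      using V W p restrict[of V f "V \<inter> W"] by (intro exI[of _ "V \<inter> W"]) (auto intro: openin_Int)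
  qed
  have sheaf: "sheaf_of_functions X"
    unfolding sheaf_of_functions_def
  proof (intro conjI allI impI)
    fix U f g assume f: "reg X U f" and eq: "\<forall>p\<in>U. f p = g p"
    show "reg X U g"
    proof (rule regI[OF regO[OF f]])
      fix p assume "p \<in> U"
      then obtain W where "openin (zar X) W" "p \<in> W" "W \<subseteq> U" "B W f" using regD[OF f] by blast
      then show "\<exists>W. openin (zar X) W \<and> p \<in> W \<and> W \<subseteq> U \<and> B W g"
        using eq cong[of W f g] by blast
    qed
  next
    fix U f
    show "reg X U f = (openin (zar X) U \<and>
       (\<forall>p\<in>U. \<exists>W. openin (zar X) W \<and> p \<in> W \<and> W \<subseteq> U \<and> reg X W f))" (is "_ = ?R")
    proof
      assume "reg X U f"
      then show ?R using regO by blast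
    next
      assume R: ?R
      show "reg X U f"
      proof (rule regI)
        show "openin (zar X) U" using R by blast
        fix p assume "p \<in> U"
        then obtain W where W: "openin (zar X) W" "p \<in> W" "W \<subseteq> U" "reg X W f" using R by blast
        then show "\<exists>W. openin (zar X) W \<and> p \<in> W \<and> W \<subseteq> U \<and> B W f"
          using regD[OF W(4,2)] by blast
      qed
    qed
  qed
  have inv1: "openin (zar X) {p \<in> U. f p \<noteq> 0}" if f: "reg X U f" for U f
  proof (subst openin_subopen, intro ballI)
    fix p assume p: "p \<in> {p \<in> U. f p \<noteq> 0}"
    then obtain W where "openin (zar X) W" "p \<in> W" "W \<subseteq> U" "B W f" using regD[OF f] by blast
    then show "\<exists>T. openin (zar X) T \<and> p \<in> T \<and> T \<subseteq> {p \<in> U. f p \<noteq> 0}"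
      using inverse[of W f] p by (intro exI[of _ "{p \<in> W. f p \<noteq> 0}"]) auto
  qed
  have inv2: "reg X {p \<in> U. f p \<noteq> 0} (\<lambda>p. inverse (f p))" if f: "reg X U f" for U f
  proof (rule regI[OF inv1[OF f]])
    fix p assume p: "p \<in> {p \<in> U. f p \<noteq> 0}"
    then obtain W where "openin (zar X) W" "p \<in> W" "W \<subseteq> U" "B W f" using regD[OF f] by blast
    then show "\<exists>W. openin (zar X) W \<and> p \<in> W \<and> W \<subseteq> {p \<in> U. f p \<noteq> 0} \<and> B W (\<lambda>p. inverse (f p))"
      using inverse[of W f] p by (intro exI[of _ "{p \<in> W. f p \<noteq> 0}"]) auto
  qed
  have A: "reg X U (\<lambda>p. f p + g p)" if fg: "reg X U f" "reg X U g" for U f g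
  proof (rule regI[OF regO[OF fg(1)]])
    fix p assume "p \<in> U"
    from two[OF fg this] show "\<exists>W. openin (zar X) W \<and> p \<in> W \<and> W \<subseteq> U \<and> B W (\<lambda>p. f p + g p)"
      using combine by blast
  qed
  have M: "reg X U (\<lambda>p. f p * g p)" if fg: "reg X U f" "reg X U g" for U f g
  proof (rule regI[OF regO[OF fg(1)]])
    fix p assume "p \<in> U"
    from two[OF fg this] show "\<exists>W. openin (zar X) W \<and> p \<in> W \<and> W \<subseteq> U \<and> B W (\<lambda>p. f p * g p)"
      using combine by blast
  qed
  have C: "reg X U (\<lambda>_. c)" if U: "openin (zar X) U" for U c
    by (rule regI[OF U]) (use U const in blast)
  show ?thesis
    unfolding field_sheaf_def
    by (intro conjI allI impI; (rule sheaf | erule (2) res | erule C | erule (1) A | erule (1) M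
          | erule inv1 | erule inv2))
qed

context
  fixes X :: "('p, 'k::field) fspace"
  assumes X: "field_sheaf X"
begin

lemma reg_iff_local:
  "reg X U f \<longleftrightarrow> openin (zar X) U \<and>
    (\<forall>p\<in>U. \<exists>W. openin (zar X) W \<and> p \<in> W \<and> W \<subseteq> U \<and> reg X W f)"
  by (rule X[unfolded field_sheaf_def sheaf_of_functions_def, THEN conjunct1, THEN conjunct2,
        THEN spec, THEN spec])

lemma reg_open: "reg X U f \<Longrightarrow> openin (zar X) U"
  by (rule iffD1[OF reg_iff_local, THEN conjunct1])

lemma reg_cong: "reg X U f \<Longrightarrow> (\<And>p. p \<in> U \<Longrightarrow> f p = g p) \<Longrightarrow> reg X U g"
  using X[unfolded field_sheaf_def sheaf_of_functions_def, THEN conjunct1, THEN conjunct1] by blast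

lemma reg_restrict: "reg X U f \<Longrightarrow> openin (zar X) W \<Longrightarrow> W \<subseteq> U \<Longrightarrow> reg X W f"
  by (rule X[unfolded field_sheaf_def, THEN conjunct2, THEN conjunct1, rule_format])

lemma reg_glue:
  assumes "openin (zar X) U"
    and "\<And>p. p \<in> U \<Longrightarrow> \<exists>W. openin (zar X) W \<and> p \<in> W \<and> W \<subseteq> U \<and> reg X W f"
  shows "reg X U f"
  by (rule iffD2[OF reg_iff_local]) (intro conjI ballI assms)

lemma reg_const: "openin (zar X) U \<Longrightarrow> reg X U (\<lambda>_. c)"
  by (rule X[unfolded field_sheaf_def, THEN conjunct2, THEN conjunct2, THEN conjunct1, rule_format])

lemma reg_add: "reg X U f \<Longrightarrow> reg X U g \<Longrightarrow> reg X U (\<lambda>p. f p + g p)"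
  by (rule X[unfolded field_sheaf_def, THEN conjunct2, THEN conjunct2, THEN conjunct2, THEN conjunct1, rule_format])

lemma reg_mult: "reg X U f \<Longrightarrow> reg X U g \<Longrightarrow> reg X U (\<lambda>p. f p * g p)"
  by (rule X[unfolded field_sheaf_def, THEN conjunct2, THEN conjunct2, THEN conjunct2, THEN conjunct2, THEN conjunct1, rule_format])

lemma open_nonzero: "reg X U f \<Longrightarrow> openin (zar X) {p \<in> U. f p \<noteq> 0}"
  by (rule X[unfolded field_sheaf_def, THEN conjunct2, THEN conjunct2, THEN conjunct2, THEN conjunct2, THEN conjunct2, THEN spec, THEN spec, THEN mp, THEN conjunct1, rule_format])

lemma reg_divide:
  assumes "reg X U f" "reg X U g" "\<And>p. p \<in> U \<Longrightarrow> g p \<noteq> 0"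
  shows "reg X U (\<lambda>p. f p / g p)"
proof -
  have "{p \<in> U. g p \<noteq> 0} = U" using assms(3) by blast
  then have "reg X U (\<lambda>p. inverse (g p))"
    using X[unfolded field_sheaf_def, THEN conjunct2, THEN conjunct2, THEN conjunct2, THEN conjunct2,
        THEN conjunct2, THEN spec, THEN spec, THEN mp, THEN conjunct2, OF assms(2)] by simp
  from reg_mult[OF assms(1) this] show ?thesis by (simp add: divide_inverse)
qed

lemma reg_diff:
  assumes "reg X U f" "reg X U g"
  shows "reg X U (\<lambda>p. f p - g p)"
  using reg_add[OF assms(1) reg_mult[OF reg_const[OF reg_open[OF assms(1)], of "-1"] assms(2)]]
  by simp

lemma reg_sum:
  assumes "openin (zar X) U" "\<And>i. i \<in> A \<Longrightarrow> reg X U (f i)"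
  shows "reg X U (\<lambda>p. \<Sum>i\<in>A. f i p)"
  using assms(2)
proof (induction A rule: infinite_finite_induct)
  case (insert i A)
  then show ?case using reg_add[of U "f i" "\<lambda>p. \<Sum>i\<in>A. f i p"] by simp
qed (simp_all add: reg_const[OF assms(1)])

lemma reg_poly_fun:
  assumes "poly_fun I F" "openin (zar X) U" "\<And>i. i \<in> I \<Longrightarrow> reg X U (\<lambda>p. g p i)"
  shows "reg X U (\<lambda>p. F (g p))"
  using assms(1) by induction (auto intro: reg_const reg_add reg_mult assms)

end

text \<open>
  All topologies here are generated by nonvanishing loci, and continuity need only be tested on such
  loci, locally around each point.
\<close>

lemma continuous_map_generated_local:
  assumes "f ` topspace T \<subseteq> \<Union>S"
    and "\<And>U p. U \<in> S \<Longrightarrow> p \<in> topspace T \<Longrightarrow> f p \<in> U \<Longrightarrow>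
      \<exists>W. openin T W \<and> p \<in> W \<and> (\<forall>q\<in>W. f q \<in> U)"
  shows "continuous_map T (topology_generated_by S) f"
proof (rule continuous_on_generated_topo)
  fix U assume U: "U \<in> S"
  show "openin T (f -` U \<inter> topspace T)"
  proof (subst openin_subopen, intro ballI)
    fix p assume "p \<in> f -` U \<inter> topspace T"
    then obtain W where "openin T W" "p \<in> W" "\<forall>q\<in>W. f q \<in> U" using assms(2)[OF U, of p] by blast
    then show "\<exists>W. openin T W \<and> p \<in> W \<and> W \<subseteq> f -` U \<inter> topspace T"
      using openin_subset by blast
  qed
qed (rule assms(1))

section \<open>Polynomial functions, lines and projective space\<close>

lemma poly_fun_uminus: "poly_fun I F \<Longrightarrow> poly_fun I (\<lambda>x. - F x)"
  using poly_fun.mult[OF poly_fun.const[of I "-1"]] by simp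

lemma poly_fun_diff: "poly_fun I F \<Longrightarrow> poly_fun I H \<Longrightarrow> poly_fun I (\<lambda>x. F x - H x)"
  using poly_fun.add[of I F, OF _ poly_fun_uminus[of I H]] by simp

lemma poly_fun_sum: "(\<And>i. i \<in> A \<Longrightarrow> poly_fun I (F i)) \<Longrightarrow> poly_fun I (\<lambda>x. \<Sum>i\<in>A. F i x)"
  by (induction A rule: infinite_finite_induct) (auto intro: poly_fun.intros)

lemma poly_fun_prod: "(\<And>i. i \<in> A \<Longrightarrow> poly_fun I (F i)) \<Longrightarrow> poly_fun I (\<lambda>x. \<Prod>i\<in>A. F i x)"
  by (induction A rule: infinite_finite_induct) (auto intro: poly_fun.intros)

lemma poly_fun_power: "poly_fun I F \<Longrightarrow> poly_fun I (\<lambda>x. F x ^ n)"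
  by (induction n) (auto intro: poly_fun.intros)

lemmas poly_fun_intros = poly_fun.intros poly_fun_uminus poly_fun_diff poly_fun_sum poly_fun_prod
  poly_fun_power

lemma homogeneous_fun_mult:
  "homogeneous_fun I d F \<Longrightarrow> homogeneous_fun I e H \<Longrightarrow> homogeneous_fun I (d + e) (\<lambda>x. F x * H x)"
  unfolding homogeneous_fun_def by (auto intro: poly_fun.mult simp: power_add)

lemma homogeneous_fun_add:
  "homogeneous_fun I d F \<Longrightarrow> homogeneous_fun I d H \<Longrightarrow> homogeneous_fun I d (\<lambda>x. F x + H x)"
  unfolding homogeneous_fun_def by (auto intro: poly_fun.add simp: algebra_simps)

lemma homogeneous_fun_const: "homogeneous_fun I 0 (\<lambda>_. c)"
  unfolding homogeneous_fun_def by (auto intro: poly_fun.const)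

lemma homogeneous_fun_coord: "i \<in> I \<Longrightarrow> homogeneous_fun I 1 (\<lambda>x. x i)"
  unfolding homogeneous_fun_def by (auto intro: poly_fun.coord)

lemma mem_line: "x \<in> line x"
  unfolding line_def by (rule range_eqI[of _ _ 1]) simp

lemma line_smult:
  assumes c: "c \<noteq> 0"
  shows "line (\<lambda>i. c * x i) = line x"
proof
  show "line (\<lambda>i. c * x i) \<subseteq> line x"
    unfolding line_def by (auto simp: mult.assoc[symmetric])
  show "line x \<subseteq> line (\<lambda>i. c * x i)"
  proof
    fix y assume "y \<in> line x"
    then obtain e where "y = (\<lambda>i. e * x i)" unfolding line_def by auto
    then have "y = (\<lambda>i. (e / c) * (c * x i))" using c by simp
    then show "y \<in> line (\<lambda>i. c * x i)" unfolding line_def by blast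
  qed
qed

lemma line_eqD:
  assumes "line x = line y" "x \<noteq> (\<lambda>_. 0)"
  shows "\<exists>c. c \<noteq> 0 \<and> y = (\<lambda>i. c * x i)"
proof -
  obtain c where c: "y = (\<lambda>i. c * x i)" using mem_line[of y] assms(1) unfolding line_def by auto
  obtain e where e: "x = (\<lambda>i. e * y i)" using mem_line[of x] assms(1) unfolding line_def by auto
  show ?thesis
  proof (cases "c = 0")
    case True
    then have "x = (\<lambda>_. 0)" using c e by simp
    with assms(2) show ?thesis by simp
  qed (use c in blast)
qed

lemma homogeneous_nonzero_line:
  assumes "homogeneous_fun I d F" "line x = line y" "x \<noteq> (\<lambda>_. 0)"
  shows "F x \<noteq> 0 \<longleftrightarrow> F y \<noteq> 0"
  using line_eqD[OF assms(2,3)] assms(1) unfolding homogeneous_fun_def by auto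

lemma coord_space_smult: "x \<in> coord_space I \<Longrightarrow> (\<lambda>i. c * x i) \<in> coord_space I"
  unfolding coord_space_def by simp

lemma zar_projective [simp]: "zar (projective_space I) = projective_zar I"
  unfolding projective_space_def by simp

lemma points_projective:
  "topspace (projective_zar I :: (nat \<Rightarrow> 'k::field) set topology) = {line x |x. x \<in> coord_space I \<and> x \<noteq> (\<lambda>_. 0)}"
proof
  show "topspace (projective_zar I :: (nat \<Rightarrow> 'k) set topology) \<subseteq> {line x |x. x \<in> coord_space I \<and> x \<noteq> (\<lambda>_. 0)}"
    unfolding projective_zar_def topology_generated_by_topspace by blast
  have "openin (projective_zar I) {line (x::nat \<Rightarrow> 'k) |x. x \<in> coord_space I \<and> x \<noteq> (\<lambda>_. 0) \<and> (1::'k) \<noteq> 0}"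
    unfolding projective_zar_def
    by (rule topology_generated_by_Basis, rule CollectI, rule exI[of _ "\<lambda>_. 1"], rule conjI[OF refl],
        rule exI[of _ 0], rule homogeneous_fun_const)
  from openin_subset[OF this]
  show "{line x |x. x \<in> coord_space I \<and> x \<noteq> (\<lambda>_. 0::'k)} \<subseteq> topspace (projective_zar I)" by simp
qed

lemma line_in_points: "x \<in> coord_space I \<Longrightarrow> x \<noteq> (\<lambda>_. 0) \<Longrightarrow> line x \<in> topspace (projective_zar I)"
  unfolding points_projective by blast

lemma open_projective:
  assumes "homogeneous_fun I d F"
  shows "openin (projective_zar I) {line x |x. x \<in> coord_space I \<and> x \<noteq> (\<lambda>_. 0) \<and> F x \<noteq> 0}"
  unfolding projective_zar_def
  by (rule topology_generated_by_Basis, rule CollectI, rule exI[of _ F], rule conjI[OF refl],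
      rule exI[of _ d], rule assms)

lemma field_sheaf_projective: "field_sheaf (projective_space I :: ((nat \<Rightarrow> 'k::field) set, 'k) fspace)"
proof (rule field_sheaf_if_local[where B="\<lambda>W f. \<exists>d F H. homogeneous_fun I d F \<and> homogeneous_fun I d H \<and>
        (\<forall>x\<in>coord_space I. x \<noteq> (\<lambda>_. 0) \<longrightarrow> line x \<in> W \<longrightarrow>
           H x \<noteq> 0 \<and> f (line x) = F x / H x)"], goal_cases)
  case (1 U f)
  then show ?case unfolding projective_space_def by auto
next
  case (2 W f g)
  then show ?case by metis
next
  case (3 W W' f)
  then show ?case by (metis subset_iff)
next
  case (4 W c)
  then show ?case
    using homogeneous_fun_const[of I c] homogeneous_fun_const[of I 1] by fastforce
next
  case (5 W f g)
  then obtain d F H e F' H' where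
    *: "homogeneous_fun I d F" "homogeneous_fun I d H" "homogeneous_fun I e F'" "homogeneous_fun I e H'"
    "\<forall>x\<in>coord_space I. x \<noteq> (\<lambda>_. 0) \<longrightarrow> line x \<in> W \<longrightarrow> H x \<noteq> 0 \<and> f (line x) = F x / H x"
    "\<forall>x\<in>coord_space I. x \<noteq> (\<lambda>_. 0) \<longrightarrow> line x \<in> W \<longrightarrow> H' x \<noteq> 0 \<and> g (line x) = F' x / H' x"
    by blast
  show ?case
  proof (intro conjI, goal_cases)
    case 1
    show ?case
      using * homogeneous_fun_mult[OF *(2,4)]
        homogeneous_fun_add[OF homogeneous_fun_mult[OF *(1,4)] homogeneous_fun_mult[OF *(2,3)]]
      by (intro exI[of _ "d + e"] exI[of _ "\<lambda>x. F x * H' x + H x * F' x"] exI[of _ "\<lambda>x. H x * H' x"])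
         (auto simp: field_simps)
  next
    case 2
    show ?case
      using * homogeneous_fun_mult[OF *(2,4)] homogeneous_fun_mult[OF *(1,3)]
      by (intro exI[of _ "d + e"] exI[of _ "\<lambda>x. F x * F' x"] exI[of _ "\<lambda>x. H x * H' x"]) auto
  qed
next
  case (6 W f)
  then obtain d F H where
    *: "homogeneous_fun I d F" "homogeneous_fun I d H"
    "\<And>x. x\<in>coord_space I \<Longrightarrow> x \<noteq> (\<lambda>_. 0) \<Longrightarrow> line x \<in> W \<Longrightarrow> H x \<noteq> 0 \<and> f (line x) = F x / H x"
    by blast
  have W: "W \<subseteq> topspace (projective_zar I)" using 6 openin_subset by fastforce
  have "{p \<in> W. f p \<noteq> 0} = W \<inter> {line x |x. x \<in> coord_space I \<and> x \<noteq> (\<lambda>_. 0) \<and> F x \<noteq> 0}"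
    using W * unfolding points_projective by fastforce
  then have "openin (projective_zar I) {p \<in> W. f p \<noteq> 0}"
    using 6 open_projective[OF *(1)] by (auto intro: openin_Int)
  moreover have "F x \<noteq> 0 \<and> inverse (f (line x)) = H x / F x"
    if "x \<in> coord_space I" "x \<noteq> (\<lambda>_. 0)" "line x \<in> {p \<in> W. f p \<noteq> 0}" for x
    using *(3)[of x] that by auto
  ultimately show ?case using *(1,2) by auto
qed

text \<open>
  The function on projective space given by a quotient of homogeneous functions of equal degree. It
  is evaluated at an arbitrary spanning vector of the line.
\<close>

definition hquot :: "((nat \<Rightarrow> 'k::field) \<Rightarrow> 'k) \<Rightarrow> ((nat \<Rightarrow> 'k) \<Rightarrow> 'k) \<Rightarrow> (nat \<Rightarrow> 'k) set \<Rightarrow> 'k"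
  where "hquot F H L = (let x = (SOME x. x \<noteq> (\<lambda>_. 0) \<and> L = line x) in F x / H x)"

lemma hquot_line:
  assumes "homogeneous_fun I d F" "homogeneous_fun I d H" "x \<noteq> (\<lambda>_. 0)"
  shows "hquot F H (line x) = F x / H x"
proof -
  define y where "y = (SOME y. y \<noteq> (\<lambda>_. 0) \<and> line x = line y)"
  have "y \<noteq> (\<lambda>_. 0) \<and> line x = line y"
    unfolding y_def by (rule someI[of _ x]) (use assms in simp)
  \<comment> \<open>Both degrees are equal, so the factor relating the two spanning vectors cancels.\<close>
  then obtain c where c: "c \<noteq> 0" "y = (\<lambda>i. c * x i)" using line_eqD assms(3) by blast
  have "F y / H y = F x / H x" using assms(1,2) c unfolding homogeneous_fun_def by simp
  then show ?thesis unfolding hquot_def y_def[symmetric] Let_def .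
qed

lemma reg_hquot:
  assumes "homogeneous_fun I d F" "homogeneous_fun I d H"
  shows "reg (projective_space I) {line x |x. x \<in> coord_space I \<and> x \<noteq> (\<lambda>_. 0) \<and> H x \<noteq> 0} (hquot F H)"
proof -
  define U where "U = {line x |x. x \<in> coord_space I \<and> x \<noteq> (\<lambda>_. 0) \<and> H x \<noteq> 0}"
  have "H x \<noteq> 0 \<and> hquot F H (line x) = F x / H x"
    if x: "x \<in> coord_space I" "x \<noteq> (\<lambda>_. 0)" "line x \<in> U" for x
  proof -
    obtain y where y: "line x = line y" "H y \<noteq> 0" using x(3) unfolding U_def by blast
    then show ?thesis
      using homogeneous_nonzero_line[OF assms(2) y(1) x(2)] hquot_line[OF assms x(2)] by simp
  qed
  moreover have "openin (projective_zar I) U" using open_projective[OF assms(2)] unfolding U_def .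
  ultimately show ?thesis
    using assms unfolding projective_space_def U_def[symmetric]
    by simp (rule ballI, rule exI[of _ U], rule conjI, assumption, rule conjI, assumption, rule conjI,
        rule order_refl, rule exI[of _ d], rule exI[of _ F], rule conjI, assumption, rule exI[of _ H], simp)
qed

section \<open>Affine space and subspaces\<close>

lemma zar_affine [simp]: "zar (affine_space I) = affine_zar I"
  unfolding affine_space_def by simp

lemma points_affine: "topspace (affine_zar I :: (nat \<Rightarrow> 'k::field) topology) = coord_space I"
proof
  show "topspace (affine_zar I :: (nat \<Rightarrow> 'k) topology) \<subseteq> coord_space I"
    unfolding affine_zar_def topology_generated_by_topspace by blast
  have "openin (affine_zar I) {x :: nat \<Rightarrow> 'k. x \<in> coord_space I \<and> (1::'k) \<noteq> 0}"
    unfolding affine_zar_def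
    by (rule topology_generated_by_Basis, rule CollectI, rule exI[of _ "\<lambda>_. 1"], rule conjI[OF refl],
        rule poly_fun.const)
  from openin_subset[OF this]
  show "coord_space I \<subseteq> topspace (affine_zar I :: (nat \<Rightarrow> 'k) topology)" by simp
qed

lemma open_affine:
  assumes "poly_fun I F"
  shows "openin (affine_zar I) {x \<in> coord_space I. F x \<noteq> 0}"
  unfolding affine_zar_def
  by (rule topology_generated_by_Basis, rule CollectI, rule exI[of _ F], rule conjI[OF refl], rule assms)

lemma field_sheaf_affine: "field_sheaf (affine_space I :: (nat \<Rightarrow> 'k::field, 'k) fspace)"
proof (rule field_sheaf_if_local[where B="\<lambda>W f. \<exists>F H. poly_fun I F \<and> poly_fun I H \<and>
        (\<forall>x\<in>W. H x \<noteq> 0 \<and> f x = F x / H x)"], goal_cases)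
  case (1 U f)
  then show ?case unfolding affine_space_def by auto
next
  case (2 W f g)
  then show ?case by metis
next
  case (3 W W' f)
  then show ?case by (metis subset_iff)
next
  case (4 W c)
  then show ?case using poly_fun.const[of I c] poly_fun.const[of I 1] by fastforce
next
  case (5 W f g)
  then obtain F H F' H' where
    *: "poly_fun I F" "poly_fun I H" "poly_fun I F'" "poly_fun I H'"
    "\<forall>x\<in>W. H x \<noteq> 0 \<and> f x = F x / H x" "\<forall>x\<in>W. H' x \<noteq> 0 \<and> g x = F' x / H' x"
    by blast
  show ?case
  proof (intro conjI, goal_cases)
    case 1
    show ?case
      using * by (intro exI[of _ "\<lambda>x. F x * H' x + H x * F' x"] exI[of _ "\<lambda>x. H x * H' x"])
         (auto simp: field_simps intro: poly_fun.intros)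
  next
    case 2
    show ?case
      using * by (intro exI[of _ "\<lambda>x. F x * F' x"] exI[of _ "\<lambda>x. H x * H' x"])
         (auto intro: poly_fun.intros)
  qed
next
  case (6 W f)
  then obtain F H where *: "poly_fun I F" "poly_fun I H" "\<And>x. x\<in>W \<Longrightarrow> H x \<noteq> 0 \<and> f x = F x / H x"
    by blast
  have "W \<subseteq> coord_space I" using 6 openin_subset points_affine by fastforce
  then have "{p \<in> W. f p \<noteq> 0} = W \<inter> {x \<in> coord_space I. F x \<noteq> 0}" using *(3) by auto
  then have "openin (affine_zar I) {p \<in> W. f p \<noteq> 0}"
    using 6 open_affine[OF *(1)] by (auto intro: openin_Int)
  moreover have "F x \<noteq> 0 \<and> inverse (f x) = H x / F x" if "x \<in> {p \<in> W. f p \<noteq> 0}" for x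
    using *(3)[of x] that by auto
  ultimately show ?case using *(1,2) by auto
qed

lemma reg_coord_affine:
  assumes "i \<in> I"
  shows "reg (affine_space I) (coord_space I) (\<lambda>x::nat\<Rightarrow>'k::field. x i)"
proof -
  have o: "openin (affine_zar I) (coord_space I :: (nat\<Rightarrow>'k) set)"
    using openin_topspace[of "affine_zar I"] unfolding points_affine .
  have "\<forall>p\<in>coord_space I :: (nat \<Rightarrow> 'k) set. \<exists>W F H. openin (affine_zar I) W \<and> p \<in> W \<and> W \<subseteq> coord_space I \<and>
      poly_fun I F \<and> poly_fun I H \<and> (\<forall>x\<in>W. H x \<noteq> 0 \<and> x i = F x / H x)"
    by (intro ballI, rule exI[of _ "coord_space I"], rule exI[of _ "\<lambda>x. x i"],
        rule exI[of _ "\<lambda>_. 1"]) (simp add: o poly_fun.coord[OF assms] poly_fun.const)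
  then show ?thesis unfolding affine_space_def using o by simp
qed

lemma zar_subspace [simp]: "zar (subspace_of X Z) = subtopology (zar X) Z"
  unfolding subspace_of_def by simp

lemma field_sheaf_subspace:
  assumes X: "field_sheaf X"
  shows "field_sheaf (subspace_of X Z)"
proof (rule field_sheaf_if_local[where B="\<lambda>W f. \<exists>V g. openin (zar X) V \<and> W = V \<inter> Z \<and>
   reg X V g \<and> (\<forall>q\<in>W. f q = g q)"], goal_cases)
  case (1 U f)
  show ?case (is "_ = (?A \<and> ?C)")
  proof
    assume l: "reg (subspace_of X Z) U f"
    then have A: ?A unfolding subspace_of_def by simp
    have ?C
    proof
      fix p assume p: "p \<in> U"
      then obtain W g where W: "openin (zar X) W" "p \<in> W" "W \<inter> Z \<subseteq> U" "reg X W g" "\<forall>q\<in>W \<inter> Z. f q = g q"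
        using l unfolding subspace_of_def by auto
      have "p \<in> Z" using A p openin_subset by fastforce
      then show "\<exists>W. openin (zar (subspace_of X Z)) W \<and> p \<in> W \<and> W \<subseteq> U \<and>
         (\<exists>V g. openin (zar X) V \<and> W = V \<inter> Z \<and> reg X V g \<and> (\<forall>q\<in>W. f q = g q))"
        using W by (intro exI[of _ "W \<inter> Z"]) (auto simp: openin_subtopology)
    qed
    with A show "?A \<and> ?C" by simp
  next
    assume r: "?A \<and> ?C"
    then show "reg (subspace_of X Z) U f"
      unfolding subspace_of_def by auto (metis Int_iff)
  qed
next
  case (2 W f g)
  then show ?case by metis
next
  case (3 W W' f)
  then obtain V g where V: "openin (zar X) V" "W = V \<inter> Z" "reg X V g" "\<forall>q\<in>W. f q = g q" by blast
  obtain V' where V': "openin (zar X) V'" "W' = V' \<inter> Z" using 3 by (auto simp: openin_subtopology)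
  show ?case
    using V V' 3 reg_restrict[OF X V(3), of "V \<inter> V'"]
    by (intro exI[of _ "V \<inter> V'"] exI[of _ g]) (auto intro: openin_Int)
next
  case (4 W c)
  then show ?case using reg_const[OF X] by (auto simp: openin_subtopology)
next
  case (5 W f g)
  then obtain V f' V' g' where
    V: "openin (zar X) V" "W = V \<inter> Z" "reg X V f'" "\<forall>q\<in>W. f q = f' q"
    "openin (zar X) V'" "W = V' \<inter> Z" "reg X V' g'" "\<forall>q\<in>W. g q = g' q" by blast
  show ?case
  proof (intro conjI, goal_cases)
    case 1
    show ?case
      using V reg_add[OF X reg_restrict[OF X V(3), of "V \<inter> V'"] reg_restrict[OF X V(7), of "V \<inter> V'"]]
      by (intro exI[of _ "V \<inter> V'"] exI[of _ "\<lambda>p. f' p + g' p"]) (auto intro: openin_Int)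
  next
    case 2
    show ?case
      using V reg_mult[OF X reg_restrict[OF X V(3), of "V \<inter> V'"] reg_restrict[OF X V(7), of "V \<inter> V'"]]
      by (intro exI[of _ "V \<inter> V'"] exI[of _ "\<lambda>p. f' p * g' p"]) (auto intro: openin_Int)
  qed
next
  case (6 W f)
  then obtain V g where V: "openin (zar X) V" "W = V \<inter> Z" "reg X V g" "\<forall>q\<in>W. f q = g q" by blast
  let ?V = "{p \<in> V. g p \<noteq> 0}"
  have eq: "{p \<in> W. f p \<noteq> 0} = ?V \<inter> Z" using V by auto
  have o: "openin (zar X) ?V" using open_nonzero[OF X V(3)] .
  have "reg X ?V (\<lambda>p. 1 / g p)"
    by (rule reg_divide[OF X reg_const[OF X o] reg_restrict[OF X V(3) o]]) auto
  then show ?case using o V unfolding eq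
    by (auto simp: openin_subtopology inverse_eq_divide intro!: exI[of _ ?V] exI[of _ "\<lambda>p. 1 / g p"])
qed

lemma reg_subspace:
  assumes X: "field_sheaf X" and f: "reg X U f"
  shows "reg (subspace_of X Z) (U \<inter> Z) f"
  using f reg_open[OF X f] unfolding subspace_of_def by (auto simp: openin_subtopology)

text \<open>
  On an open subset the induced structure is the restriction of the ambient one. This is what allows
  regular functions on the domain of a birational map to be computed in the ambient variety.
\<close>

lemma reg_open_subspace:
  assumes X: "field_sheaf X" and V: "openin (zar X) V"
  shows "reg (subspace_of X V) U f \<longleftrightarrow> U \<subseteq> V \<and> reg X U f"
proof
  assume l: "reg (subspace_of X V) U f"
  then have o: "openin (subtopology (zar X) V) U" unfolding subspace_of_def by simp
  then have U: "openin (zar X) U" "U \<subseteq> V"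
    using V by (auto simp: openin_open_subtopology)
  have "reg X U f"
  proof (rule reg_glue[OF X U(1)])
    fix p assume p: "p \<in> U"
    then obtain W g where W: "openin (zar X) W" "p \<in> W" "W \<inter> V \<subseteq> U" "reg X W g" "\<forall>q\<in>W \<inter> V. f q = g q"
      using l unfolding subspace_of_def by auto
    have "reg X (W \<inter> V) f"
      using reg_cong[OF X reg_restrict[OF X W(4), of "W \<inter> V"], of f] W V by (auto intro: openin_Int)
    then show "\<exists>W. openin (zar X) W \<and> p \<in> W \<and> W \<subseteq> U \<and> reg X W f"
      using W V U p by (intro exI[of _ "W \<inter> V"]) (auto intro: openin_Int)
  qed
  with U show "U \<subseteq> V \<and> reg X U f" by simp
next
  assume "U \<subseteq> V \<and> reg X U f"
  then show "reg (subspace_of X V) U f"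
    using reg_subspace[OF X, of U f V] by (simp add: Int_absorb2)
qed

section \<open>Products\<close>

lemma zar_product [simp]: "zar (product_of X Y) = product_zar X Y"
  unfolding product_of_def by simp

lemma box_function_const:
  assumes "field_sheaf X" "field_sheaf Y" "openin (zar X) U" "openin (zar Y) V"
  shows "box_function X U Y V (\<lambda>_. c)"
  unfolding box_function_def
  using reg_const[OF assms(1,3), of c] reg_const[OF assms(2,4), of 1]
  by (intro exI[of _ 1] exI[of _ "\<lambda>_ _. c"] exI[of _ "\<lambda>_ _. 1"]) auto

lemma box_function_fst:
  assumes "field_sheaf X" "field_sheaf Y" "reg X U f" "openin (zar Y) V"
  shows "box_function X U Y V (\<lambda>z. f (fst z))"
  unfolding box_function_def
  using reg_const[OF assms(2,4), of 1] assms
  by (intro exI[of _ 1] exI[of _ "\<lambda>_. f"] exI[of _ "\<lambda>_ _. 1"]) auto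

lemma box_function_snd:
  assumes "field_sheaf X" "field_sheaf Y" "openin (zar X) U" "reg Y V f"
  shows "box_function X U Y V (\<lambda>z. f (snd z))"
  unfolding box_function_def
  using reg_const[OF assms(1,3), of 1] assms
  by (intro exI[of _ 1] exI[of _ "\<lambda>_ _. 1"] exI[of _ "\<lambda>_. f"]) auto

lemma box_function_restrict:
  assumes "field_sheaf X" "field_sheaf Y" "box_function X U Y V h"
    "openin (zar X) U'" "openin (zar Y) V'" "U' \<subseteq> U" "V' \<subseteq> V"
  shows "box_function X U' Y V' h"
proof -
  obtain n :: nat and f g where "\<forall>i<n. reg X U (f i) \<and> reg Y V (g i)"
    "\<forall>p\<in>U. \<forall>q\<in>V. h (p, q) = (\<Sum>i<n. f i p * g i q)" using assms(3) unfolding box_function_def by blast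
  then show ?thesis
    unfolding box_function_def using reg_restrict[OF assms(1)] reg_restrict[OF assms(2)] assms(4-)
    by (intro exI[of _ n] exI[of _ f] exI[of _ g]) blast
qed

lemma box_function_cong:
  assumes "box_function X U Y V h" "\<And>p q. p \<in> U \<Longrightarrow> q \<in> V \<Longrightarrow> h (p, q) = h' (p, q)"
  shows "box_function X U Y V h'"
proof -
  obtain n :: nat and f g where "\<forall>i<n. reg X U (f i) \<and> reg Y V (g i)"
    "\<forall>p\<in>U. \<forall>q\<in>V. h (p, q) = (\<Sum>i<n. f i p * g i q)" using assms(1) unfolding box_function_def by blast
  then show ?thesis
    unfolding box_function_def using assms(2) by (intro exI[of _ n] exI[of _ f] exI[of _ g]) simp
qed

lemma box_function_add:
  assumes "box_function X U Y V h" "box_function X U Y V h'"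
  shows "box_function X U Y V (\<lambda>z. h z + h' z)"
proof -
  obtain n :: nat and f g where 1: "\<forall>i<n. reg X U (f i) \<and> reg Y V (g i)"
    "\<forall>p\<in>U. \<forall>q\<in>V. h (p, q) = (\<Sum>i<n. f i p * g i q)" using assms(1) unfolding box_function_def by blast
  obtain m :: nat and f' g' where 2: "\<forall>i<m. reg X U (f' i) \<and> reg Y V (g' i)"
    "\<forall>p\<in>U. \<forall>q\<in>V. h' (p, q) = (\<Sum>i<m. f' i p * g' i q)" using assms(2) unfolding box_function_def by blast
  let ?f = "\<lambda>i. if i < n then f i else f' (i - n)" and ?g = "\<lambda>i. if i < n then g i else g' (i - n)"
  have "(\<Sum>i<n+m. ?f i p * ?g i q) = (\<Sum>i<n. f i p * g i q) + (\<Sum>i<m. f' i p * g' i q)" for p q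
  proof -
    have "(\<Sum>i<n+m. ?f i p * ?g i q) = (\<Sum>i<n. ?f i p * ?g i q) + (\<Sum>i<m. ?f (n + i) p * ?g (n + i) q)"
      by (induction m) (auto simp: add.assoc)
    then show ?thesis by simp
  qed
  then show ?thesis
    unfolding box_function_def using 1 2
    by (intro exI[of _ "n + m"] exI[of _ ?f] exI[of _ ?g]) auto
qed

text \<open>
  A product of two finite sums of products is again such a sum; multiplying one term of the first
  sum at a time avoids indexing by pairs.
\<close>

lemma box_function_mult:
  assumes X: "field_sheaf X" and Y: "field_sheaf Y"
    and "box_function X U Y V h" "box_function X U Y V h'" "openin (zar X) U" "openin (zar Y) V"
  shows "box_function X U Y V (\<lambda>z. h z * h' z)"
proof -
  obtain n :: nat and f g where 1: "\<forall>i<n. reg X U (f i) \<and> reg Y V (g i)"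
    "\<forall>p\<in>U. \<forall>q\<in>V. h (p, q) = (\<Sum>i<n. f i p * g i q)" using assms(3) unfolding box_function_def by blast
  obtain m :: nat and f' g' where 2: "\<forall>i<m. reg X U (f' i) \<and> reg Y V (g' i)"
    "\<forall>p\<in>U. \<forall>q\<in>V. h' (p, q) = (\<Sum>i<m. f' i p * g' i q)" using assms(4) unfolding box_function_def by blast
  have "box_function X U Y V (\<lambda>z. (\<Sum>i<k. f i (fst z) * g i (snd z)) * h' z)" if "k \<le> n" for k
    using that
  proof (induction k)
    case 0
    then show ?case using box_function_const[OF X Y assms(5,6), of 0] by simp
  next
    case (Suc k)
    have "box_function X U Y V (\<lambda>z. (f k (fst z) * g k (snd z)) * h' z)"
      unfolding box_function_def using 1 2 Suc.prems
      by (intro exI[of _ m] exI[of _ "\<lambda>i p. f k p * f' i p"] exI[of _ "\<lambda>i p. g k p * g' i p"])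
         (auto intro!: reg_mult X Y simp: sum_distrib_left mult_ac)
    from box_function_add[OF Suc.IH this] Suc.prems show ?case
      by (simp add: algebra_simps)
  qed
  from this[OF order_refl] show ?thesis
    by (rule box_function_cong) (use 1 in auto)
qed

lemma product_zar_boxes:
  "openin (zar X) U \<Longrightarrow> openin (zar Y) V \<Longrightarrow> box_function X U Y V h \<Longrightarrow>
    openin (product_zar X Y) {z \<in> U \<times> V. h z \<noteq> 0}"
  unfolding product_zar_def by (rule topology_generated_by_Basis, rule CollectI, rule exI[of _ U], rule exI[of _ V],
      rule exI[of _ h]) simp

lemma open_Times:
  assumes "field_sheaf X" "field_sheaf Y" "openin (zar X) U" "openin (zar Y) V"
  shows "openin (product_zar X Y) (U \<times> V)"
  using product_zar_boxes[OF assms(3,4) box_function_const[OF assms, of 1]] by simp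

lemma points_product:
  assumes "field_sheaf X" "field_sheaf Y"
  shows "topspace (product_zar X Y) = points X \<times> points Y"
proof
  show "topspace (product_zar X Y) \<subseteq> points X \<times> points Y"
    unfolding product_zar_def topology_generated_by_topspace
    using openin_subset[of "zar X"] openin_subset[of "zar Y"] by blast
  show "points X \<times> points Y \<subseteq> topspace (product_zar X Y)"
    using openin_subset[OF open_Times[OF assms openin_topspace openin_topspace]] .
qed

lemma field_sheaf_product:
  assumes X: "field_sheaf X" and Y: "field_sheaf Y"
  shows "field_sheaf (product_of X Y)"
proof (rule field_sheaf_if_local[where B="\<lambda>W f. \<exists>U V h h'. W \<subseteq> U \<times> V \<and>
        openin (zar X) U \<and> openin (zar Y) V \<and>
        box_function X U Y V h \<and> box_function X U Y V h' \<and>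
        (\<forall>w\<in>W. h' w \<noteq> 0 \<and> f w = h w / h' w)"], goal_cases)
  case (1 U f)
  show ?case unfolding product_of_def by simp
next
  case (2 W f g)
  then show ?case by metis
next
  case (3 W W' f)
  then show ?case by (metis subset_iff)
next
  case (4 W c)
  have "W \<subseteq> points X \<times> points Y" using openin_subset[OF 4] by (simp add: points_product[OF X Y])
  then show ?case
    using box_function_const[OF X Y openin_topspace openin_topspace, of c]
      box_function_const[OF X Y openin_topspace openin_topspace, of 1]
    by (intro exI[of _ "points X"] exI[of _ "points Y"] exI[of _ "\<lambda>_. c"] exI[of _ "\<lambda>_. 1"]) auto
next
  case (5 W f g)
  then obtain U V h h' U' V' k k' where
    *: "W \<subseteq> U \<times> V" "openin (zar X) U" "openin (zar Y) V" "box_function X U Y V h" "box_function X U Y V h'"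
    "\<forall>w\<in>W. h' w \<noteq> 0 \<and> f w = h w / h' w"
    and **: "W \<subseteq> U' \<times> V'" "openin (zar X) U'" "openin (zar Y) V'" "box_function X U' Y V' k" "box_function X U' Y V' k'"
    "\<forall>w\<in>W. k' w \<noteq> 0 \<and> g w = k w / k' w"
    by (elim exE conjE) (rule that)
  have o: "openin (zar X) (U \<inter> U')" "openin (zar Y) (V \<inter> V')" using * ** by (auto intro: openin_Int)
  note b = box_function_restrict[OF X Y *(4) o] box_function_restrict[OF X Y *(5) o]
    box_function_restrict[OF X Y **(4) o] box_function_restrict[OF X Y **(5) o]
  show ?case
  proof (intro conjI, goal_cases)
    case 1
    have "box_function X (U \<inter> U') Y (V \<inter> V') (\<lambda>z. h z * k' z + h' z * k z)"
      "box_function X (U \<inter> U') Y (V \<inter> V') (\<lambda>z. h' z * k' z)"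
      using b by (auto intro!: box_function_add box_function_mult X Y o)
    then show ?case
      using o * **
      by (intro exI[of _ "U \<inter> U'"] exI[of _ "V \<inter> V'"] exI[of _ "\<lambda>z. h z * k' z + h' z * k z"]
          exI[of _ "\<lambda>z. h' z * k' z"]) (auto simp: field_simps)
  next
    case 2
    have "box_function X (U \<inter> U') Y (V \<inter> V') (\<lambda>z. h z * k z)"
      "box_function X (U \<inter> U') Y (V \<inter> V') (\<lambda>z. h' z * k' z)"
      using b by (auto intro!: box_function_mult X Y o)
    then show ?case
      using o * **
      by (intro exI[of _ "U \<inter> U'"] exI[of _ "V \<inter> V'"] exI[of _ "\<lambda>z. h z * k z"]
          exI[of _ "\<lambda>z. h' z * k' z"]) auto
  qed
next
  case (6 W f)
  then obtain U V h h' where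
    *: "W \<subseteq> U \<times> V" "openin (zar X) U" "openin (zar Y) V" "box_function X U Y V h" "box_function X U Y V h'"
    "\<forall>w\<in>W. h' w \<noteq> 0 \<and> f w = h w / h' w" by blast
  have "{p \<in> W. f p \<noteq> 0} = W \<inter> {z \<in> U \<times> V. h z \<noteq> 0}" using * by auto
  then have "openin (product_zar X Y) {p \<in> W. f p \<noteq> 0}"
    using product_zar_boxes[OF *(2,3,4)] 6 by (auto intro: openin_Int)
  moreover have "\<forall>w\<in>{p \<in> W. f p \<noteq> 0}. h w \<noteq> 0 \<and> inverse (f w) = h' w / h w" using * by auto
  ultimately show ?case using * by auto blast
qed

section \<open>Morphisms\<close>

lemma morphismI:
  assumes "continuous_map (zar X) (zar Y) \<phi>"
    and "\<And>V f. openin (zar Y) V \<Longrightarrow> reg Y V f \<Longrightarrow> reg X {p \<in> points X. \<phi> p \<in> V} (f \<circ> \<phi>)"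
  shows "morphism X Y \<phi>"
  using assms unfolding morphism_def by blast

lemma morphism_reg: "morphism X Y \<phi> \<Longrightarrow> openin (zar Y) V \<Longrightarrow> reg Y V f \<Longrightarrow>
    reg X {p \<in> points X. \<phi> p \<in> V} (\<lambda>p. f (\<phi> p))"
  unfolding morphism_def comp_def by blast

lemma morphism_open: "morphism X Y \<phi> \<Longrightarrow> openin (zar Y) V \<Longrightarrow> openin (zar X) {p \<in> points X. \<phi> p \<in> V}"
  unfolding morphism_def by (simp add: continuous_map)

lemma morphism_points: "morphism X Y \<phi> \<Longrightarrow> p \<in> points X \<Longrightarrow> \<phi> p \<in> points Y"
  unfolding morphism_def continuous_map by blast

lemma morphism_cong:
  assumes X: "field_sheaf X" and m: "morphism X Y \<phi>" and eq: "\<And>p. p \<in> points X \<Longrightarrow> \<psi> p = \<phi> p"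
  shows "morphism X Y \<psi>"
proof (rule morphismI)
  show "continuous_map (zar X) (zar Y) \<psi>"
    by (rule continuous_map_eq[of _ _ \<phi>]) (use m in \<open>simp_all add: morphism_def eq\<close>)
  fix V f assume V: "openin (zar Y) V" "reg Y V f"
  have same: "{p \<in> points X. \<psi> p \<in> V} = {p \<in> points X. \<phi> p \<in> V}" using eq by auto
  show "reg X {p \<in> points X. \<psi> p \<in> V} (f \<circ> \<psi>)"
    unfolding same by (rule reg_cong[OF X morphism_reg[OF m V]]) (simp add: eq)
qed

lemma morphism_into_subspace:
  assumes X: "field_sheaf X" and Y: "field_sheaf Y" and m: "morphism X Y \<phi>"
    and Z: "\<And>p. p \<in> points X \<Longrightarrow> \<phi> p \<in> Z"
  shows "morphism X (subspace_of Y Z) \<phi>"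
proof (rule morphismI)
  show "continuous_map (zar X) (zar (subspace_of Y Z)) \<phi>"
    using m Z unfolding morphism_def by (auto simp: continuous_map_in_subtopology)
  fix V f assume V: "openin (zar (subspace_of Y Z)) V" and f: "reg (subspace_of Y Z) V f"
  obtain V' where V': "openin (zar Y) V'" "V = V' \<inter> Z" using V by (auto simp: openin_subtopology)
  have "{p \<in> points X. \<phi> p \<in> V} = {p \<in> points X. \<phi> p \<in> V'}" using V' Z by auto
  then have o: "openin (zar X) {p \<in> points X. \<phi> p \<in> V}" using morphism_open[OF m V'(1)] by simp
  show "reg X {p \<in> points X. \<phi> p \<in> V} (f \<circ> \<phi>)"
  proof (rule reg_glue[OF X o])
    fix p assume p: "p \<in> {p \<in> points X. \<phi> p \<in> V}"
    then obtain W g where W: "openin (zar Y) W" "\<phi> p \<in> W" "W \<inter> Z \<subseteq> V" "reg Y W g" "\<forall>q\<in>W \<inter> Z. f q = g q"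
      using f unfolding subspace_of_def by auto
    have "reg X {p \<in> points X. \<phi> p \<in> W} (f \<circ> \<phi>)"
      by (rule reg_cong[OF X morphism_reg[OF m W(1,4)]]) (use W Z in auto)
    then show "\<exists>W. openin (zar X) W \<and> p \<in> W \<and> W \<subseteq> {p \<in> points X. \<phi> p \<in> V} \<and> reg X W (f \<circ> \<phi>)"
      using p W Z morphism_open[OF m W(1)] by (intro exI[of _ "{p \<in> points X. \<phi> p \<in> W}"]) auto
  qed
qed

text \<open>
  Restriction of the domain to a smaller open set. The two induced structures agree on it, since both
  are restrictions of the structure of \<open>X\<close>.
\<close>

lemma morphism_subspace_subset:
  assumes X: "field_sheaf X" and U: "openin (zar X) U" and V: "openin (zar X) V" "V \<subseteq> U"
    and m: "morphism (subspace_of X U) Y \<phi>"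
  shows "morphism (subspace_of X V) Y \<phi>"
proof -
  have U': "U \<subseteq> points X" using openin_subset[OF U] .
  show ?thesis
  proof (rule morphismI)
    show "continuous_map (zar (subspace_of X V)) (zar Y) \<phi>"
      using m V unfolding morphism_def by (auto intro: continuous_map_from_subtopology_mono)
    fix W f assume W: "openin (zar Y) W" "reg Y W f"
    have "reg (subspace_of X U) {p \<in> U. \<phi> p \<in> W} (f \<circ> \<phi>)"
      using m W U' unfolding morphism_def by (simp add: Int_absorb1)
    then have r: "reg X {p \<in> U. \<phi> p \<in> W} (f \<circ> \<phi>)" by (simp add: reg_open_subspace[OF X U])
    have eq: "{p \<in> V. \<phi> p \<in> W} = V \<inter> {p \<in> U. \<phi> p \<in> W}" using V by auto
    have "reg X {p \<in> V. \<phi> p \<in> W} (f \<circ> \<phi>)"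
      by (rule reg_restrict[OF X r]) (use V reg_open[OF X r] eq in \<open>auto intro: openin_Int\<close>)
    moreover have "topspace (zar X) \<inter> V = V" using U' V by auto
    ultimately show "reg (subspace_of X V) {p \<in> points (subspace_of X V). \<phi> p \<in> W} (f \<circ> \<phi>)"
      by (auto simp: reg_open_subspace[OF X V(1)])
  qed
qed

text \<open>
  Homogeneous coordinates that are regular functions without common zero define a morphism; they may
  be chosen locally, as only the line they span matters.
\<close>

lemma morphism_into_projective:
  fixes X :: "('p, 'k::field) fspace" and \<phi> :: "'p \<Rightarrow> (nat \<Rightarrow> 'k) set"
  assumes X: "field_sheaf X"
    and loc: "\<And>p. p \<in> points X \<Longrightarrow> \<exists>W g. openin (zar X) W \<and> p \<in> W \<and>
      (\<forall>i\<in>I. reg X W (\<lambda>q. g q i)) \<and>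
      (\<forall>q\<in>W. g q \<in> coord_space I \<and> g q \<noteq> (\<lambda>_. 0) \<and> \<phi> q = line (g q))"
  shows "morphism X (projective_space I) \<phi>"
proof (rule morphismI)
  have sub: "\<phi> ` topspace (zar X) \<subseteq> topspace (projective_zar I)"
  proof (rule image_subsetI)
    fix p assume "p \<in> points X"
    from loc[OF this] show "\<phi> p \<in> topspace (projective_zar I)" using line_in_points by metis
  qed
  show cont: "continuous_map (zar X) (zar (projective_space I)) \<phi>"
    unfolding zar_projective projective_zar_def
  proof (rule continuous_map_generated_local, goal_cases)
    case 1
    then show ?case using sub unfolding projective_zar_def topology_generated_by_topspace .
  next
    case (2 U p)
    then obtain F d where F: "homogeneous_fun I d F"
      "U = {line x |x. x \<in> coord_space I \<and> x \<noteq> (\<lambda>_. 0) \<and> F x \<noteq> 0}" by blast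
    obtain W g where W: "openin (zar X) W" "p \<in> W" "\<forall>i\<in>I. reg X W (\<lambda>q. g q i)"
      "\<forall>q\<in>W. g q \<in> coord_space I \<and> g q \<noteq> (\<lambda>_. 0) \<and> \<phi> q = line (g q)"
      using loc[OF 2(2)] by (elim exE conjE) (rule that)
    have "reg X W (\<lambda>q. F (g q))"
      by (rule reg_poly_fun[OF X _ W(1)]) (use F(1) W(3) in \<open>auto simp: homogeneous_fun_def\<close>)
    from open_nonzero[OF X this] have o: "openin (zar X) {q \<in> W. F (g q) \<noteq> 0}" .
    obtain x where x: "\<phi> p = line x" "x \<noteq> (\<lambda>_. 0)" "F x \<noteq> 0" using 2(3) F(2) by blast
    have "line x = line (g p)" using x(1) W(2,4) by metis
    then have "F (g p) \<noteq> 0" using homogeneous_nonzero_line[OF F(1) _ x(2)] x(3) by metis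
    then show ?case using o W(2,4) F(2) by (intro exI[of _ "{q \<in> W. F (g q) \<noteq> 0}"]) auto
  qed
  fix V :: "(nat \<Rightarrow> 'k) set set" and f
  assume V: "openin (zar (projective_space I)) V" and f: "reg (projective_space I) V f"
  have o: "openin (zar X) {p \<in> points X. \<phi> p \<in> V}" using cont V by (simp add: continuous_map)
  show "reg X {p \<in> points X. \<phi> p \<in> V} (f \<circ> \<phi>)"
  proof (rule reg_glue[OF X o])
    fix p assume p: "p \<in> {p \<in> points X. \<phi> p \<in> V}"
    then obtain V' d F H where V': "openin (projective_zar I) V'" "\<phi> p \<in> V'" "V' \<subseteq> V"
      and FH: "homogeneous_fun I d F" "homogeneous_fun I d H"
      "\<And>x. x\<in>coord_space I \<Longrightarrow> x \<noteq> (\<lambda>_. 0) \<Longrightarrow> line x \<in> V' \<Longrightarrow> H x \<noteq> 0 \<and> f (line x) = F x / H x"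
      using f unfolding projective_space_def by auto
    obtain W g where W: "openin (zar X) W" "p \<in> W" "\<forall>i\<in>I. reg X W (\<lambda>q. g q i)"
      "\<And>q. q\<in>W \<Longrightarrow> g q \<in> coord_space I \<and> g q \<noteq> (\<lambda>_. 0) \<and> \<phi> q = line (g q)"
      using loc[of p] p by auto
    let ?W = "W \<inter> {p \<in> points X. \<phi> p \<in> V'}"
    have oW: "openin (zar X) ?W"
      using W cont V' by (auto simp: continuous_map intro: openin_Int)
    have r: "reg X ?W (\<lambda>q. g q i)" if "i \<in> I" for i
      using reg_restrict[OF X W(3)[rule_format, OF that] oW] by auto
    have pF: "poly_fun I F" "poly_fun I H" using FH(1,2) unfolding homogeneous_fun_def by auto
    have nz: "H (g q) \<noteq> 0" if "q \<in> ?W" for q using W(4)[of q] FH(3)[of "g q"] that by auto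
    have "reg X ?W (\<lambda>q. F (g q) / H (g q))"
      by (rule reg_divide[OF X reg_poly_fun[OF X pF(1) oW r] reg_poly_fun[OF X pF(2) oW r] nz])
    then have "reg X ?W (f \<circ> \<phi>)"
      by (rule reg_cong[OF X]) (use W(4) FH(3) in auto)
    then show "\<exists>W. openin (zar X) W \<and> p \<in> W \<and> W \<subseteq> {p \<in> points X. \<phi> p \<in> V} \<and> reg X W (f \<circ> \<phi>)"
      using oW W V' p by (intro exI[of _ ?W]) auto
  qed
qed

lemma morphism_into_affine:
  fixes X :: "('p, 'k::field) fspace" and \<phi> :: "'p \<Rightarrow> nat \<Rightarrow> 'k"
  assumes X: "field_sheaf X"
    and r: "\<And>i. i \<in> I \<Longrightarrow> reg X (points X) (\<lambda>q. \<phi> q i)"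
    and sub: "\<And>q. q \<in> points X \<Longrightarrow> \<phi> q \<in> coord_space I"
  shows "morphism X (affine_space I) \<phi>"
proof (rule morphismI)
  have pf: "reg X (points X) (\<lambda>q. F (\<phi> q))" if "poly_fun I F" for F
    using reg_poly_fun[OF X that openin_topspace r] .
  show cont: "continuous_map (zar X) (zar (affine_space I)) \<phi>"
    unfolding zar_affine affine_zar_def
  proof (rule continuous_map_generated_local, goal_cases)
    case 1
    have "\<phi> ` topspace (zar X) \<subseteq> topspace (affine_zar I)" unfolding points_affine using sub by blast
    then show ?case unfolding affine_zar_def topology_generated_by_topspace .
  next
    case (2 U p)
    then obtain F where F: "poly_fun I F" "U = {x \<in> coord_space I. F x \<noteq> 0}" by blast
    show ?case
      using open_nonzero[OF X pf[OF F(1)]] 2 F sub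
      by (intro exI[of _ "{p \<in> points X. F (\<phi> p) \<noteq> 0}"]) auto
  qed
  fix V :: "(nat \<Rightarrow> 'k) set" and f
  assume V: "openin (zar (affine_space I)) V" and f: "reg (affine_space I) V f"
  have o: "openin (zar X) {p \<in> points X. \<phi> p \<in> V}" using cont V by (simp add: continuous_map)
  show "reg X {p \<in> points X. \<phi> p \<in> V} (f \<circ> \<phi>)"
  proof (rule reg_glue[OF X o])
    fix p assume p: "p \<in> {p \<in> points X. \<phi> p \<in> V}"
    then obtain V' F H where V': "openin (affine_zar I) V'" "\<phi> p \<in> V'" "V' \<subseteq> V"
      and FH: "poly_fun I F" "poly_fun I H"
      "\<And>x. x\<in>V' \<Longrightarrow> H x \<noteq> 0 \<and> f x = F x / H x"
      using f unfolding affine_space_def by auto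
    let ?W = "{p \<in> points X. \<phi> p \<in> V'}"
    have oW: "openin (zar X) ?W" using cont V' by (auto simp: continuous_map)
    have nz: "H (\<phi> q) \<noteq> 0" if "q \<in> ?W" for q using FH(3)[of "\<phi> q"] that by auto
    have "reg X ?W (\<lambda>q. F (\<phi> q) / H (\<phi> q))"
      by (rule reg_divide[OF X reg_restrict[OF X pf[OF FH(1)] oW] reg_restrict[OF X pf[OF FH(2)] oW] nz]) auto
    then have "reg X ?W (f \<circ> \<phi>)"
      by (rule reg_cong[OF X]) (use FH(3) in auto)
    then show "\<exists>W. openin (zar X) W \<and> p \<in> W \<and> W \<subseteq> {p \<in> points X. \<phi> p \<in> V} \<and> reg X W (f \<circ> \<phi>)"
      using oW V' p by (intro exI[of _ ?W]) auto
  qed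
qed

text \<open>
  The universal property of the product: box functions pull back to sums of products of regular
  functions.
\<close>

lemma morphism_into_product:
  assumes Z: "field_sheaf Z" and X: "field_sheaf X" and Y: "field_sheaf Y"
    and m: "morphism Z X \<alpha>" "morphism Z Y \<beta>"
  shows "morphism Z (product_of X Y) (\<lambda>p. (\<alpha> p, \<beta> p))"
proof (rule morphismI)
  let ?\<phi> = "\<lambda>p. (\<alpha> p, \<beta> p)"
  let ?W = "\<lambda>U V. {p \<in> points Z. \<alpha> p \<in> U} \<inter> {p \<in> points Z. \<beta> p \<in> V}"
  have oW: "openin (zar Z) (?W U V)" if "openin (zar X) U" "openin (zar Y) V" for U V
    using morphism_open[OF m(1) that(1)] morphism_open[OF m(2) that(2)] by (rule openin_Int)
  have box: "reg Z (?W U V) (\<lambda>p. h (?\<phi> p))"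
    if UV: "openin (zar X) U" "openin (zar Y) V" and h: "box_function X U Y V h" for U V h
  proof -
    obtain n :: nat and f g where fg: "\<forall>i<n. reg X U (f i) \<and> reg Y V (g i)"
      "\<forall>p\<in>U. \<forall>q\<in>V. h (p, q) = (\<Sum>i<n. f i p * g i q)" using h unfolding box_function_def by blast
    have "reg Z (?W U V) (\<lambda>p. \<Sum>i<n. f i (\<alpha> p) * g i (\<beta> p))"
    proof (intro reg_sum[OF Z] reg_mult[OF Z] oW UV)
      fix i assume "i \<in> {..<n}"
      then have i: "reg X U (f i)" "reg Y V (g i)" using fg by auto
      show "reg Z (?W U V) (\<lambda>p. f i (\<alpha> p))"
        by (rule reg_restrict[OF Z morphism_reg[OF m(1) UV(1) i(1)] oW[OF UV]]) auto
      show "reg Z (?W U V) (\<lambda>p. g i (\<beta> p))"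
        by (rule reg_restrict[OF Z morphism_reg[OF m(2) UV(2) i(2)] oW[OF UV]]) auto
    qed
    then show ?thesis by (rule reg_cong[OF Z]) (use fg in auto)
  qed
  show cont: "continuous_map (zar Z) (zar (product_of X Y)) ?\<phi>"
    unfolding zar_product product_zar_def
  proof (rule continuous_map_generated_local, goal_cases)
    case 1
    have "?\<phi> ` topspace (zar Z) \<subseteq> topspace (product_zar X Y)"
      unfolding points_product[OF X Y] using morphism_points[OF m(1)] morphism_points[OF m(2)] by auto
    then show ?case unfolding product_zar_def topology_generated_by_topspace .
  next
    case (2 O' p)
    then obtain U V h where UV: "openin (zar X) U" "openin (zar Y) V" "box_function X U Y V h"
      "O' = {z \<in> U \<times> V. h z \<noteq> 0}" by blast
    show ?case
      using open_nonzero[OF Z box[OF UV(1-3)]] 2 UV(4)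
      by (intro exI[of _ "{p \<in> ?W U V. h (?\<phi> p) \<noteq> 0}"]) auto
  qed
  fix O' f assume O': "openin (zar (product_of X Y)) O'" and f: "reg (product_of X Y) O' f"
  have o: "openin (zar Z) {p \<in> points Z. ?\<phi> p \<in> O'}" using cont O' by (simp add: continuous_map)
  show "reg Z {p \<in> points Z. ?\<phi> p \<in> O'} (f \<circ> ?\<phi>)"
  proof (rule reg_glue[OF Z o])
    fix p assume p: "p \<in> {p \<in> points Z. ?\<phi> p \<in> O'}"
    then obtain W U V h h' where W: "openin (product_zar X Y) W" "?\<phi> p \<in> W" "W \<subseteq> O' \<inter> U \<times> V"
      and UV: "openin (zar X) U" "openin (zar Y) V" "box_function X U Y V h" "box_function X U Y V h'"
        "\<And>w. w\<in>W \<Longrightarrow> h' w \<noteq> 0 \<and> f w = h w / h' w"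
      using f p unfolding product_of_def by auto
    let ?O = "{p \<in> points Z. ?\<phi> p \<in> W}"
    have oO: "openin (zar Z) ?O" using cont W by (simp add: continuous_map)
    have "reg Z ?O (\<lambda>p. h (?\<phi> p) / h' (?\<phi> p))"
      using W UV
      by (intro reg_divide[OF Z] reg_restrict[OF Z box[OF UV(1,2,3)] oO] reg_restrict[OF Z box[OF UV(1,2,4)] oO]) auto
    then have "reg Z ?O (f \<circ> ?\<phi>)" by (rule reg_cong[OF Z]) (use UV(5) in auto)
    then show "\<exists>W. openin (zar Z) W \<and> p \<in> W \<and> W \<subseteq> {p \<in> points Z. ?\<phi> p \<in> O'} \<and> reg Z W (f \<circ> ?\<phi>)"
      using oO W p by (intro exI[of _ ?O]) auto
  qed
qed

lemma reg_product_fst: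
  assumes X: "field_sheaf X" and Y: "field_sheaf Y" and f: "reg X U f"
  shows "reg (product_of X Y) (U \<times> points Y) (\<lambda>z. f (fst z))"
proof -
  note o = reg_open[OF X f]
  note oo = open_Times[OF X Y o openin_topspace]
  show ?thesis
    unfolding product_of_def
    using oo o box_function_fst[OF X Y f openin_topspace] box_function_const[OF X Y o openin_topspace, of 1]
    by simp (intro ballI, rule exI[of _ "U \<times> points Y"], simp, rule exI[of _ U], rule exI[of _ "points Y"],
        simp, rule exI[of _ "\<lambda>z. f (fst z)"], simp, rule exI[of _ "\<lambda>_. 1"], simp)
qed

lemma reg_product_snd:
  assumes X: "field_sheaf X" and Y: "field_sheaf Y" and f: "reg Y V f"
  shows "reg (product_of X Y) (points X \<times> V) (\<lambda>z. f (snd z))"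
proof -
  note o = reg_open[OF Y f]
  note oo = open_Times[OF X Y openin_topspace o]
  show ?thesis
    unfolding product_of_def
    using oo o box_function_snd[OF X Y openin_topspace f] box_function_const[OF X Y openin_topspace o, of 1]
    by simp (intro ballI, rule exI[of _ "points X \<times> V"], simp, rule exI[of _ "points X"], rule exI[of _ V],
        simp, rule exI[of _ "\<lambda>z. f (snd z)"], simp, rule exI[of _ "\<lambda>_. 1"], simp)
qed

text \<open>
  Two rational maps that are inverse to each other wherever a composition is defined restrict to an
  isomorphism of open sets. Each domain is shrunk to the preimage of the other one; since the
  composition is the identity, an image point is sent back into the domain that it came from.
\<close>

lemma isomorphism_if_partial_inverses:
  assumes X: "field_sheaf X" and Y: "field_sheaf Y"
    and U0: "openin (zar X) U0" and V0: "openin (zar Y) V0"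
    and \<phi>: "morphism (subspace_of X U0) Y \<phi>" and \<psi>: "morphism (subspace_of Y V0) X \<psi>"
    and inv1: "\<And>p. p \<in> U0 \<Longrightarrow> \<phi> p \<in> V0 \<Longrightarrow> \<psi> (\<phi> p) = p"
    and inv2: "\<And>q. q \<in> V0 \<Longrightarrow> \<psi> q \<in> U0 \<Longrightarrow> \<phi> (\<psi> q) = q"
  defines "U \<equiv> {p \<in> U0. \<phi> p \<in> V0}" and "V \<equiv> {q \<in> V0. \<psi> q \<in> U0}"
  shows "openin (zar X) U" "openin (zar Y) V" "isomorphism (subspace_of X U) (subspace_of Y V) \<phi>"
proof -
  have sU: "points X \<inter> U0 = U0" and sV: "points Y \<inter> V0 = V0"
    using openin_subset[OF U0] openin_subset[OF V0] by auto
  have oU: "openin (zar X) U"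
    using morphism_open[OF \<phi> V0] U0 by (simp add: sU U_def openin_open_subtopology)
  have oV: "openin (zar Y) V"
    using morphism_open[OF \<psi> U0] V0 by (simp add: sV V_def openin_open_subtopology)
  have sU': "points X \<inter> U = U" and sV': "points Y \<inter> V = V"
    using openin_subset[OF oU] openin_subset[OF oV] by auto
  have 1: "morphism (subspace_of X U) (subspace_of Y V) \<phi>"
    by (rule morphism_into_subspace[OF field_sheaf_subspace[OF X] Y morphism_subspace_subset[OF X U0 oU _ \<phi>]])
       (use inv1 in \<open>auto simp: U_def V_def\<close>)
  have 2: "morphism (subspace_of Y V) (subspace_of X U) \<psi>"
    by (rule morphism_into_subspace[OF field_sheaf_subspace[OF Y] X morphism_subspace_subset[OF Y V0 oV _ \<psi>]])
       (use inv2 in \<open>auto simp: U_def V_def\<close>)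
  show "isomorphism (subspace_of X U) (subspace_of Y V) \<phi>"
    unfolding isomorphism_def using 1 2 inv1 inv2
    by (auto simp: sU' sV' intro!: exI[of _ \<psi>]) (auto simp: U_def V_def)
  show "openin (zar X) U" "openin (zar Y) V" using oU oV by auto
qed

section \<open>The quadric is a smooth variety\<close>

text \<open>
  Nonvanishing loci of homogeneous functions form a basis of the Zariski topology, not just a
  subbasis, because homogeneous functions can be multiplied.
\<close>

lemma projective_basis:
  fixes x :: "nat \<Rightarrow> 'k::field"
  assumes U: "openin (projective_zar I) U"
    and x: "x \<in> coord_space I" "x \<noteq> (\<lambda>_. 0)" "line x \<in> U"
  shows "\<exists>d F. homogeneous_fun I d F \<and> F x \<noteq> 0 \<and>
    (\<forall>y\<in>coord_space I. y \<noteq> (\<lambda>_. 0) \<longrightarrow> F y \<noteq> 0 \<longrightarrow> line y \<in> U)"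
proof -
  have "generate_topology_on
    {{line x |x. x \<in> coord_space I \<and> x \<noteq> (\<lambda>_. 0::'k) \<and> F x \<noteq> 0} |F. \<exists>d. homogeneous_fun I d F} U"
    using U unfolding projective_zar_def by (rule openin_topology_generated_by)
  then show ?thesis using x(3)
  proof induction
    case Empty
    then show ?case by simp
  next
    case (Int a b)
    obtain d F where F: "homogeneous_fun I d F" "F x \<noteq> 0"
      "\<forall>y\<in>coord_space I. y \<noteq> (\<lambda>_. 0) \<longrightarrow> F y \<noteq> 0 \<longrightarrow> line y \<in> a" using Int by blast
    obtain e H where H: "homogeneous_fun I e H" "H x \<noteq> 0"
      "\<forall>y\<in>coord_space I. y \<noteq> (\<lambda>_. 0) \<longrightarrow> H y \<noteq> 0 \<longrightarrow> line y \<in> b" using Int by blast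
    show ?case
      using homogeneous_fun_mult[OF F(1) H(1)] F H
      by (intro exI[of _ "d + e"] exI[of _ "\<lambda>x. F x * H x"]) auto
  next
    case (UN K)
    then obtain k where "k \<in> K" "line x \<in> k" by blast
    with UN.IH[of k] show ?case by blast
  next
    case (Basis s)
    then obtain d F where F: "homogeneous_fun I d F"
      "s = {line x |x. x \<in> coord_space I \<and> x \<noteq> (\<lambda>_. 0) \<and> F x \<noteq> 0}" by blast
    then obtain x' where x': "line x' = line x" "x' \<noteq> (\<lambda>_. 0)" "F x' \<noteq> 0" using Basis.prems by auto
    have "F x \<noteq> 0" using homogeneous_nonzero_line[OF F(1) x'(1,2)] x'(3) by simp
    then show ?case using F by blast
  qed
qed

lemma poly_fun_along_curve:
  assumes "poly_fun I F" and "\<And>i. i \<in> I \<Longrightarrow> \<exists>p. \<forall>t. c t i = poly p t"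
  shows "\<exists>p. \<forall>t. F (c t) = poly p t"
  using assms(1)
proof induction
  case (const a)
  then show ?case by (intro exI[of _ "[:a:]"]) simp
next
  case (coord i)
  then show ?case using assms(2) by blast
next
  case (add F H)
  then obtain p r where "\<forall>t. F (c t) = poly p t" "\<forall>t. H (c t) = poly r t" by blast
  then show ?case by (intro exI[of _ "p + r"]) simp
next
  case (mult F H)
  then obtain p r where "\<forall>t. F (c t) = poly p t" "\<forall>t. H (c t) = poly r t" by blast
  then show ?case by (intro exI[of _ "p * r"]) simp
qed

definition dot :: "(nat \<Rightarrow> 'k::field) \<Rightarrow> (nat \<Rightarrow> 'k) \<Rightarrow> 'k"
  where "dot x y = (\<Sum>i=1..5. x i * y i)"

lemma dot_commute: "dot x y = dot y x"
  unfolding dot_def by (simp add: mult.commute)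

lemma dot_add: "dot (\<lambda>i. x i + y i) z = dot x z + dot y z"
  "dot z (\<lambda>i. x i + y i) = dot z x + dot z y"
  unfolding dot_def by (simp_all add: algebra_simps sum.distrib)

lemma dot_smult: "dot (\<lambda>i. c * x i) z = c * dot x z" "dot z (\<lambda>i. c * x i) = c * dot z x"
  unfolding dot_def by (simp_all add: algebra_simps sum_distrib_left)

lemma dot_diff: "dot (\<lambda>i. x i - y i) z = dot x z - dot y z"
  "dot z (\<lambda>i. x i - y i) = dot z x - dot z y"
  unfolding dot_def by (simp_all add: algebra_simps sum_subtractf)

lemmas dot_simps = dot_add dot_diff dot_smult

abbreviation quadric_cone :: "(nat \<Rightarrow> 'k::field) set"
  where "quadric_cone \<equiv> {x \<in> coord_space {1..5}. x \<noteq> (\<lambda>_. 0) \<and> dot x x = 0}"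

lemma quadric_eq: "(quadric :: ((nat \<Rightarrow> 'a::field) set, 'a) fspace) =
  subspace_of (projective_space {1..5}) (line ` quadric_cone)"
proof -
  have "{line x |x. x \<in> coord_space {1..5} \<and> x \<noteq> (\<lambda>_. 0) \<and> (\<Sum>i=1..5. (x i)\<^sup>2) = 0} =
    line ` (quadric_cone :: (nat \<Rightarrow> 'a) set)"
    unfolding dot_def power2_eq_square by auto
  then show ?thesis unfolding quadric_def by simp
qed

lemma points_quadric: "points quadric = line ` quadric_cone"
  unfolding quadric_eq using points_projective[of "{1..5}"] by auto

lemma field_sheaf_quadric: "field_sheaf quadric"
  unfolding quadric_eq by (rule field_sheaf_subspace[OF field_sheaf_projective])

lemma hyperplane_homogeneous: "i \<in> {1..5} \<Longrightarrow> homogeneous_fun {1..5} (Suc 0) (\<lambda>x. x i)"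
  using homogeneous_fun_coord[of i "{1..5}"] by simp

lemma reg_hquot_quadric:
  assumes "homogeneous_fun {1..5} d F" "homogeneous_fun {1..5} d H"
  shows "reg quadric {line x |x. x \<in> quadric_cone \<and> H x \<noteq> 0} (hquot F H)"
proof -
  have "{line x |x. x \<in> coord_space {1..5} \<and> x \<noteq> (\<lambda>_. 0) \<and> H x \<noteq> 0} \<inter> line ` quadric_cone =
    {line x |x. x \<in> quadric_cone \<and> H x \<noteq> 0}" (is "?L = ?R")
  proof
    show "?L \<subseteq> ?R"
    proof
      fix p assume "p \<in> ?L"
      then obtain x y where *: "p = line x" "x \<noteq> (\<lambda>_. 0)" "H x \<noteq> 0" "p = line y" "y \<in> quadric_cone" by blast
      then have "H y \<noteq> 0" using homogeneous_nonzero_line[OF assms(2), of x y] by simp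
      then show "p \<in> ?R" using * by blast
    qed
  qed blast
  with reg_subspace[OF field_sheaf_projective reg_hquot[OF assms], of "line ` quadric_cone"]
  show ?thesis unfolding quadric_eq by simp
qed

text \<open>
  This vector is the middle coefficient of a conic on the quadric joining \<open>x\<close> and \<open>y\<close>. If \<open>x\<close> and \<open>y\<close>
  are not orthogonal, the projections of the five unit vectors to the orthogonal complement of
  \<open>x\<close> and \<open>y\<close> have squared lengths that add up to 3, the dimension of that complement, so one of them
  is anisotropic and can be rescaled.
\<close>

lemma orthogonal_vector_exists:
  fixes x y :: "nat \<Rightarrow> 'k::{alg_closed_field, field_char_0}"
  assumes x: "x \<in> coord_space {1..5}" "dot x x = 0" and y: "y \<in> coord_space {1..5}" "dot y y = 0"
  shows "\<exists>w\<in>coord_space {1..5}. dot w x = 0 \<and> dot w y = 0 \<and> dot w w = - 2 * dot x y"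
proof (cases "dot x y = 0")
  case True
  then show ?thesis by (intro bexI[of _ "\<lambda>_. 0"]) (auto simp: dot_def coord_space_def)
next
  case False
  define B where "B = dot x y"
  define e :: "nat \<Rightarrow> nat \<Rightarrow> 'k" where "e j = (\<lambda>i. if i = j then 1 else 0)" for j
  have e: "dot (e j) z = z j" "dot z (e j) = z j" if "j \<in> {1..5}" for j z
    using that unfolding dot_def e_def by (auto simp: if_distrib[of "\<lambda>a. _ * a"] if_distrib[of "\<lambda>a. a * _"] cong: if_cong)
  have "(\<Sum>j=1..5. 1 - 2 * (x j * y j) / B) = 3"
  proof -
    have "(\<Sum>j=1..5. 1 - 2 * (x j * y j) / B) = 5 - 2 * dot x y / B"
      unfolding dot_def by (simp add: sum_subtractf sum_divide_distrib sum_distrib_left)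
    then show ?thesis using False by (simp add: B_def)
  qed
  then obtain j where j: "j \<in> {1..5}" "1 - 2 * (x j * y j) / B \<noteq> 0"
    by (metis (no_types, lifting) sum.neutral zero_neq_numeral)
  define w where "w = (\<lambda>i. e j i - ((y j / B) * x i + (x j / B) * y i))"
  have w: "w \<in> coord_space {1..5}" using x y j unfolding w_def coord_space_def e_def by auto
  have ejj: "e j j = 1" unfolding e_def by simp
  have Byx: "dot y x = B" using dot_commute B_def by metis
  have wx: "dot w x = 0" "dot w y = 0" 
    using False x y Byx unfolding w_def dot_simps e(1)[OF j(1)] e(2)[OF j(1)] by (auto simp: B_def)
  have ww: "dot w w = 1 - 2 * (x j * y j) / B"
    using False x y Byx unfolding w_def dot_simps e(1)[OF j(1)] e(2)[OF j(1)] ejj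
    by (simp add: B_def[symmetric] field_simps)
  obtain s where s: "s ^ 2 = - 2 * B / dot w w" using nth_root_exists[of 2 "- 2 * B / dot w w"] by auto
  have "dot w w \<noteq> 0" using ww j by simp
  then have "dot (\<lambda>i. s * w i) (\<lambda>i. s * w i) = - 2 * B"
    using s unfolding dot_simps by (simp add: field_simps power2_eq_square)
  then show ?thesis
    using w wx by (intro bexI[of _ "\<lambda>i. s * w i"]) (auto simp: B_def dot_simps coord_space_smult)
qed

text \<open>
  For points \<open>x\<close> and \<open>y\<close> in two given open sets, choose \<open>w\<close> orthogonal to both with
  \<open>dot w w = - 2 * dot x y\<close>. Then \<open>x + t w + t^2 y\<close> is isotropic for all \<open>t\<close>; this curve starts at
  \<open>x\<close> and tends to \<open>y\<close>, and a general point of it lies in both open sets.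
\<close>

lemma irreducible_quadric:
  "irreducible_space (zar (quadric :: ((nat \<Rightarrow> 'k::{alg_closed_field, field_char_0}) set, 'k) fspace))"
  unfolding irreducible_space_def
proof (intro conjI allI impI)
  obtain \<iota> :: 'k where \<iota>: "\<iota> ^ 2 = -1" using nth_root_exists[of 2 "-1::'k"] by auto
  define x where "x = (\<lambda>i::nat. if i = 1 then 1 else if i = 2 then \<iota> else 0)"
  have "x \<in> quadric_cone"
    using \<iota> unfolding x_def coord_space_def dot_def
    by (auto simp: numeral_eq_Suc fun_eq_iff)
  then show "points (quadric :: ((nat \<Rightarrow> 'k) set, 'k) fspace) \<noteq> {}" unfolding points_quadric by blast
next
  fix U V :: "(nat \<Rightarrow> 'k) set set"
  assume U: "openin (zar quadric) U" "U \<noteq> {}" and V: "openin (zar quadric) V" "V \<noteq> {}"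
  obtain U' where U': "openin (projective_zar {1..5}) U'" "U = U' \<inter> line ` quadric_cone"
    using U unfolding quadric_eq by (auto simp: openin_subtopology)
  obtain V' where V': "openin (projective_zar {1..5}) V'" "V = V' \<inter> line ` quadric_cone"
    using V unfolding quadric_eq by (auto simp: openin_subtopology)
  obtain x where x: "x \<in> coord_space {1..5}" "x \<noteq> (\<lambda>_. 0)" "dot x x = 0" "line x \<in> U'" using U U' by auto
  obtain y where y: "y \<in> coord_space {1..5}" "y \<noteq> (\<lambda>_. 0)" "dot y y = 0" "line y \<in> V'" using V V' by auto
  obtain d F where F: "homogeneous_fun {1..5} d F" "F x \<noteq> 0"
    "\<forall>y\<in>coord_space {1..5}. y \<noteq> (\<lambda>_. 0) \<longrightarrow> F y \<noteq> 0 \<longrightarrow> line y \<in> U'"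
    using projective_basis[OF U'(1) x(1,2,4)] by blast
  obtain e H where H: "homogeneous_fun {1..5} e H" "H y \<noteq> 0"
    "\<forall>y\<in>coord_space {1..5}. y \<noteq> (\<lambda>_. 0) \<longrightarrow> H y \<noteq> 0 \<longrightarrow> line y \<in> V'"
    using projective_basis[OF V'(1) y(1,2,4)] by blast
  obtain w where w: "w \<in> coord_space {1..5}" "dot w x = 0" "dot w y = 0" "dot w w = - 2 * dot x y"
    using orthogonal_vector_exists[OF x(1,3) y(1,3)] by blast
  \<comment> \<open>The k-th coordinate keeps the curve away from the origin for general t.\<close>
  obtain k where k: "x k \<noteq> 0" using x(2) by blast
  define c where "c = (\<lambda>t i. x i + t * w i + t ^ 2 * y i)"
  \<comment> \<open>The same curve in the parameter 1/t, which starts at y.\<close>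
  define c' where "c' = (\<lambda>t i. y i + t * w i + t ^ 2 * x i)"
  have pc: "\<exists>p. \<forall>t. c t i = poly p t" for i
    unfolding c_def by (intro exI[of _ "[:x i, w i, y i:]"]) (simp add: algebra_simps power2_eq_square)
  have pc': "\<exists>p. \<forall>t. c' t i = poly p t" for i
    unfolding c'_def by (intro exI[of _ "[:y i, w i, x i:]"]) (simp add: algebra_simps power2_eq_square)
  obtain p where p: "\<forall>t. F (c t) = poly p t"
    using poly_fun_along_curve[of "{1..5}" F c] F(1) pc unfolding homogeneous_fun_def by blast
  obtain r where r: "\<forall>t. H (c' t) = poly r t"
    using poly_fun_along_curve[of "{1..5}" H c'] H(1) pc' unfolding homogeneous_fun_def by blast
  obtain s where s: "\<forall>t. c t k = poly s t" using pc by blast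
  have c0: "c 0 = x" "c' 0 = y" unfolding c_def c'_def by auto
  have "p \<noteq> 0" "r \<noteq> 0" "s \<noteq> 0" using p r s c0 F(2) H(2) k by (metis poly_0)+
  then have fin: "finite {t. poly p t = 0}" "finite {t. poly r t = 0}" "finite {t. poly s t = 0}"
    by (auto intro: poly_roots_finite)
  have "finite ({t. poly p t = 0} \<union> {t. poly s t = 0} \<union> inverse ` {t. poly r t = 0} \<union> {0})"
    using fin by auto
  then obtain t where t: "t \<notin> {t. poly p t = 0} \<union> {t. poly s t = 0} \<union> inverse ` {t. poly r t = 0} \<union> {0}"
    using ex_new_if_finite[OF infinite_UNIV_char_0] by metis
  have t0: "t \<noteq> 0" "F (c t) \<noteq> 0" "c t k \<noteq> 0" using t p s by auto
  have "poly r (inverse t) \<noteq> 0" using t by (metis (mono_tags, lifting) UnCI imageI inverse_inverse_eq mem_Collect_eq)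
  then have "H (c' (inverse t)) \<noteq> 0" using r by simp
  moreover have "c t = (\<lambda>i. t ^ 2 * c' (inverse t) i)"
    using t0(1) unfolding c_def c'_def by (auto simp: field_simps power2_eq_square)
  then have "H (c t) = (t ^ 2) ^ e * H (c' (inverse t))" using H(1) unfolding homogeneous_fun_def by metis
  ultimately have Hc: "H (c t) \<noteq> 0" using t0 by simp
  have cs: "c t \<in> coord_space {1..5}" using x y w unfolding c_def coord_space_def by simp
  have cn: "c t \<noteq> (\<lambda>_. 0)" using t0(3) by auto
  have xw: "dot x w = 0" "dot y w = 0" "dot y x = dot x y" using w dot_commute by metis+
  have "dot (c t) (c t) = 0"
    unfolding c_def dot_simps using x y w xw by (simp add: algebra_simps power2_eq_square)
  then have "line (c t) \<in> U \<inter> V"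
    using F(3) H(3) Hc t0 cs cn U' V' by blast
  then show "U \<inter> V \<noteq> {}" by blast
qed

text \<open>
  Two lines are different if and only if some two by two minor of their spanning vectors is nonzero.
  Divided by suitable coordinates, such a minor is a box function.
\<close>

lemma separated_projective_subspace:
  fixes Z :: "(nat \<Rightarrow> 'k::field) set set" and I :: "nat set"
  defines "X \<equiv> subspace_of (projective_space I) Z"
  shows "closedin (zar (product_of X X)) {(p, p) |p. p \<in> points X}"
proof -
  have X: "field_sheaf X" unfolding X_def by (rule field_sheaf_subspace[OF field_sheaf_projective])
  note XX = field_sheaf_product[OF X X]
  have pts: "points X \<subseteq> topspace (projective_zar I)" unfolding X_def by simp
  have tp: "topspace (zar (product_of X X)) = points X \<times> points X" by (simp add: points_product[OF X X])
  define Y where "Y = points X \<times> points X - {(p, p) |p. p \<in> points X}"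
  have "openin (zar (product_of X X)) Y"
  proof (subst openin_subopen, intro ballI)
    fix z assume "z \<in> Y"
    then obtain P Q where PQ: "z = (P, Q)" "P \<in> points X" "Q \<in> points X" "P \<noteq> Q" unfolding Y_def by auto
    obtain x where x: "P = line x" "x \<in> coord_space I" "x \<noteq> (\<lambda>_. 0)" using PQ pts points_projective by blast
    obtain y where y: "Q = line y" "y \<in> coord_space I" "y \<noteq> (\<lambda>_. 0)" using PQ pts points_projective by blast
    obtain l where l: "x l \<noteq> 0" "l \<in> I" using x unfolding coord_space_def by blast
    obtain k where k: "y k \<noteq> 0" "k \<in> I" using y unfolding coord_space_def by blast
    have "\<exists>i. x i * y k \<noteq> x k * y i"
    proof (rule ccontr)
      assume "\<not> ?thesis"
      then have *: "x = (\<lambda>i. (x k / y k) * y i)" using k by (auto simp: field_simps)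
      then have "x k / y k \<noteq> 0" using x(3) by auto
      from line_smult[OF this, of y] * have "line x = line y" by metis
      with PQ x y show False by simp
    qed
    then obtain i where i: "x i * y k \<noteq> x k * y i" by blast
    have iI: "i \<in> I" using i x y unfolding coord_space_def by force
    define D where "D = (\<lambda>l. {line x |x. x \<in> coord_space I \<and> x \<noteq> (\<lambda>_. 0) \<and> x l \<noteq> 0} \<inter> Z)"
    let ?h = "\<lambda>i l. hquot (\<lambda>x. x i) (\<lambda>x. x l) :: (nat \<Rightarrow> 'k) set \<Rightarrow> 'k"
    have r: "reg X (D l) (?h i l)" if "i \<in> I" "l \<in> I" for i l
      unfolding X_def D_def by (rule reg_subspace[OF field_sheaf_projective reg_hquot[OF homogeneous_fun_coord homogeneous_fun_coord]])
        (use that in auto)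
    have hl: "?h i l (line x) = x i / x l" if "i \<in> I" "l \<in> I" "x \<noteq> (\<lambda>_. 0)" for i l x
      using hquot_line[OF homogeneous_fun_coord homogeneous_fun_coord] that by blast
    define h where "h = (\<lambda>z. ?h i l (fst z) - ?h k l (fst z) * ?h i k (snd z))"
    have oo: "openin (zar (product_of X X)) (D l \<times> D k)"
      using open_Times[OF X X reg_open[OF X r] reg_open[OF X r]] l k by simp
    have sub: "D m \<subseteq> points X" for m unfolding X_def D_def using points_projective[of I] by auto
    have f: "reg (product_of X X) (D l \<times> D k) (\<lambda>z. ?h i l (fst z))" if "i \<in> I" for i
      by (rule reg_restrict[OF XX reg_product_fst[OF X X r] oo]) (use that l sub in auto)
    have g: "reg (product_of X X) (D l \<times> D k) (\<lambda>z. ?h i k (snd z))"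
      by (rule reg_restrict[OF XX reg_product_snd[OF X X r] oo]) (use iI k sub in auto)
    have "reg (product_of X X) (D l \<times> D k) h"
      unfolding h_def by (intro reg_diff[OF XX] reg_mult[OF XX] f g iI k)
    from open_nonzero[OF XX this]
    have o: "openin (zar (product_of X X)) {z \<in> D l \<times> D k. h z \<noteq> 0}" .
    have "P \<in> Z" "Q \<in> Z" using PQ unfolding X_def by auto
    then have "(P, Q) \<in> D l \<times> D k" using x y l k unfolding D_def by auto
    moreover have "h (P, Q) \<noteq> 0"
      unfolding h_def using i l k x y iI by (simp add: hl field_simps)
    moreover have "h (p, p) = 0" if p: "(p, p) \<in> D l \<times> D k" for p
    proof -
      obtain v where v: "p = line v" "v \<noteq> (\<lambda>_. 0)" "v l \<noteq> 0" using p unfolding D_def by blast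
      obtain v' where v': "p = line v'" "v' \<noteq> (\<lambda>_. 0)" "v' k \<noteq> 0" using p unfolding D_def by blast
      have "v k \<noteq> 0" using homogeneous_nonzero_line[OF homogeneous_fun_coord[OF k(2)], of v' v] v v' by simp
      then show ?thesis unfolding h_def using v l k iI by (simp add: hl)
    qed
    ultimately show "\<exists>T. openin (zar (product_of X X)) T \<and> z \<in> T \<and> T \<subseteq> Y"
      using o PQ(1) sub unfolding Y_def by (intro exI[of _ "{z \<in> D l \<times> D k. h z \<noteq> 0}"]) auto
  qed
  then show ?thesis unfolding closedin_def tp Y_def by auto
qed

lemma partial_deriv_eq:
  fixes F :: "(nat \<Rightarrow> 'k::field_char_0) \<Rightarrow> 'k"
  assumes "\<And>t. poly p t = F (x(i := t))"
  shows "partial_deriv i F x = poly (pderiv p) (x i)"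
proof -
  have "(THE p. \<forall>t. poly p t = F (x(i := t))) = p"
    by (rule the_equality) (use assms in \<open>auto simp: poly_eq_poly_eq_iff[symmetric] fun_eq_iff\<close>)
  then show ?thesis unfolding partial_deriv_def by simp
qed

text \<open>
  The affine chart where the \<open>i\<close>-th coordinate equals 1 is kept inside five-dimensional space, cut out
  by this condition and the equation of the quadric. This avoids renumbering coordinates, at the cost
  of a second equation.
\<close>

definition chart_equations :: "nat \<Rightarrow> nat \<Rightarrow> (nat \<Rightarrow> 'k::field) \<Rightarrow> 'k"
  where "chart_equations i j y = (if j = 0 then y i - 1 else dot y y)"

definition quadric_chart :: "nat \<Rightarrow> (nat \<Rightarrow> 'k::field, 'k) fspace"
  where "quadric_chart i = subspace_of (affine_space {1..5})
    {y \<in> coord_space {1..5}. \<forall>j<2. chart_equations i j y = 0}"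

lemma partial_deriv_coord:
  fixes x :: "nat \<Rightarrow> 'k::field_char_0"
  shows "partial_deriv m (\<lambda>y. y i - 1) x = (if m = i then 1 else 0)"
proof (cases "m = i")
  case True
  then show ?thesis by (subst partial_deriv_eq[where p="[:-1, 1:]"]) (auto simp: pderiv_pCons)
next
  case False
  then show ?thesis by (subst partial_deriv_eq[where p="[:x i - 1:]"]) auto
qed

lemma partial_deriv_dot:
  fixes x :: "nat \<Rightarrow> 'k::field_char_0"
  assumes "m \<in> {1..5}"
  shows "partial_deriv m (\<lambda>y. dot y y) x = 2 * x m"
proof -
  define c where "c = (\<Sum>i\<in>{1..5} - {m}. x i * x i)"
  have "dot (x(m := t)) (x(m := t)) = c + t * t" for t
    unfolding dot_def c_def using assms by (subst sum.remove[of _ m]) (auto intro!: sum.cong)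
  then show ?thesis
    by (subst partial_deriv_eq[where p="[:c, 0, 1:]"]) (auto simp: pderiv_pCons)
qed

lemma points_quadric_chart:
  assumes "i \<in> {1..5}"
  shows "points (quadric_chart i) = {y \<in> coord_space {1..5}. y i = 1 \<and> dot y y = 0}"
proof -
  have "(\<forall>j<2. chart_equations i j y = 0) \<longleftrightarrow> y i = 1 \<and> dot y y = 0" for y :: "nat \<Rightarrow> 'a"
    unfolding chart_equations_def by (auto simp: less_2_cases_iff)
  then show ?thesis unfolding quadric_chart_def by (auto simp: points_affine)
qed

text \<open>
  A linear relation between the two gradients would make the gradient \<open>2 x\<close> of the quadratic form a
  multiple of the \<open>i\<close>-th unit vector, but \<open>x\<close> is isotropic and its \<open>i\<close>-th coordinate is 1.
\<close>

lemma standard_smooth_chart: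
  assumes i: "i \<in> {1..5}"
  shows "standard_smooth (quadric_chart i :: (nat \<Rightarrow> 'k::field_char_0, 'k) fspace)"
  unfolding standard_smooth_def
proof (rule exI[of _ 5], rule exI[of _ 2], rule exI[of _ "chart_equations i"],
    intro conjI ballI allI impI)
  fix j assume "j < (2::nat)"
  show "poly_fun {1..5} (chart_equations i j :: (nat \<Rightarrow> 'k) \<Rightarrow> 'k)"
    unfolding chart_equations_def dot_def using i
    by (cases "j = 0") (auto intro!: poly_fun_intros)
next
  show "quadric_chart i = subspace_of (affine_space {1..5})
    {y :: nat \<Rightarrow> 'k. y \<in> coord_space {1..5} \<and> (\<forall>j<2. chart_equations i j y = 0)}" by (rule quadric_chart_def)
next
  fix x :: "nat \<Rightarrow> 'k" and c :: "nat \<Rightarrow> 'k" and j :: nat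
  assume x: "x \<in> points (quadric_chart i)"
    and *: "\<forall>m\<in>{1..5}. (\<Sum>j<2. c j * partial_deriv m (chart_equations i j) x) = 0"
    and j: "j < 2"
  have xx: "x i = 1" "dot x x = 0" using x unfolding points_quadric_chart[OF i] by auto
  have d: "c 0 * (if m = i then 1 else 0) + c 1 * (2 * x m) = 0" if m: "m \<in> {1..5}" for m
  proof -
    have e: "chart_equations i 0 = (\<lambda>y. y i - 1 :: 'k)" "chart_equations i 1 = (\<lambda>y. dot y y :: 'k)"
      unfolding chart_equations_def by auto
    show ?thesis
      using *[rule_format, OF m] unfolding numeral_2_eq_2
      by (simp add: e[unfolded One_nat_def] partial_deriv_coord partial_deriv_dot[OF m])
  qed
  have "c 1 = 0"
  proof (rule ccontr)
    assume c: "c 1 \<noteq> 0"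
    have "x m * x m = (if m = i then 1 else 0)" if "m \<in> {1..5}" for m
      using d[OF that] c xx by (auto split: if_splits)
    then have "dot x x = (\<Sum>m=1..5. if m = i then 1 else 0)"
      unfolding dot_def by (intro sum.cong) auto
    then show False using xx(2) i by simp
  qed
  then show "c j = 0" using d[OF i] j by (cases j) (auto simp: less_2_cases_iff)
qed

lemma quadric_chart_isomorphism:
  fixes i :: nat
  assumes i: "i \<in> {1..5}"
  defines "U \<equiv> {line x |x. x \<in> quadric_cone \<and> x i \<noteq> (0::'k::field_char_0)}"
  shows "openin (zar quadric) U" "\<exists>\<phi>. isomorphism (subspace_of quadric U) (quadric_chart i) \<phi>"
proof -
  note h = hyperplane_homogeneous[where 'a='k]
  show oU: "openin (zar quadric) U"
    using reg_open[OF field_sheaf_quadric reg_hquot_quadric[OF h[OF i] h[OF i]]] unfolding U_def .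
  define \<phi> :: "(nat \<Rightarrow> 'k) set \<Rightarrow> nat \<Rightarrow> 'k" where
    "\<phi> L = (\<lambda>j. if j \<in> {1..5} then hquot (\<lambda>x. x j) (\<lambda>x. x i) L else 0)" for L
  have \<phi>l: "\<phi> (line x) = (\<lambda>j. x j / x i)" if "x \<in> quadric_cone" for x
    using that hquot_line[OF h h[OF i]] unfolding \<phi>_def by (auto simp: fun_eq_iff coord_space_def)
  have ptsU: "points (subspace_of quadric U) = U"
    using openin_subset[OF oU] by auto
  have fsU: "field_sheaf (subspace_of quadric U)" by (rule field_sheaf_subspace[OF field_sheaf_quadric])
  have scaled: "(\<lambda>j. x j / x i) \<in> coord_space {1..5} \<and> x i / x i = 1 \<and> dot (\<lambda>j. x j / x i) (\<lambda>j. x j / x i) = 0"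
    if "x \<in> quadric_cone" "x i \<noteq> 0" for x :: "nat \<Rightarrow> 'k"
    using that coord_space_smult[of x _ "inverse (x i)"] dot_smult(1)[of "inverse (x i)" x]
      dot_smult(2)[of _ "inverse (x i)" x]
    by (simp add: divide_inverse mult.commute)
  have Zeq: "{y \<in> coord_space {1..5}. \<forall>j<2. chart_equations i j y = (0::'k)} = 
      {y \<in> coord_space {1..5}. y i = 1 \<and> dot y y = 0}"
    using points_quadric_chart[OF i, where 'a='k] unfolding quadric_chart_def by (auto simp: points_affine)
  have "morphism (subspace_of quadric U) (affine_space {1..5}) \<phi>"
  proof (rule morphism_into_affine[OF fsU])
    fix j :: nat assume j: "j \<in> {1..5}"
    show "reg (subspace_of quadric U) (points (subspace_of quadric U)) (\<lambda>q. \<phi> q j)"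
      unfolding ptsU reg_open_subspace[OF field_sheaf_quadric oU]
      using reg_hquot_quadric[OF h[OF j] h[OF i]] j unfolding U_def \<phi>_def by simp
  qed (auto simp: \<phi>_def coord_space_def)
  then have m1: "morphism (subspace_of quadric U) (quadric_chart i) \<phi>"
    unfolding quadric_chart_def Zeq
    by (rule morphism_into_subspace[OF fsU field_sheaf_affine])
       (use scaled \<phi>l in \<open>auto simp: ptsU U_def\<close>)
  have fsZ: "field_sheaf (quadric_chart i :: (nat \<Rightarrow> 'k, 'k) fspace)"
    unfolding quadric_chart_def by (rule field_sheaf_subspace[OF field_sheaf_affine])
  have nz: "y \<in> quadric_cone \<and> y i = 1" if "y \<in> points (quadric_chart i)" for y :: "nat \<Rightarrow> 'k"
    using that unfolding points_quadric_chart[OF i] by auto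
  have "morphism (quadric_chart i) (projective_space {1..5}) (line :: (nat \<Rightarrow> 'k) \<Rightarrow> _)"
  proof (rule morphism_into_projective[OF fsZ])
    fix p :: "nat \<Rightarrow> 'k" assume p: "p \<in> points (quadric_chart i)"
    have "reg (quadric_chart i) (points (quadric_chart i)) (\<lambda>x::nat\<Rightarrow>'k. x j)" if "j \<in> {1..5}" for j
      using reg_subspace[OF field_sheaf_affine reg_coord_affine[OF that]]
      unfolding quadric_chart_def by (simp add: points_affine)
    then show "\<exists>W g. openin (zar (quadric_chart i)) W \<and> p \<in> W \<and>
       (\<forall>j\<in>{1..5}. reg (quadric_chart i) W (\<lambda>q. g q j)) \<and>
       (\<forall>q\<in>W. g q \<in> coord_space {1..5} \<and> g q \<noteq> (\<lambda>_. 0) \<and> line q = line (g q))"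
      using p nz by (intro exI[of _ "points (quadric_chart i)"] exI[of _ "\<lambda>q. q"]) auto
  qed
  then have "morphism (quadric_chart i) quadric (line :: (nat \<Rightarrow> 'k) \<Rightarrow> _)"
    unfolding quadric_eq
    by (rule morphism_into_subspace[OF fsZ field_sheaf_projective]) (use nz in auto)
  then have m2: "morphism (quadric_chart i) (subspace_of quadric U) (line :: (nat \<Rightarrow> 'k) \<Rightarrow> _)"
  proof (rule morphism_into_subspace[OF fsZ field_sheaf_quadric])
    fix y :: "nat \<Rightarrow> 'k" assume "y \<in> points (quadric_chart i)"
    from nz[OF this] show "line y \<in> U" unfolding U_def by (intro CollectI exI[of _ y]) simp
  qed
  have "line (\<phi> p) = p" if p: "p \<in> U" for p
  proof -
    obtain x where x: "p = line x" "x \<in> quadric_cone" "x i \<noteq> 0" using p unfolding U_def by blast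
    show ?thesis using line_smult[of "inverse (x i)" x] x by (simp add: \<phi>l divide_inverse mult.commute)
  qed
  moreover have "\<phi> (line y) = y" if "y \<in> points (quadric_chart i)" for y
    using nz[OF that] by (subst \<phi>l) auto
  ultimately show "\<exists>\<phi>. isomorphism (subspace_of quadric U) (quadric_chart i) \<phi>"
    unfolding isomorphism_def using m1 m2 ptsU by blast
qed

lemma smooth_quadric:
  "smooth_variety (quadric :: ((nat \<Rightarrow> 'k::{alg_closed_field, field_char_0}) set, 'k) fspace)"
  unfolding smooth_variety_def
proof (intro conjI)
  let ?X = "quadric :: ((nat \<Rightarrow> 'k) set, 'k) fspace"
  show "sheaf_of_functions ?X" using field_sheaf_quadric unfolding field_sheaf_def by blast
  show "irreducible_space (zar ?X)" by (rule irreducible_quadric)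
  show "closedin (zar (product_of ?X ?X)) {(p, p) |p. p \<in> points ?X}"
    using separated_projective_subspace[of "{1..5}" "line ` (quadric_cone :: (nat \<Rightarrow> 'k) set)"]
    unfolding quadric_eq .
  let ?U = "\<lambda>i. {line x |x. x \<in> quadric_cone \<and> x i \<noteq> (0::'k)}"
  show "\<exists>\<U>. finite \<U> \<and> \<Union> \<U> = points ?X \<and> (\<forall>U\<in>\<U>. openin (zar ?X) U \<and>
      (\<exists>Z \<phi>. standard_smooth Z \<and> isomorphism (subspace_of ?X U) Z \<phi>))"
  proof (intro exI[of _ "?U ` {1..5}"] conjI ballI)
    show "\<Union> (?U ` {1..5}) = points ?X"
    proof
      show "points ?X \<subseteq> \<Union> (?U ` {1..5})"
      proof
        fix p assume "p \<in> points ?X"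
        then obtain x where x: "p = line x" "x \<in> quadric_cone" unfolding points_quadric by blast
        then obtain i where "x i \<noteq> 0" by blast
        moreover from this have "i \<in> {1..5}" using x(2) unfolding coord_space_def by blast
        ultimately show "p \<in> \<Union> (?U ` {1..5})" using x by blast
      qed
    qed (auto simp: points_quadric)
    fix U assume "U \<in> ?U ` {1..5}"
    then obtain i where i: "i \<in> {1..5}" "U = ?U i" by blast
    show "openin (zar ?X) U" using quadric_chart_isomorphism(1)[OF i(1), where 'k='k] i(2) by simp
    show "\<exists>Z \<phi>. standard_smooth Z \<and> isomorphism (subspace_of ?X U) Z \<phi>"
      using quadric_chart_isomorphism(2)[OF i(1), where 'k='k] standard_smooth_chart[OF i(1), where 'k='k]
      unfolding i(2) by blast
  qed simp
qed

section \<open>Equivariant frames\<close>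

lemma poly_fun_det:
  assumes "\<And>x. A x \<in> carrier_mat n n"
    and "\<And>i j. i < n \<Longrightarrow> j < n \<Longrightarrow> poly_fun I (\<lambda>x. A x $$ (i, j))"
  shows "poly_fun I (\<lambda>x. det (A x))"
proof -
  have "poly_fun I (\<lambda>x. \<Sum>p | p permutes {0..<n}. signof p * (\<Prod>i = 0..<n. A x $$ (i, p i)))"
  proof (intro poly_fun_sum poly_fun.mult poly_fun_prod)
    fix p i assume p: "p \<in> {p. p permutes {0..<n}}" and i: "i \<in> {0..<n}"
    then have "p i < n" using permutes_in_image by fastforce
    then show "poly_fun I (\<lambda>x. A x $$ (i, p i))" using assms(2) i by simp
  qed (rule poly_fun.const)
  then show ?thesis by (simp add: det_def'[OF assms(1)])
qed

lemma poly_fun_adj_mat: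
  assumes A: "\<And>x. A x \<in> carrier_mat n n"
    and p: "\<And>i j. i < n \<Longrightarrow> j < n \<Longrightarrow> poly_fun I (\<lambda>x. A x $$ (i, j))"
    and ij: "i < n" "j < n"
  shows "poly_fun I (\<lambda>x. adj_mat (A x) $$ (i, j))"
proof -
  have dim: "dim_row (A x) = n" "dim_col (A x) = n" for x using A[of x] by auto
  have "poly_fun I (\<lambda>x. det (mat_delete (A x) j i))"
  proof (rule poly_fun_det[where n="n - 1"])
    show "mat_delete (A x) j i \<in> carrier_mat (n - 1) (n - 1)" for x
      using A[of x] by (rule mat_delete_carrier)
    fix k l assume "k < n - 1" "l < n - 1"
    then show "poly_fun I (\<lambda>x. mat_delete (A x) j i $$ (k, l))"
      unfolding mat_delete_def dim by (auto intro!: p)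
  qed
  then have "poly_fun I (\<lambda>x. (- 1) ^ (j + i) * det (mat_delete (A x) j i))"
    by (rule poly_fun.mult[OF poly_fun.const])
  moreover have "adj_mat (A x) $$ (i, j) = (- 1) ^ (j + i) * det (mat_delete (A x) j i)" for x
    using ij unfolding adj_mat_def cofactor_def by (simp add: dim)
  ultimately show ?thesis by simp
qed

abbreviation vspace :: "(nat \<Rightarrow> 'k::field) set"
  where "vspace \<equiv> coord_space {1..5}"

definition std_basis :: "nat \<Rightarrow> nat \<Rightarrow> 'k::field"
  where "std_basis j = (\<lambda>i. if i = j then 1 else 0)"

lemma std_basis_expansion:
  assumes "y \<in> vspace"
  shows "y = (\<lambda>i. \<Sum>j=1..5. y j * std_basis j i)"
proof
  fix i
  show "y i = (\<Sum>j=1..5. y j * std_basis j i)"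
    using assms unfolding std_basis_def coord_space_def
    by (cases "i \<in> {1..5}") (auto simp: if_distrib[of "\<lambda>a. _ * a"] sum.delta' cong: if_cong)
qed

lemma std_basis_vspace: "j \<in> {1..5} \<Longrightarrow> std_basis j \<in> vspace"
  unfolding std_basis_def coord_space_def by auto

lemma coord_space_diff: "x \<in> coord_space I \<Longrightarrow> y \<in> coord_space I \<Longrightarrow> (\<lambda>i. x i - y i) \<in> coord_space I"
  unfolding coord_space_def by simp

lemma coord_space_sum: "(\<And>k. k \<in> A \<Longrightarrow> F k \<in> coord_space I) \<Longrightarrow> (\<lambda>i. \<Sum>k\<in>A. F k i) \<in> coord_space I"
  unfolding coord_space_def by simp

text \<open>
  Sums of five coordinates are computed on all functions of type \<open>nat \<Rightarrow> 'k\<close>; this is the projection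
  to those supported on \<open>{1..5}\<close>.
\<close>

definition restrict5 :: "(nat \<Rightarrow> 'k::field) \<Rightarrow> nat \<Rightarrow> 'k"
  where "restrict5 z = (\<lambda>j. if j \<in> {1..5} then z j else 0)"

lemma restrict5_vspace: "restrict5 z \<in> vspace"
  unfolding restrict5_def coord_space_def by auto

text \<open>
  The representation is orthogonal and faithful, \<open>lin\<close> is an invariant linear form used to normalise
  vectors on a line, and \<open>M i\<close> are equivariant vector fields. The point \<open>x0\<close> on the quadric witnesses
  that all nondegeneracy conditions hold generically: the frame is a basis there, and \<open>x0\<close> is not
  orthogonal to the isotropic vector \<open>M 5 x0\<close>. That \<open>M 1\<close> is the identity makes it possible to use the
  same \<open>x0\<close> as a point of the quadric and as a point of the representation.
\<close>

locale equivariant_frame =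
  fixes G :: "('g, 'm) monoid_scheme"
    and \<rho> :: "'g \<Rightarrow> (nat \<Rightarrow> 'k::{alg_closed_field, field_char_0}) \<Rightarrow> nat \<Rightarrow> 'k"
    and lin :: "(nat \<Rightarrow> 'k) \<Rightarrow> 'k"
    and M :: "nat \<Rightarrow> (nat \<Rightarrow> 'k) \<Rightarrow> nat \<Rightarrow> 'k"
    and x0 :: "nat \<Rightarrow> 'k"
  assumes group: "group G" and finite_group: "finite (carrier G)"
    and rep: "linear_representation G {1..5} \<rho>"
    and orthogonal: "g \<in> carrier G \<Longrightarrow> x \<in> vspace \<Longrightarrow> y \<in> vspace \<Longrightarrow> dot (\<rho> g x) (\<rho> g y) = dot x y"
    and faithful: "g \<in> carrier G \<Longrightarrow> (\<And>x. x \<in> vspace \<Longrightarrow> \<rho> g x = x) \<Longrightarrow> g = \<one>\<^bsub>G\<^esub>"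
    and lin_degree_one: "homogeneous_fun {1..5} 1 lin"
    and lin_invariant: "g \<in> carrier G \<Longrightarrow> x \<in> vspace \<Longrightarrow> lin (\<rho> g x) = lin x"
    and frame_poly: "i \<in> {1..5} \<Longrightarrow> j \<in> {1..5} \<Longrightarrow> poly_fun {1..5} (\<lambda>x. M i x j)"
    and frame_vspace: "i \<in> {1..5} \<Longrightarrow> x \<in> vspace \<Longrightarrow> M i x \<in> vspace"
    and frame_equivariant: "g \<in> carrier G \<Longrightarrow> i \<in> {1..5} \<Longrightarrow> x \<in> vspace \<Longrightarrow> M i (\<rho> g x) = \<rho> g (M i x)"
    and frame_first: "x \<in> vspace \<Longrightarrow> M 1 x = x"
    and frame_isotropic: "x \<in> vspace \<Longrightarrow> dot (M 5 x) (M 5 x) = 0"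
    and x0: "x0 \<in> vspace" "dot x0 x0 = 0" "lin x0 = 1" "dot (M 5 x0) x0 \<noteq> 0"
    and x0_independent: "(\<And>j. j \<in> {1..5} \<Longrightarrow> (\<Sum>i=1..5. b i * M i x0 j) = 0) \<Longrightarrow> i \<in> {1..5} \<Longrightarrow> b i = 0"
begin

lemma rho_vspace: "g \<in> carrier G \<Longrightarrow> x \<in> vspace \<Longrightarrow> \<rho> g x \<in> vspace"
  using rep unfolding linear_representation_def by blast

lemma rho_add: "g \<in> carrier G \<Longrightarrow> x \<in> vspace \<Longrightarrow> y \<in> vspace \<Longrightarrow>
    \<rho> g (\<lambda>i. x i + y i) = (\<lambda>i. \<rho> g x i + \<rho> g y i)"
  using rep unfolding linear_representation_def by blast

lemma rho_smult: "g \<in> carrier G \<Longrightarrow> x \<in> vspace \<Longrightarrow> \<rho> g (\<lambda>i. c * x i) = (\<lambda>i. c * \<rho> g x i)"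
  using rep unfolding linear_representation_def by blast

lemma rho_one: "x \<in> vspace \<Longrightarrow> \<rho> \<one>\<^bsub>G\<^esub> x = x"
  using rep unfolding linear_representation_def by blast

lemma rho_mult: "g \<in> carrier G \<Longrightarrow> h \<in> carrier G \<Longrightarrow> x \<in> vspace \<Longrightarrow> \<rho> (g \<otimes>\<^bsub>G\<^esub> h) x = \<rho> g (\<rho> h x)"
  using rep unfolding linear_representation_def by blast

lemma rho_zero: "g \<in> carrier G \<Longrightarrow> \<rho> g (\<lambda>_. 0) = (\<lambda>_. 0)"
  using rho_smult[of g "\<lambda>_. 0" 0] by (simp add: coord_space_def)

lemma rho_sum:
  assumes g: "g \<in> carrier G" and F: "\<And>i. i \<in> A \<Longrightarrow> F i \<in> vspace"
  shows "\<rho> g (\<lambda>j. \<Sum>i\<in>A. c i * F i j) = (\<lambda>j. \<Sum>i\<in>A. c i * \<rho> g (F i) j)"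
  using F
proof (induction A rule: infinite_finite_induct)
  case (insert i A)
  have "(\<lambda>j. c i * F i j) \<in> vspace" "(\<lambda>j. \<Sum>i\<in>A. c i * F i j) \<in> vspace"
    using insert.prems by (auto intro!: coord_space_smult coord_space_sum)
  from rho_add[OF g this] show ?case
    using insert by (simp add: rho_smult[OF g])
qed (simp_all add: rho_zero[OF g])

lemma rho_diff:
  assumes g: "g \<in> carrier G" and "x \<in> vspace" "y \<in> vspace"
  shows "\<rho> g (\<lambda>i. x i - y i) = (\<lambda>i. \<rho> g x i - \<rho> g y i)"
  using rho_add[OF g assms(2) coord_space_smult[OF assms(3), of "-1"]] rho_smult[OF g assms(3), of "-1"] by simp

lemma rho_inverse:
  assumes g: "g \<in> carrier G" and x: "x \<in> vspace"
  shows "\<rho> (inv\<^bsub>G\<^esub> g) (\<rho> g x) = x"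
  using rho_mult[of "inv\<^bsub>G\<^esub> g" g x] rho_one[OF x] x group g by (simp add: group.l_inv)

lemma rho_nonzero:
  assumes g: "g \<in> carrier G" and x: "x \<in> vspace" "x \<noteq> (\<lambda>_. 0)"
  shows "\<rho> g x \<noteq> (\<lambda>_. 0)"
proof
  assume "\<rho> g x = (\<lambda>_. 0)"
  then have "x = \<rho> (inv\<^bsub>G\<^esub> g) (\<lambda>_. 0)" using rho_inverse[OF g x(1)] by simp
  then show False using rho_zero[of "inv\<^bsub>G\<^esub> g"] group g x(2) by (simp add: group.inv_closed)
qed

lemma lin_poly: "poly_fun {1..5} lin"
  using lin_degree_one unfolding homogeneous_fun_def by blast

lemma lin_smult: "lin (\<lambda>i. c * x i) = c * lin x"
  using lin_degree_one unfolding homogeneous_fun_def by simp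

lemma lin_zero: "lin (\<lambda>_. 0) = 0"
  using lin_smult[of 0 "\<lambda>_. 0"] by simp

text \<open>
  The columns are the frame vectors, with indices shifted to start at 0.
\<close>

definition frame_matrix :: "(nat \<Rightarrow> 'k) \<Rightarrow> 'k mat"
  where "frame_matrix x = mat 5 5 (\<lambda>(j, i). M (Suc i) x (Suc j))"

definition \<Delta> :: "(nat \<Rightarrow> 'k) \<Rightarrow> 'k"
  where "\<Delta> x = det (frame_matrix x)"

definition dual_frame :: "nat \<Rightarrow> (nat \<Rightarrow> 'k) \<Rightarrow> nat \<Rightarrow> 'k"
  where "dual_frame i x j = adj_mat (frame_matrix x) $$ (i - 1, j - 1)"

definition coefficient :: "(nat \<Rightarrow> 'k) \<Rightarrow> (nat \<Rightarrow> 'k) \<Rightarrow> nat \<Rightarrow> 'k"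
  where "coefficient x v i = (\<Sum>j=1..5. dual_frame i x j * v j) / \<Delta> x"

definition combination :: "(nat \<Rightarrow> 'k) \<Rightarrow> (nat \<Rightarrow> 'k) \<Rightarrow> nat \<Rightarrow> 'k"
  where "combination a x = (\<lambda>j. \<Sum>i=1..5. a i * M i x j)"

lemma frame_matrix_carrier: "frame_matrix x \<in> carrier_mat 5 5"
  unfolding frame_matrix_def by simp

lemma frame_matrix_poly:
  assumes "i < 5" "j < 5"
  shows "poly_fun {1..5} (\<lambda>x. frame_matrix x $$ (i, j))"
proof -
  have "poly_fun {1..5} (\<lambda>x. M (Suc j) x (Suc i))" by (rule frame_poly) (use assms in auto)
  then show ?thesis using assms unfolding frame_matrix_def by (simp del: One_nat_def)
qed

lemma Delta_poly: "poly_fun {1..5} \<Delta>"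
  unfolding \<Delta>_def[abs_def]
  by (rule poly_fun_det[OF frame_matrix_carrier frame_matrix_poly])

lemma dual_frame_poly: "i \<in> {1..5} \<Longrightarrow> j \<in> {1..5} \<Longrightarrow> poly_fun {1..5} (\<lambda>x. dual_frame i x j)"
  unfolding dual_frame_def
  by (rule poly_fun_adj_mat[OF frame_matrix_carrier frame_matrix_poly]) auto

lemma sum_shift5: "(\<Sum>i=1..5. f i) = (\<Sum>i<5. f (Suc i))" for f :: "nat \<Rightarrow> 'k"
  by (simp add: sum.atLeast1_atMost_eq)

lemma dual_frame_left:
  assumes "i \<in> {1..5}" "k \<in> {1..5}"
  shows "(\<Sum>j=1..5. dual_frame i x j * M k x j) = (if i = k then \<Delta> x else 0)"
proof -
  have ik: "i - 1 < 5" "k - 1 < 5" "i - 1 = k - 1 \<longleftrightarrow> i = k" using assms by auto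
  have "(adj_mat (frame_matrix x) * frame_matrix x) $$ (i - 1, k - 1) =
      (\<Sum>j<5. adj_mat (frame_matrix x) $$ (i - 1, j) * frame_matrix x $$ (j, k - 1))"
    using ik adj_mat(1)[OF frame_matrix_carrier, of x] frame_matrix_carrier[of x]
    by (auto simp: times_mat_def scalar_prod_def atLeast0LessThan)
  also have "\<dots> = (\<Sum>j=1..5. dual_frame i x j * M k x j)"
    using assms unfolding sum_shift5 dual_frame_def by (intro sum.cong) (auto simp: frame_matrix_def)
  finally show ?thesis
    using ik unfolding adj_mat(3)[OF frame_matrix_carrier] by (auto simp: \<Delta>_def)
qed

lemma dual_frame_right:
  assumes "j \<in> {1..5}" "k \<in> {1..5}"
  shows "(\<Sum>i=1..5. M i x j * dual_frame i x k) = (if j = k then \<Delta> x else 0)"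
proof -
  have jk: "j - 1 < 5" "k - 1 < 5" "j - 1 = k - 1 \<longleftrightarrow> j = k" using assms by auto
  have "(frame_matrix x * adj_mat (frame_matrix x)) $$ (j - 1, k - 1) =
      (\<Sum>i<5. frame_matrix x $$ (j - 1, i) * adj_mat (frame_matrix x) $$ (i, k - 1))"
    using jk adj_mat(1)[OF frame_matrix_carrier, of x] frame_matrix_carrier[of x]
    by (auto simp: times_mat_def scalar_prod_def atLeast0LessThan)
  also have "\<dots> = (\<Sum>i=1..5. M i x j * dual_frame i x k)"
    using assms unfolding sum_shift5 dual_frame_def by (intro sum.cong) (auto simp: frame_matrix_def)
  finally show ?thesis
    using jk unfolding adj_mat(2)[OF frame_matrix_carrier] by (auto simp: \<Delta>_def)
qed

lemma coefficient_combination: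
  assumes "\<Delta> x \<noteq> 0" "i \<in> {1..5}"
  shows "coefficient x (combination a x) i = a i"
proof -
  have "(\<Sum>j=1..5. dual_frame i x j * combination a x j) =
      (\<Sum>j=1..5. \<Sum>k=1..5. a k * (dual_frame i x j * M k x j))"
    unfolding combination_def by (simp add: sum_distrib_left mult_ac)
  also have "\<dots> = (\<Sum>k=1..5. a k * (\<Sum>j=1..5. dual_frame i x j * M k x j))"
    by (subst sum.swap) (simp add: sum_distrib_left)
  also have "\<dots> = (\<Sum>k=1..5. a k * (if i = k then \<Delta> x else 0))"
    using dual_frame_left[OF assms(2)] by (intro sum.cong) auto
  also have "\<dots> = a i * \<Delta> x"
    using assms(2) by (simp add: if_distrib[of "\<lambda>b. _ * b"] cong: if_cong)
  finally show ?thesis unfolding coefficient_def using assms(1) by simp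
qed

lemma combination_vspace: "x \<in> vspace \<Longrightarrow> combination a x \<in> vspace"
  unfolding combination_def by (rule coord_space_sum, rule coord_space_smult, rule frame_vspace)

lemma combination_coefficient:
  assumes "\<Delta> x \<noteq> 0" "x \<in> vspace" "v \<in> vspace"
  shows "combination (coefficient x v) x = v"
proof
  fix j
  show "combination (coefficient x v) x j = v j"
  proof (cases "j \<in> {1..5}")
    case False
    then have "combination (coefficient x v) x j = 0" "v j = 0"
      using combination_vspace[OF assms(2), of "coefficient x v"] assms(3) by (simp_all add: coord_space_def)
    then show ?thesis by simp
  next
    case True
    have "combination (coefficient x v) x j = (\<Sum>i=1..5. \<Sum>k=1..5. v k * (M i x j * dual_frame i x k)) / \<Delta> x"
      unfolding combination_def coefficient_def
      by (simp add: sum_divide_distrib sum_distrib_left sum_distrib_right mult_ac)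
    also have "(\<Sum>i=1..5. \<Sum>k=1..5. v k * (M i x j * dual_frame i x k)) =
        (\<Sum>k=1..5. v k * (\<Sum>i=1..5. M i x j * dual_frame i x k))"
      by (subst sum.swap) (simp add: sum_distrib_left)
    also have "\<dots> = (\<Sum>k=1..5. v k * (if j = k then \<Delta> x else 0))"
      using dual_frame_right[OF True] by (intro sum.cong) auto
    also have "\<dots> = v j * \<Delta> x"
      using True by (simp add: if_distrib[of "\<lambda>b. _ * b"] cong: if_cong)
    finally show ?thesis using assms(1) by simp
  qed
qed

lemma coefficient_eqI:
  assumes "\<Delta> x \<noteq> 0" "v = combination a x" "i \<in> {1..5}"
  shows "coefficient x v i = a i"
  unfolding assms(2) by (rule coefficient_combination[OF assms(1,3)])

lemma rho_combination:
  assumes "g \<in> carrier G" "x \<in> vspace"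
  shows "\<rho> g (combination a x) = combination a (\<rho> g x)"
  unfolding combination_def using assms
  by (subst rho_sum) (auto intro!: frame_vspace simp: frame_equivariant simp del: One_nat_def)

text \<open>
  Equivariance of the frame means that coordinates with respect to it are invariants. This is why the
  group acts trivially on the new coordinates of both trivialisations.
\<close>

lemma coefficient_invariant:
  assumes g: "g \<in> carrier G" and x: "x \<in> vspace" and v: "v \<in> vspace"
    and "\<Delta> x \<noteq> 0" "\<Delta> (\<rho> g x) \<noteq> 0" "i \<in> {1..5}"
  shows "coefficient (\<rho> g x) (\<rho> g v) i = coefficient x v i"
  by (rule coefficient_eqI[OF assms(5) _ assms(6)])
     (simp add: rho_combination[OF g x, symmetric] combination_coefficient[OF assms(4) x v])

lemma Delta_x0: "\<Delta> x0 \<noteq> 0"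
proof
  assume "\<Delta> x0 = 0"
  then obtain b where b: "b \<in> carrier_vec 5" "b \<noteq> 0\<^sub>v 5" "frame_matrix x0 *\<^sub>v b = 0\<^sub>v 5"
    unfolding \<Delta>_def det_0_iff_vec_prod_zero_field[OF frame_matrix_carrier] by blast
  have "(\<Sum>i=1..5. b $ (i - 1) * M i x0 j) = 0" if j: "j \<in> {1..5}" for j
  proof -
    have "j - 1 < 5" using j by auto
    then have "0 = (frame_matrix x0 *\<^sub>v b) $ (j - 1)" unfolding b(3) by simp
    also have "\<dots> = (\<Sum>i<5. frame_matrix x0 $$ (j - 1, i) * b $ i)"
      using j b(1) frame_matrix_carrier[of x0]
      by (auto simp: mult_mat_vec_def scalar_prod_def atLeast0LessThan)
    also have "\<dots> = (\<Sum>i=1..5. b $ (i - 1) * M i x0 j)"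
      using j unfolding sum_shift5 by (intro sum.cong) (auto simp: frame_matrix_def)
    finally show ?thesis by simp
  qed
  from x0_independent[OF this] have "b $ i = 0" if "i < 5" for i
    using that by (metis Suc_leI atLeastAtMost_iff diff_Suc_1 le_add1 plus_1_eq_Suc)
  then show False using b(1,2) by (auto simp: vec_eq_iff)
qed


section \<open>The action on the quadric\<close>

lemma rho_quadric_cone:
  assumes g: "g \<in> carrier G" and x: "x \<in> quadric_cone"
  shows "\<rho> g x \<in> quadric_cone"
  using x rho_vspace[OF g] rho_nonzero[OF g] orthogonal[OF g] by auto

lemma rho_image_line:
  assumes "g \<in> carrier G" "x \<in> vspace"
  shows "\<rho> g ` line x = line (\<rho> g x)"
  using rho_smult[OF assms] unfolding line_def by (simp add: image_image)

lemma quadric_action: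
  assumes g: "g \<in> carrier G" and x: "x \<in> quadric_cone"
  shows "induced_action \<rho> quadric g (line x) = line (\<rho> g x)"
  using rho_image_line[OF g, of x] x points_quadric[where 'a='k] unfolding induced_action_def by auto

lemma quadric_action_group_action: "group_action G (points quadric) (induced_action \<rho> quadric)"
proof -
  let ?E = "points (quadric :: ((nat \<Rightarrow> 'k) set, 'k) fspace)"
  let ?a = "induced_action \<rho> quadric"
  have maps: "?a g p \<in> ?E" if g: "g \<in> carrier G" and p: "p \<in> ?E" for g p
  proof -
    obtain x where x: "x \<in> quadric_cone" "p = line x" using p unfolding points_quadric by blast
    then show ?thesis
      using quadric_action[OF g x(1)] rho_quadric_cone[OF g x(1)] unfolding points_quadric by auto
  qed
  have mult: "?a (g \<otimes>\<^bsub>G\<^esub> h) p = ?a g (?a h p)" if gh: "g \<in> carrier G" "h \<in> carrier G" and p: "p \<in> ?E" for g h p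
  proof -
    obtain x where x: "x \<in> quadric_cone" "p = line x" using p unfolding points_quadric by blast
    have "g \<otimes>\<^bsub>G\<^esub> h \<in> carrier G" using group gh by (simp add: group.is_monoid monoid.m_closed)
    then show ?thesis
      using x gh rho_quadric_cone[OF gh(2) x(1)] by (simp add: quadric_action rho_mult)
  qed
  have one: "?a \<one>\<^bsub>G\<^esub> p = p" if p: "p \<in> ?E" for p
  proof -
    obtain x where x: "x \<in> quadric_cone" "p = line x" using p unfolding points_quadric by blast
    have "\<one>\<^bsub>G\<^esub> \<in> carrier G" using group by (simp add: group.is_monoid monoid.one_closed)
    then show ?thesis using x by (simp add: quadric_action rho_one)
  qed
  have ext: "?a g \<in> extensional ?E" for g unfolding induced_action_def by simp
  have bij: "?a g \<in> Bij ?E" if g: "g \<in> carrier G" for g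
  proof -
    have i: "inv\<^bsub>G\<^esub> g \<in> carrier G" using group g by (simp add: group.inv_closed)
    have "bij_betw (?a g) ?E ?E"
    proof (rule bij_betw_byWitness[where f'="?a (inv\<^bsub>G\<^esub> g)"])
      show "\<forall>p\<in>?E. ?a (inv\<^bsub>G\<^esub> g) (?a g p) = p"
        using mult[OF i g, symmetric] one group g by (simp add: group.l_inv)
      show "\<forall>p\<in>?E. ?a g (?a (inv\<^bsub>G\<^esub> g) p) = p"
        using mult[OF g i, symmetric] one group g by (simp add: group.r_inv)
    qed (use maps[OF g] maps[OF i] in auto)
    with ext show ?thesis unfolding Bij_def by blast
  qed
  have "?a \<in> hom G (BijGroup ?E)"
  proof (rule homI)
    fix g h assume gh: "g \<in> carrier G" "h \<in> carrier G"
    have "?a (g \<otimes>\<^bsub>G\<^esub> h) = compose ?E (?a g) (?a h)"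
      by (rule extensionalityI[OF ext]) (auto simp: compose_def mult[OF gh])
    then show "?a (g \<otimes>\<^bsub>G\<^esub> h) = ?a g \<otimes>\<^bsub>BijGroup ?E\<^esub> ?a h"
      using bij gh by (simp add: BijGroup_def)
  qed (use bij in \<open>simp add: BijGroup_def\<close>)
  then show ?thesis
    unfolding group_action_def
    using group group_BijGroup by (simp add: group_hom_def group_hom_axioms_def)
qed

lemma rho_coordinate:
  assumes "g \<in> carrier G" "y \<in> vspace"
  shows "\<rho> g y i = (\<Sum>j=1..5. y j * \<rho> g (std_basis j) i)"
proof -
  have "\<rho> g y = \<rho> g (\<lambda>i. \<Sum>j=1..5. y j * std_basis j i)" using std_basis_expansion[OF assms(2)] by simp
  also have "\<dots> = (\<lambda>i. \<Sum>j=1..5. y j * \<rho> g (std_basis j) i)"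
    by (rule rho_sum[OF assms(1)]) (rule std_basis_vspace)
  finally show ?thesis by simp
qed

text \<open>
  Locally a point of the quadric is spanned by its vector of coordinates divided by the \<open>k\<close>-th one,
  and the group acts on that vector by linear combinations.
\<close>

lemma quadric_action_morphism:
  assumes g: "g \<in> carrier G"
  shows "morphism quadric quadric (induced_action \<rho> quadric g)"
proof -
  let ?a = "induced_action \<rho> quadric g" and ?X = "quadric :: ((nat \<Rightarrow> 'k) set, 'k) fspace"
  have "morphism ?X (projective_space {1..5}) ?a"
  proof (rule morphism_into_projective[OF field_sheaf_quadric])
    fix p assume "p \<in> points ?X"
    then obtain x where x: "x \<in> quadric_cone" "p = line x" unfolding points_quadric by blast
    then obtain k where k: "x k \<noteq> 0" by blast
    have kI: "k \<in> {1..5}" using k x(1) unfolding coord_space_def by blast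
    define W where "W = {line x |x. x \<in> quadric_cone \<and> x k \<noteq> (0::'k)}"
    define h where "h = (\<lambda>q j. if j \<in> {1..5} then hquot (\<lambda>x. x j) (\<lambda>x. x k) q else (0::'k))"
    have hl: "h (line y) = (\<lambda>j. inverse (y k) * y j)" if "y \<in> quadric_cone" for y
      unfolding h_def
      using that hquot_line[OF hyperplane_homogeneous hyperplane_homogeneous[OF kI], of _ y]
      by (auto simp: fun_eq_iff coord_space_def divide_inverse mult.commute)
    have reg_h: "reg ?X W (\<lambda>q. h q j)" if "j \<in> {1..5}" for j
      using reg_hquot_quadric[OF hyperplane_homogeneous[OF that] hyperplane_homogeneous[OF kI]] that
      unfolding h_def W_def by simp
    have hv: "h q \<in> vspace" for q unfolding h_def coord_space_def by auto
    have oW: "openin (zar ?X) W" using reg_open[OF field_sheaf_quadric reg_h[OF kI]] .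
    have 1: "\<forall>i\<in>{1..5}. reg ?X W (\<lambda>q. \<rho> g (h q) i)"
      unfolding rho_coordinate[OF g hv]
      by (intro ballI reg_sum[OF field_sheaf_quadric oW] reg_mult[OF field_sheaf_quadric]
          reg_h reg_const[OF field_sheaf_quadric oW])
    have 2: "\<rho> g (h q) \<in> vspace \<and> \<rho> g (h q) \<noteq> (\<lambda>_. 0) \<and> ?a q = line (\<rho> g (h q))" if q: "q \<in> W" for q
    proof -
      obtain y where y: "y \<in> quadric_cone" "q = line y" "y k \<noteq> 0" using q unfolding W_def by blast
      have yv: "y \<in> vspace" and y0: "y \<noteq> (\<lambda>_. 0)" using y(1) by auto
      have e: "\<rho> g (h q) = (\<lambda>j. inverse (y k) * \<rho> g y j)"
        using y(2) rho_smult[OF g yv] by (simp add: hl[OF y(1)])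
      have "h q \<noteq> (\<lambda>_. 0)" using y(3) unfolding y(2) hl[OF y(1)] by (metis left_inverse zero_neq_one)
      then have "\<rho> g (h q) \<noteq> (\<lambda>_. 0)" by (rule rho_nonzero[OF g hv])
      moreover have "?a q = line (\<rho> g (h q))"
        unfolding e unfolding y(2) using line_smult[of "inverse (y k)" "\<rho> g y"] y(3)
        by (simp add: quadric_action[OF g y(1)])
      ultimately show ?thesis using rho_vspace[OF g hv] by blast
    qed
    have "p \<in> W" using x k unfolding W_def by blast
    then show "\<exists>W h. openin (zar ?X) W \<and> p \<in> W \<and> (\<forall>i\<in>{1..5}. reg ?X W (\<lambda>q. h q i)) \<and>
      (\<forall>q\<in>W. h q \<in> coord_space {1..5} \<and> h q \<noteq> (\<lambda>_. 0) \<and> ?a q = line (h q))"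
      using oW 1 2 by (intro exI[of _ W] exI[of _ "\<lambda>q. \<rho> g (h q)"]) blast
  qed
  then have "morphism ?X (subspace_of (projective_space {1..5}) (line ` quadric_cone)) ?a"
  proof (rule morphism_into_subspace[OF field_sheaf_quadric field_sheaf_projective])
    fix p assume "p \<in> points ?X"
    then obtain x where x: "x \<in> quadric_cone" "p = line x" unfolding points_quadric by blast
    then show "?a p \<in> line ` quadric_cone"
      using quadric_action[OF g x(1)] rho_quadric_cone[OF g x(1)] by auto
  qed
  then show ?thesis by (simp only: quadric_eq[symmetric])
qed

text \<open>
  The spanning vector on which \<open>lin\<close> takes the value 1.
\<close>

definition normalised :: "(nat \<Rightarrow> 'k) set \<Rightarrow> nat \<Rightarrow> 'k"
  where "normalised L = (\<lambda>j. if j \<in> {1..5} then hquot (\<lambda>x. x j) lin L else 0)"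

definition quadric_lin :: "(nat \<Rightarrow> 'k) set set"
  where "quadric_lin = {line x |x. x \<in> quadric_cone \<and> lin x \<noteq> 0}"

lemma lin_homogeneous: "homogeneous_fun {1..5} (Suc 0) lin"
  using lin_degree_one by simp

lemma normalised_line:
  assumes "x \<in> vspace" "x \<noteq> (\<lambda>_. 0)"
  shows "normalised (line x) = (\<lambda>j. x j / lin x)"
  unfolding normalised_def
  using assms hquot_line[OF hyperplane_homogeneous lin_homogeneous, of _ x]
  by (auto simp: fun_eq_iff coord_space_def)

lemma reg_normalised: "j \<in> {1..5} \<Longrightarrow> reg quadric quadric_lin (\<lambda>L. normalised L j)"
  using reg_hquot_quadric[OF hyperplane_homogeneous lin_homogeneous, of j]
  unfolding normalised_def quadric_lin_def by simp

lemma open_quadric_lin: "openin (zar quadric) quadric_lin"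
  by (rule reg_open[OF field_sheaf_quadric reg_normalised[of 1]]) simp

lemma quadric_linE:
  assumes "L \<in> quadric_lin"
  shows "L = line (normalised L)" "normalised L \<in> quadric_cone" "lin (normalised L) = 1"
proof -
  obtain x where x: "L = line x" "x \<in> quadric_cone" "lin x \<noteq> 0" using assms unfolding quadric_lin_def by blast
  have n: "normalised L = (\<lambda>j. inverse (lin x) * x j)"
    using x normalised_line[of x] by (simp add: divide_inverse mult.commute)
  have i: "inverse (lin x) \<noteq> 0" using x(3) by simp
  show "L = line (normalised L)" using line_smult[OF i, of x] x(1) n by simp
  have "x \<noteq> (\<lambda>_. 0)" using x by auto
  then have "(\<lambda>j. inverse (lin x) * x j) \<noteq> (\<lambda>_. 0)" using i by (auto simp: fun_eq_iff)
  then show "normalised L \<in> quadric_cone"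
    using x(2) coord_space_smult[of x] unfolding n by (simp add: dot_simps)
  show "lin (normalised L) = 1" unfolding n lin_smult using x(3) by simp
qed

lemma normalised_id:
  assumes "x \<in> vspace" "lin x = 1"
  shows "normalised (line x) = x"
proof -
  have "x \<noteq> (\<lambda>_. 0)" using assms(2) lin_zero by auto
  then show ?thesis using normalised_line[OF assms(1)] assms(2) by simp
qed

lemma x0_nonzero: "x0 \<noteq> (\<lambda>_. 0)"
  using x0(3) lin_zero by auto

text \<open>
  An element fixing a line fixes its normalised spanning vector \<open>r\<close>, by invariance of \<open>lin\<close>, hence the
  frame at \<open>r\<close>. If that is a basis, the element acts trivially on the representation.
\<close>

lemma generically_free_quadric: "generically_free G quadric (induced_action \<rho> quadric)"
proof -
  let ?X = "quadric :: ((nat \<Rightarrow> 'k) set, 'k) fspace"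
  define U where "U = {L \<in> quadric_lin. \<Delta> (normalised L) \<noteq> 0}"
  have "reg ?X quadric_lin (\<lambda>L. \<Delta> (normalised L))"
    by (rule reg_poly_fun[OF field_sheaf_quadric Delta_poly open_quadric_lin reg_normalised])
  then have oU: "openin (zar ?X) U" unfolding U_def by (rule open_nonzero[OF field_sheaf_quadric])
  have "line x0 \<in> U"
    unfolding U_def quadric_lin_def using x0 x0_nonzero Delta_x0 normalised_id[OF x0(1,3)] by auto
  moreover have "g = \<one>\<^bsub>G\<^esub>" if L: "L \<in> U" and g: "g \<in> carrier G" and fixed: "induced_action \<rho> quadric g L = L" for L g
  proof (rule faithful[OF g])
    let ?r = "normalised L"
    have r: "L = line ?r" "?r \<in> quadric_cone" "lin ?r = 1" "\<Delta> ?r \<noteq> 0"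
      using L quadric_linE[of L] unfolding U_def by auto
    have rv: "?r \<in> vspace" using r(2) by simp
    have "line (\<rho> g ?r) = line ?r" using fixed quadric_action[OF g r(2)] r(1) by simp
    then have "normalised (line (\<rho> g ?r)) = normalised (line ?r)" by simp
    then have e: "\<rho> g ?r = ?r"
      using normalised_id[OF rv r(3)] normalised_id[OF rho_vspace[OF g rv]] lin_invariant[OF g rv] r(3) by simp
    fix x :: "nat \<Rightarrow> 'k" assume x: "x \<in> vspace"
    have "\<rho> g (combination (coefficient ?r x) ?r) = combination (coefficient ?r x) ?r"
      unfolding rho_combination[OF g rv] e ..
    then show "\<rho> g x = x" using combination_coefficient[OF r(4) rv x] by simp
  qed
  ultimately show ?thesis unfolding generically_free_def using oU by blast
qed

lemma smooth_G_quadric: "smooth_G_variety G quadric (induced_action \<rho> quadric)"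
  unfolding smooth_G_variety_def regular_action_def
  using finite_group smooth_quadric quadric_action_group_action quadric_action_morphism
    generically_free_quadric by blast

section \<open>The birational map\<close>

text \<open>
  The argument \<open>u\<close> is a point of the nine-dimensional representation with last coordinate 1. Its
  first five coordinates are a vector \<open>v\<close> of the orthogonal representation, and the coordinates 6, 7, 8
  are the slopes of a line through \<open>M 5 v\<close>: its direction is \<open>M 1 v\<close> plus these multiples of \<open>M 2 v\<close>,
  \<open>M 3 v\<close>, \<open>M 4 v\<close>.
\<close>

definition slope_vector :: "(nat \<Rightarrow> 'k) \<Rightarrow> nat \<Rightarrow> 'k"
  where "slope_vector u = combination (\<lambda>i. if i = 1 then 1 else if i = 5 then 0 else u (i + 4)) (restrict5 u)"

text \<open>
  The second point of intersection of the quadric with the line joining the isotropic vector \<open>f\<close> and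
  the vector \<open>w\<close>, that is, inverse stereographic projection from \<open>f\<close>.
\<close>

definition second_point :: "(nat \<Rightarrow> 'k) \<Rightarrow> nat \<Rightarrow> 'k"
  where "second_point u = (let f = M 5 (restrict5 u); w = slope_vector u in
    (\<lambda>j. dot w w * f j - (2 * dot f w) * w j))"

definition scaled :: "(nat \<Rightarrow> 'k) \<Rightarrow> nat \<Rightarrow> 'k"
  where "scaled x = (\<lambda>j. x j / lin x)"

text \<open>
  The homogeneous coordinates of the point in the second factor, the sixth one being normalised to 1.
\<close>

definition parameters :: "(nat \<Rightarrow> 'k) \<Rightarrow> nat \<Rightarrow> 'k"
  where "parameters u = (\<lambda>i. if i \<in> {1..5} then coefficient (scaled (second_point u)) (restrict5 u) i
    else if i = 6 then 1 else 0)"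

text \<open>
  The affine coordinates on the part of projective space where the \<open>n\<close>-th homogeneous coordinate is
  nonzero.
\<close>

definition dehomogenise :: "nat \<Rightarrow> (nat \<Rightarrow> 'k) set \<Rightarrow> nat \<Rightarrow> 'k"
  where "dehomogenise n L = (\<lambda>i. if i \<in> {1..n} then hquot (\<lambda>x. x i) (\<lambda>x. x n) L else 0)"

definition to_product :: "(nat \<Rightarrow> 'k) set \<Rightarrow> (nat \<Rightarrow> 'k) set \<times> (nat \<Rightarrow> 'k) set"
  where "to_product L = (let u = dehomogenise 9 L in (line (second_point u), line (parameters u)))"

text \<open>
  Here \<open>r\<close> is a normalised point of the quadric and \<open>a\<close> its frame coordinates. They determine \<open>v\<close>, and
  the coordinates of \<open>r\<close> in the frame at \<open>v\<close>, up to a common factor and disregarding the component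
  along \<open>M 5 v\<close>, are the slopes of the line joining \<open>M 5 v\<close> and \<open>r\<close>.
\<close>

definition inverse_vector :: "(nat \<Rightarrow> 'k) \<Rightarrow> (nat \<Rightarrow> 'k) \<Rightarrow> nat \<Rightarrow> 'k"
  where "inverse_vector r a = (let v = combination a r; c = coefficient v r in
    (\<lambda>i. if i \<in> {1..5} then v i else if i \<in> {6..8} then c (i - 4) / c 1 else if i = 9 then 1 else 0))"

definition from_product :: "(nat \<Rightarrow> 'k) set \<times> (nat \<Rightarrow> 'k) set \<Rightarrow> (nat \<Rightarrow> 'k) set"
  where "from_product z = line (inverse_vector (normalised (fst z)) (dehomogenise 6 (snd z)))"

definition D :: "nat \<Rightarrow> (nat \<Rightarrow> 'k) set set"
  where "D n = {line x |x. x \<in> coord_space {1..n} \<and> x \<noteq> (\<lambda>_. 0) \<and> x n \<noteq> 0}"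

text \<open>
  The largest set on which the formula for \<open>to_product\<close> makes sense; \<open>target\<close> plays the same role for
  \<open>from_product\<close>. The two sets correspond to each other only up to proper closed subsets.
\<close>

definition source :: "(nat \<Rightarrow> 'k) set set"
  where "source = {L \<in> D 9. let x = second_point (dehomogenise 9 L) in lin x \<noteq> 0 \<and> \<Delta> (scaled x) \<noteq> 0}"

definition target :: "((nat \<Rightarrow> 'k) set \<times> (nat \<Rightarrow> 'k) set) set"
  where "target = {z \<in> quadric_lin \<times> D 6.
     let r = normalised (fst z); v = combination (dehomogenise 6 (snd z)) r in
       \<Delta> v \<noteq> 0 \<and> coefficient v r 1 \<noteq> 0}"

abbreviation P8 :: "((nat \<Rightarrow> 'k) set, 'k) fspace"
  where "P8 \<equiv> projective_space {1..9}"

abbreviation P5 :: "((nat \<Rightarrow> 'k) set, 'k) fspace"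
  where "P5 \<equiv> projective_space {1..6}"

abbreviation QP :: "((nat \<Rightarrow> 'k) set \<times> (nat \<Rightarrow> 'k) set, 'k) fspace"
  where "QP \<equiv> product_of quadric P5"

lemma coord_homogeneous: "i \<in> {1..n} \<Longrightarrow> homogeneous_fun {1..n} (Suc 0) (\<lambda>x. x i)"
  using homogeneous_fun_coord[of i "{1..n}"] by simp

lemma dehomogenise_line:
  assumes "n \<ge> 1" "x \<in> coord_space {1..n}" "x \<noteq> (\<lambda>_. 0)"
  shows "dehomogenise n (line x) = (\<lambda>i. x i / x n)"
proof -
  have n: "n \<in> {1..n}" using assms(1) by simp
  show ?thesis
    unfolding dehomogenise_def
    using assms hquot_line[OF coord_homogeneous coord_homogeneous[OF n], of _ x]
    by (auto simp: fun_eq_iff coord_space_def)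
qed

lemma dehomogenise_id:
  assumes "n \<ge> 1" "x \<in> coord_space {1..n}" "x n = 1"
  shows "dehomogenise n (line x) = x"
proof -
  have "x \<noteq> (\<lambda>_. 0)" using assms(3) by auto
  then show ?thesis using dehomogenise_line[OF assms(1,2)] assms(3) by simp
qed

lemma DE:
  assumes "n \<ge> 1" "L \<in> D n"
  shows "L = line (dehomogenise n L)" "dehomogenise n L \<in> coord_space {1..n}" "dehomogenise n L n = 1"
proof -
  obtain x where x: "L = line x" "x \<in> coord_space {1..n}" "x n \<noteq> 0" using assms unfolding D_def by blast
  then have x0: "x \<noteq> (\<lambda>_. 0)" by auto
  have n: "dehomogenise n L = (\<lambda>i. inverse (x n) * x i)"
    using dehomogenise_line[OF assms(1) x(2) x0] x(1) by (simp add: divide_inverse mult.commute)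
  show "L = line (dehomogenise n L)" using line_smult[of "inverse (x n)" x] x n by simp
  show "dehomogenise n L \<in> coord_space {1..n}" unfolding n by (rule coord_space_smult[OF x(2)])
  show "dehomogenise n L n = 1" using n x(3) by simp
qed

lemma DI:
  assumes "x \<in> coord_space {1..n}" "x n = 1"
  shows "line x \<in> D n"
  unfolding D_def using assms by (intro CollectI exI[of _ x]) auto

lemma reg_dehomogenise:
  assumes "n \<ge> 1" "i \<in> {1..n}"
  shows "reg (projective_space {1..n}) (D n) (\<lambda>L. dehomogenise n L i)"
proof -
  have n: "n \<in> {1..n}" using assms(1) by simp
  show ?thesis
    using reg_hquot[OF coord_homogeneous[OF assms(2)] coord_homogeneous[OF n]] assms(2)
    unfolding dehomogenise_def D_def by simp
qed

lemma open_D: "n \<ge> 1 \<Longrightarrow> openin (projective_zar {1..n}) (D n)"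
  using reg_open[OF field_sheaf_projective reg_dehomogenise, of n 1] by simp

lemma reg_combination:
  assumes X: "field_sheaf X" and U: "openin (zar X) U"
    and a: "\<And>i. i \<in> {1..5} \<Longrightarrow> reg X U (\<lambda>p. a p i)" and x: "\<And>i. i \<in> {1..5} \<Longrightarrow> reg X U (\<lambda>p. x p i)"
    and j: "j \<in> {1..5}"
  shows "reg X U (\<lambda>p. combination (a p) (x p) j)"
  unfolding combination_def
proof (rule reg_sum[OF X U])
  fix i :: nat assume i: "i \<in> {1..5}"
  show "reg X U (\<lambda>p. a p i * M i (x p) j)"
    by (rule reg_mult[OF X a[OF i] reg_poly_fun[OF X frame_poly[OF i j] U x]])
qed

lemma reg_coefficient:
  assumes X: "field_sheaf X" and U: "openin (zar X) U"
    and v: "\<And>i. i \<in> {1..5} \<Longrightarrow> reg X U (\<lambda>p. v p i)" and x: "\<And>i. i \<in> {1..5} \<Longrightarrow> reg X U (\<lambda>p. x p i)"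
    and nz: "\<And>p. p \<in> U \<Longrightarrow> \<Delta> (x p) \<noteq> 0" and j: "j \<in> {1..5}"
  shows "reg X U (\<lambda>p. coefficient (x p) (v p) j)"
  unfolding coefficient_def
proof (rule reg_divide[OF X _ reg_poly_fun[OF X Delta_poly U x] nz])
  show "reg X U (\<lambda>p. \<Sum>i=1..5. dual_frame j (x p) i * v p i)"
  proof (rule reg_sum[OF X U])
    fix i :: nat assume i: "i \<in> {1..5}"
    show "reg X U (\<lambda>p. dual_frame j (x p) i * v p i)"
      by (rule reg_mult[OF X reg_poly_fun[OF X dual_frame_poly[OF j i] U x] v[OF i]])
  qed
qed

lemma reg_dot:
  assumes X: "field_sheaf X" and U: "openin (zar X) U"
    and x: "\<And>i. i \<in> {1..5} \<Longrightarrow> reg X U (\<lambda>p. x p i)" and y: "\<And>i. i \<in> {1..5} \<Longrightarrow> reg X U (\<lambda>p. y p i)"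
  shows "reg X U (\<lambda>p. dot (x p) (y p))"
  unfolding dot_def by (rule reg_sum[OF X U], rule reg_mult[OF X x y])

lemma reg_second_point:
  assumes X: "field_sheaf X" and U: "openin (zar X) U"
    and u: "\<And>i. i \<in> {1..9} \<Longrightarrow> reg X U (\<lambda>p. u p i)" and j: "j \<in> {1..5}"
  shows "reg X U (\<lambda>p. second_point (u p) j)"
proof -
  have v: "reg X U (\<lambda>p. restrict5 (u p) i)" if "i \<in> {1..5}" for i
    using u[of i] that unfolding restrict5_def by simp
  have w: "reg X U (\<lambda>p. slope_vector (u p) i)" if i: "i \<in> {1..5}" for i
    unfolding slope_vector_def
  proof (rule reg_combination[OF X U _ v i])
    fix k :: nat assume k: "k \<in> {1..5}"
    consider "k = 1" | "k = 5" | "k \<noteq> 1" "k \<noteq> 5" by blast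
    then show "reg X U (\<lambda>p. if k = 1 then 1 else if k = 5 then 0 else u p (k + 4))"
      by cases (use k u[of "k + 4"] in \<open>auto intro: reg_const[OF X U]\<close>)
  qed
  have f: "reg X U (\<lambda>p. M 5 (restrict5 (u p)) i)" if i: "i \<in> {1..5}" for i
    by (rule reg_poly_fun[OF X frame_poly[OF _ i] U v]) simp
  show ?thesis
    unfolding second_point_def Let_def
    by (intro reg_diff[OF X] reg_mult[OF X] reg_const[OF X U] reg_dot[OF X U] f w j)
qed

lemma second_point_vspace: "second_point u \<in> vspace"
proof -
  have "slope_vector u \<in> vspace" "M 5 (restrict5 u) \<in> vspace"
    unfolding slope_vector_def by (rule combination_vspace[OF restrict5_vspace], rule frame_vspace[OF _ restrict5_vspace]) simp
  then show ?thesis unfolding second_point_def Let_def by (intro coord_space_diff coord_space_smult)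
qed

lemma second_point_isotropic: "dot (second_point u) (second_point u) = 0"
  using frame_isotropic[OF restrict5_vspace, of u]
  unfolding second_point_def Let_def dot_simps by (simp add: algebra_simps dot_commute)

lemma parameters_coord: "parameters u \<in> coord_space {1..6}" "parameters u 6 = 1"
  unfolding parameters_def coord_space_def by auto

lemma open_source: "openin (zar P8) source"
  and reg_scaled: "j \<in> {1..5} \<Longrightarrow> reg P8 source (\<lambda>L. scaled (second_point (dehomogenise 9 L)) j)"
proof -
  note X = field_sheaf_projective[of "{1..9}", where 'k='k]
  have oD: "openin (zar P8) (D 9)" using open_D[of 9] by simp
  have u: "reg P8 (D 9) (\<lambda>L. dehomogenise 9 L i)" if "i \<in> {1..9}" for i
    using reg_dehomogenise[OF _ that] by simp
  have x: "reg P8 (D 9) (\<lambda>L. second_point (dehomogenise 9 L) j)" if "j \<in> {1..5}" for j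
    by (rule reg_second_point[OF X oD u that])
  have l: "reg P8 (D 9) (\<lambda>L. lin (second_point (dehomogenise 9 L)))"
    by (rule reg_poly_fun[OF X lin_poly oD x])
  define E where "E = {L \<in> D 9. lin (second_point (dehomogenise 9 L)) \<noteq> 0}"
  have oE: "openin (zar P8) E" unfolding E_def by (rule open_nonzero[OF X l])
  have ED: "E \<subseteq> D 9" unfolding E_def by blast
  have s: "reg P8 E (\<lambda>L. scaled (second_point (dehomogenise 9 L)) j)" if "j \<in> {1..5}" for j
    unfolding scaled_def
    by (rule reg_divide[OF X reg_restrict[OF X x[OF that] oE ED] reg_restrict[OF X l oE ED]])
       (simp add: E_def)
  have "source = {L \<in> E. \<Delta> (scaled (second_point (dehomogenise 9 L))) \<noteq> 0}"
    unfolding source_def E_def Let_def by auto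
  then show o: "openin (zar P8) source"
    using open_nonzero[OF X reg_poly_fun[OF X Delta_poly oE s]] by simp
  show "j \<in> {1..5} \<Longrightarrow> reg P8 source (\<lambda>L. scaled (second_point (dehomogenise 9 L)) j)"
    by (rule reg_restrict[OF X s o]) (auto simp: source_def E_def Let_def)
qed

lemma scaled_line: "lin x \<noteq> 0 \<Longrightarrow> line (scaled x) = line x"
  using line_smult[of "inverse (lin x)" x] unfolding scaled_def by (simp add: divide_inverse mult.commute)

lemma scaled_cone:
  assumes "x \<in> vspace" "dot x x = 0" "lin x \<noteq> 0"
  shows "scaled x \<in> quadric_cone" "lin (scaled x) = 1"
proof -
  have s: "scaled x = (\<lambda>j. inverse (lin x) * x j)" unfolding scaled_def by (simp add: divide_inverse mult.commute)
  show l: "lin (scaled x) = 1" unfolding s lin_smult using assms by simp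
  then have "scaled x \<noteq> (\<lambda>_. 0)" using lin_zero by auto
  then show "scaled x \<in> quadric_cone" using assms coord_space_smult[OF assms(1)] unfolding s by (simp add: dot_simps)
qed

lemma sourceE:
  assumes "L \<in> source"
  defines "u \<equiv> dehomogenise 9 L" and "r \<equiv> scaled (second_point (dehomogenise 9 L))"
  shows "L = line u" "u \<in> coord_space {1..9}" "u 9 = 1" "r \<in> quadric_cone" "lin r = 1" "\<Delta> r \<noteq> 0"
    "to_product L = (line r, line (parameters u))"
proof -
  have L: "L \<in> D 9" "lin (second_point u) \<noteq> 0" "\<Delta> r \<noteq> 0"
    using assms unfolding source_def Let_def by auto
  show "L = line u" "u \<in> coord_space {1..9}" "u 9 = 1" unfolding u_def using DE[of 9 L] L(1) by auto
  show "r \<in> quadric_cone" "lin r = 1" unfolding r_def u_def[symmetric]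
    using scaled_cone[OF second_point_vspace second_point_isotropic L(2)] by blast+
  show "\<Delta> r \<noteq> 0" by fact
  show "to_product L = (line r, line (parameters u))"
    unfolding to_product_def Let_def u_def[symmetric] r_def using scaled_line[OF L(2)] by simp
qed

lemma to_product_morphism: "morphism (subspace_of P8 source) QP to_product"
proof -
  let ?S = "subspace_of P8 source"
  note P = field_sheaf_projective[of "{1..9}", where 'k='k]
  have S: "field_sheaf ?S" by (rule field_sheaf_subspace[OF P])
  have pts: "points ?S = source" using openin_subset[OF open_source] by auto
  have oS: "openin (zar ?S) source" using openin_topspace[of "zar ?S"] unfolding pts .
  note reg_S = reg_open_subspace[OF P open_source]
  let ?r = "\<lambda>L. scaled (second_point (dehomogenise 9 L))"
  have r: "reg ?S source (\<lambda>L. ?r L j)" if "j \<in> {1..5}" for j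
    unfolding reg_S using reg_scaled[OF that] by simp
  have "morphism ?S (projective_space {1..5}) (\<lambda>L. line (?r L))"
  proof (rule morphism_into_projective[OF S])
    fix L assume "L \<in> points ?S"
    then show "\<exists>W g. openin (zar ?S) W \<and> L \<in> W \<and> (\<forall>i\<in>{1..5}. reg ?S W (\<lambda>q. g q i)) \<and>
      (\<forall>q\<in>W. g q \<in> coord_space {1..5} \<and> g q \<noteq> (\<lambda>_. 0) \<and> line (?r q) = line (g q))"
      unfolding pts using oS r sourceE(4) by (intro exI[of _ source] exI[of _ ?r]) blast
  qed
  then have m1: "morphism ?S quadric (\<lambda>L. line (?r L))"
    unfolding quadric_eq
    by (rule morphism_into_subspace[OF S field_sheaf_projective]) (use sourceE(4) pts in blast)
  have v: "reg ?S source (\<lambda>L. restrict5 (dehomogenise 9 L) i)" if i: "i \<in> {1..5}" for i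
  proof -
    have "reg P8 (D 9) (\<lambda>L. dehomogenise 9 L i)" using reg_dehomogenise[of 9 i] i by simp
    then have "reg P8 source (\<lambda>L. dehomogenise 9 L i)"
      by (rule reg_restrict[OF P _ open_source]) (auto simp: source_def)
    then show ?thesis unfolding reg_S restrict5_def using i by simp
  qed
  have a: "reg ?S source (\<lambda>L. parameters (dehomogenise 9 L) i)" if "i \<in> {1..6}" for i
  proof (cases "i \<in> {1..5}")
    case True
    have "reg ?S source (\<lambda>L. coefficient (?r L) (restrict5 (dehomogenise 9 L)) i)"
      by (rule reg_coefficient[OF S oS v r sourceE(6) True])
    then show ?thesis using True unfolding parameters_def by simp
  next
    case False
    then have "i = 6" using that by auto
    then show ?thesis unfolding parameters_def using reg_const[OF S oS, of 1] by simp
  qed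
  have m2: "morphism ?S P5 (\<lambda>L. line (parameters (dehomogenise 9 L)))"
  proof (rule morphism_into_projective[OF S])
    have nz: "parameters u \<noteq> (\<lambda>_. 0)" for u using parameters_coord(2)[of u] by auto
    fix L assume "L \<in> points ?S"
    then show "\<exists>W g. openin (zar ?S) W \<and> L \<in> W \<and> (\<forall>i\<in>{1..6}. reg ?S W (\<lambda>q. g q i)) \<and>
      (\<forall>q\<in>W. g q \<in> coord_space {1..6} \<and> g q \<noteq> (\<lambda>_. 0) \<and>
         line (parameters (dehomogenise 9 q)) = line (g q))"
      unfolding pts using oS a parameters_coord(1) nz
      by (intro exI[of _ source] exI[of _ "\<lambda>L. parameters (dehomogenise 9 L)"]) blast
  qed
  have m: "morphism ?S QP (\<lambda>L. (line (?r L), line (parameters (dehomogenise 9 L))))"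
    by (rule morphism_into_product[OF S field_sheaf_quadric field_sheaf_projective m1 m2])
  have "line (?r L) = line (second_point (dehomogenise 9 L))" if "L \<in> source" for L
    by (rule scaled_line) (use that in \<open>auto simp: source_def Let_def\<close>)
  then have eq: "to_product L = (line (?r L), line (parameters (dehomogenise 9 L)))" if "L \<in> source" for L
    using that unfolding to_product_def Let_def by simp
  show ?thesis
    by (rule morphism_cong[OF S m]) (use eq pts in simp)
qed

lemma open_target: "openin (zar QP) target"
  and from_product_morphism: "morphism (subspace_of QP target) P8 from_product"
proof -
  have Q: "field_sheaf (quadric :: ((nat \<Rightarrow> 'k) set, 'k) fspace)" by (rule field_sheaf_quadric)
  note P = field_sheaf_projective[of "{1..6}", where 'k='k]
  note X = field_sheaf_product[OF Q P]
  define W where "W = quadric_lin \<times> D 6"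
  have oD: "openin (zar P5) (D 6)" using open_D[of 6] by simp
  have oW: "openin (zar QP) W" unfolding W_def using open_Times[OF Q P open_quadric_lin oD] by simp
  have sub: "quadric_lin \<subseteq> points quadric" "D 6 \<subseteq> points P5"
    using openin_subset[OF open_quadric_lin] openin_subset[OF oD] by auto
  have r: "reg QP W (\<lambda>z. normalised (fst z) j)" if j: "j \<in> {1..5}" for j
    by (rule reg_restrict[OF X reg_product_fst[OF Q P reg_normalised[OF j]] oW]) (use sub in \<open>auto simp: W_def\<close>)
  have a: "reg QP W (\<lambda>z. dehomogenise 6 (snd z) j)" if j: "j \<in> {1..6}" for j
    by (rule reg_restrict[OF X reg_product_snd[OF Q P reg_dehomogenise[OF _ j]] oW])
       (use sub in \<open>auto simp: W_def\<close>)
  have a5: "reg QP W (\<lambda>z. dehomogenise 6 (snd z) j)" if j: "j \<in> {1..5}" for j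
    using a[of j] j by simp
  let ?v = "\<lambda>z. combination (dehomogenise 6 (snd z)) (normalised (fst z))"
  let ?c = "\<lambda>z. coefficient (?v z) (normalised (fst z))"
  have v: "reg QP W (\<lambda>z. ?v z j)" if j: "j \<in> {1..5}" for j
    by (rule reg_combination[OF X oW a5 r j])
  define W' where "W' = {z \<in> W. \<Delta> (?v z) \<noteq> 0}"
  have oW': "openin (zar QP) W'"
    unfolding W'_def by (rule open_nonzero[OF X reg_poly_fun[OF X Delta_poly oW v]])
  have W'W: "W' \<subseteq> W" unfolding W'_def by blast
  have nz: "\<Delta> (?v z) \<noteq> 0" if "z \<in> W'" for z using that unfolding W'_def by blast
  have c: "reg QP W' (\<lambda>z. ?c z j)" if j: "j \<in> {1..5}" for j
    by (rule reg_coefficient[OF X oW' reg_restrict[OF X r oW' W'W] reg_restrict[OF X v oW' W'W] nz j])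
  have t: "target = {z \<in> W'. ?c z 1 \<noteq> 0}" unfolding target_def W'_def W_def Let_def by auto
  have c1: "reg QP W' (\<lambda>z. ?c z 1)" by (rule c) simp
  show oT: "openin (zar QP) target" unfolding t by (rule open_nonzero[OF X c1])
  have TW: "target \<subseteq> W'" "target \<subseteq> W" unfolding t W'_def by auto
  let ?S = "subspace_of QP target"
  have S: "field_sheaf ?S" by (rule field_sheaf_subspace[OF X])
  have pts: "points ?S = target" using openin_subset[OF oT] by auto
  have oS: "openin (zar ?S) target" using openin_topspace[of "zar ?S"] unfolding pts .
  note reg_S = reg_open_subspace[OF X oT]
  let ?g = "\<lambda>z. inverse_vector (normalised (fst z)) (dehomogenise 6 (snd z))"
  have g: "reg QP target (\<lambda>z. ?g z i)" if "i \<in> {1..9}" for i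
  proof -
    consider "i \<in> {1..5}" | "i \<in> {6..8}" | "i = 9" using \<open>i \<in> {1..9}\<close> by fastforce
    then show ?thesis
    proof cases
      case 1
      then show ?thesis using reg_restrict[OF X v[OF 1] oT TW(2)] unfolding inverse_vector_def Let_def by simp
    next
      case 2
      have i: "i - 4 \<in> {1..5}" using 2 by auto
      have "reg QP target (\<lambda>z. ?c z (i - 4) / ?c z 1)"
        by (rule reg_divide[OF X reg_restrict[OF X c[OF i] oT TW(1)] reg_restrict[OF X c1 oT TW(1)]])
           (simp add: t)
      then show ?thesis using 2 unfolding inverse_vector_def Let_def by simp
    next
      case 3
      then show ?thesis using reg_const[OF X oT, of 1] unfolding inverse_vector_def Let_def by simp
    qed
  qed
  have gc: "?g z \<in> coord_space {1..9}" "?g z \<noteq> (\<lambda>_. 0)" for z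
  proof -
    show "?g z \<in> coord_space {1..9}" unfolding inverse_vector_def Let_def coord_space_def by auto
    have "?g z 9 = 1" unfolding inverse_vector_def Let_def by simp
    then show "?g z \<noteq> (\<lambda>_. 0)" by auto
  qed
  show "morphism ?S P8 from_product"
  proof (rule morphism_into_projective[OF S])
    fix z assume "z \<in> points ?S"
    moreover have "reg ?S target (\<lambda>z. ?g z i)" if "i \<in> {1..9}" for i
      unfolding reg_S using g[OF that] by simp
    ultimately show "\<exists>W g. openin (zar ?S) W \<and> z \<in> W \<and> (\<forall>i\<in>{1..9}. reg ?S W (\<lambda>q. g q i)) \<and>
      (\<forall>q\<in>W. g q \<in> coord_space {1..9} \<and> g q \<noteq> (\<lambda>_. 0) \<and> from_product q = line (g q))"
      unfolding pts from_product_def using oS gc by (intro exI[of _ target] exI[of _ ?g]) blast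
  qed
qed


section \<open>The maps are inverse to each other and equivariant\<close>

lemma combination_cong:
  "(\<And>i. i \<in> {1..5} \<Longrightarrow> a i = b i) \<Longrightarrow> combination a x = combination b x"
  unfolding combination_def by (auto intro!: sum.cong)

lemma combination_add: "combination (\<lambda>i. a i + b i) x = (\<lambda>j. combination a x j + combination b x j)"
  unfolding combination_def by (simp add: algebra_simps sum.distrib)

lemma combination_smult: "combination (\<lambda>i. c * a i) x = (\<lambda>j. c * combination a x j)"
  unfolding combination_def by (simp add: algebra_simps sum_distrib_left)

lemma combination_single:
  assumes "k \<in> {1..5}"
  shows "combination (\<lambda>i. if i = k then c else 0) x = (\<lambda>j. c * M k x j)"
  unfolding combination_def using assms
  by (simp add: if_distrib[of "\<lambda>a. a * _"] cong: if_cong)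

lemma second_point_combination:
  fixes u :: "nat \<Rightarrow> 'k"
  defines "v \<equiv> restrict5 u" and "w \<equiv> slope_vector u"
  shows "second_point u = combination (\<lambda>i. (if i = 5 then dot w w else 0) +
    (- 2 * dot (M 5 v) w) * (if i = 1 then 1 else if i = 5 then 0 else u (i + 4))) v"
  unfolding combination_add combination_smult
  using combination_single[of 5 "dot w w" v]
  by (simp add: second_point_def Let_def slope_vector_def v_def w_def)

text \<open>
  The frame coordinates of the second point are read off from its definition as a combination of
  \<open>M 5 v\<close> and the slope vector; dividing by the first one recovers the slopes.
\<close>

lemma from_product_to_product:
  assumes L: "L \<in> source" and T: "to_product L \<in> target"
  shows "from_product (to_product L) = L"
proof -
  define u where "u = dehomogenise 9 L"
  define v where "v = restrict5 u"
  define w where "w = slope_vector u"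
  define x where "x = second_point u"
  define r where "r = scaled x"
  define B where "B = - 2 * dot (M 5 v) w"
  note S = sourceE[OF L, folded u_def, folded x_def, folded r_def]
  have vv: "v \<in> vspace" unfolding v_def by (rule restrict5_vspace)
  have rv: "r \<in> vspace" using S(4) by simp
  have lx: "lin x \<noteq> 0" using L unfolding source_def Let_def u_def x_def by simp
  have nr: "normalised (line r) = r" by (rule normalised_id[OF rv S(5)])
  have da: "dehomogenise 6 (line (parameters u)) = parameters u"
    by (rule dehomogenise_id) (use parameters_coord in auto)
  have cv: "combination (parameters u) r = v"
  proof -
    have "combination (parameters u) r = combination (coefficient r v) r"
      by (rule combination_cong) (simp add: parameters_def r_def x_def v_def)
    then show ?thesis using combination_coefficient[OF S(6) rv vv] by simp
  qed
  have T': "\<Delta> v \<noteq> 0" "coefficient v r 1 \<noteq> 0"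
    using T unfolding S(7) target_def Let_def by (simp_all add: nr da cv)
  define b where "b = (\<lambda>i. if i = 1 then 1 else if i = 5 then 0 else u (i + 4))"
  have x_comb: "x = combination (\<lambda>i. (if i = 5 then dot w w else 0) + B * b i) v"
    unfolding x_def second_point_combination v_def w_def B_def b_def ..
  have r_comb: "r = combination (\<lambda>i. inverse (lin x) * ((if i = 5 then dot w w else 0) + B * b i)) v"
    unfolding combination_smult x_comb[symmetric] r_def scaled_def by (simp add: divide_inverse mult.commute)
  have c: "coefficient v r i = inverse (lin x) * ((if i = 5 then dot w w else 0) + B * b i)" if "i \<in> {1..5}" for i
    by (rule coefficient_eqI[OF T'(1) r_comb that])
  have c1: "coefficient v r 1 = inverse (lin x) * B" using c[of 1] by (simp add: b_def)
  then have B: "B \<noteq> 0" using T'(2) by auto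
  have "inverse_vector r (parameters u) i = u i" for i
  proof -
    consider "i \<in> {1..5}" | "i \<in> {6..8}" | "i = 9" | "i \<notin> {1..9}" by fastforce
    then show ?thesis
    proof cases
      case 1
      then show ?thesis unfolding inverse_vector_def Let_def cv by (simp add: v_def restrict5_def)
    next
      case 2
      then have "coefficient v r (i - 4) = inverse (lin x) * (B * u i)"
        by (subst c) (auto simp: b_def)
      then show ?thesis using 2 B lx unfolding inverse_vector_def Let_def cv c1 by simp
    next
      case 3
      then show ?thesis using S(3) unfolding inverse_vector_def Let_def by simp
    next
      case 4
      then have "u i = 0" using S(2) unfolding coord_space_def by blast
      then show ?thesis using 4 unfolding inverse_vector_def Let_def by auto
    qed
  qed
  then have "inverse_vector r (parameters u) = u" by blast
  then show ?thesis unfolding S(7) from_product_def by (simp add: nr da S(1)[symmetric])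
qed

lemma inverse_vector_coord: "inverse_vector r a \<in> coord_space {1..9}" "inverse_vector r a 9 = 1"
  unfolding inverse_vector_def Let_def coord_space_def by auto

text \<open>
  The slope vector is a combination of the given point \<open>r\<close> and of \<open>f = M 5 v\<close>. Both are isotropic, so
  the second point on the line that it spans with \<open>f\<close> is \<open>r\<close> again, up to a scalar.
\<close>

lemma to_product_from_product:
  assumes z: "z \<in> target" and s: "from_product z \<in> source"
  shows "to_product (from_product z) = z"
proof -
  obtain L K where z_eq: "z = (L, K)" by fastforce
  define r where "r = normalised L"
  define a where "a = dehomogenise 6 K"
  define v where "v = combination a r"
  define c where "c = coefficient v r"
  define u where "u = inverse_vector r a"
  define f where "f = M 5 v"
  have T: "L \<in> quadric_lin" "K \<in> D 6" "\<Delta> v \<noteq> 0" "c 1 \<noteq> 0"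
    using z unfolding z_eq target_def Let_def by (auto simp: r_def a_def v_def c_def)
  note r = quadric_linE[OF T(1), folded r_def]
  have rv: "r \<in> vspace" using r(2) by simp
  have vv: "v \<in> vspace" unfolding v_def by (rule combination_vspace[OF rv])
  have K: "K = line a" "a 6 = 1" "a \<in> coord_space {1..6}" using DE[OF _ T(2)] unfolding a_def by auto
  have fz: "from_product z = line u" unfolding from_product_def z_eq u_def r_def a_def by simp
  have du: "dehomogenise 9 (line u) = u"
    by (rule dehomogenise_id) (use inverse_vector_coord in \<open>auto simp: u_def\<close>)
  have uv: "restrict5 u = v"
    using vv unfolding restrict5_def u_def inverse_vector_def Let_def v_def coord_space_def by auto
  define w where "w = slope_vector u"
  have w: "w = (\<lambda>j. inverse (c 1) * (r j + (- c 5) * f j))"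
  proof -
    have "w = combination (\<lambda>i. inverse (c 1) * (c i + (- c 5) * (if i = 5 then 1 else 0))) v"
      unfolding w_def slope_vector_def uv
    proof (rule combination_cong)
      fix i :: nat assume i: "i \<in> {1..5}"
      consider "i = 1" | "i = 5" | "i \<in> {2..4}" using i by fastforce
      then show "(if i = 1 then 1 else if i = 5 then 0 else u (i + 4)) =
          inverse (c 1) * (c i + (- c 5) * (if i = 5 then 1 else 0))"
        by cases (use T(4) in \<open>auto simp: u_def inverse_vector_def Let_def v_def[symmetric] c_def[symmetric] divide_inverse\<close>)
    qed
    then show ?thesis
      unfolding combination_smult combination_add
      using combination_single[of 5 1 v] combination_coefficient[OF T(3) vv rv]
      by (simp add: c_def f_def)
  qed
  have iso: "dot r r = 0" "dot f f = 0" using r(2) frame_isotropic[OF vv] unfolding f_def by auto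
  have dw: "dot w w = - 2 * c 5 * dot f r * (inverse (c 1))\<^sup>2"
    unfolding w dot_simps iso dot_commute[of r f] by (simp add: power2_eq_square)
  have df: "dot f w = inverse (c 1) * dot f r" unfolding w dot_simps iso by simp
  define e where "e = - 2 * dot f r * (inverse (c 1))\<^sup>2"
  have x: "second_point u = (\<lambda>j. e * r j)"
    unfolding second_point_def Let_def uv w_def[symmetric] f_def[symmetric] dw df unfolding w e_def
    by (simp add: algebra_simps power2_eq_square)
  have le: "lin (second_point u) = e" unfolding x lin_smult r(3) by simp
  have "lin (second_point u) \<noteq> 0" "\<Delta> (scaled (second_point u)) \<noteq> 0"
    using s unfolding fz source_def Let_def by (auto simp: du)
  then have e0: "e \<noteq> 0" and "\<Delta> (scaled (second_point u)) \<noteq> 0" using le by auto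
  have sr: "scaled (second_point u) = r" unfolding scaled_def le using x e0 by simp
  have "parameters u = a"
  proof
    fix i :: nat
    consider "i \<in> {1..5}" | "i = 6" | "i \<notin> {1..6}" by fastforce
    then show "parameters u i = a i"
    proof cases
      case 1
      then show ?thesis
        using coefficient_combination[of r i a] \<open>\<Delta> (scaled _) \<noteq> 0\<close> unfolding parameters_def sr uv v_def by simp
    next
      case 3
      then show ?thesis using K(3) unfolding parameters_def coord_space_def by auto
    qed (simp add: parameters_def K(2))
  qed
  then show ?thesis
    unfolding to_product_def Let_def fz du using line_smult[OF e0, of r] K(1) r(1) by (simp add: x z_eq)
qed

text \<open>
  At \<open>v = x0\<close> with all slopes zero the slope vector is \<open>x0\<close> itself. It is isotropic, so the second
  point on its line is \<open>x0\<close>, and all conditions become conditions on \<open>x0\<close>.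
\<close>

lemma source_target_meet: "\<exists>L\<in>source. to_product L \<in> target"
proof -
  define u where "u = (\<lambda>i::nat. if i \<in> {1..5} then x0 i else if i = 9 then 1 else 0)"
  have du: "dehomogenise 9 (line u) = u" and D9: "line u \<in> D 9"
    by (rule dehomogenise_id, auto simp: u_def coord_space_def) (rule DI, auto simp: u_def coord_space_def)
  have uv: "restrict5 u = x0" using x0(1) unfolding restrict5_def u_def coord_space_def by auto
  have w: "slope_vector u = x0"
  proof -
    have "slope_vector u = combination (\<lambda>i. if i = 1 then 1 else 0) x0"
      unfolding slope_vector_def uv by (rule combination_cong) (auto simp: u_def)
    then show ?thesis using combination_single[of 1 1 x0] frame_first[OF x0(1)] by simp
  qed
  define e where "e = - 2 * dot (M 5 x0) x0"
  have e0: "e \<noteq> 0" using x0(4) unfolding e_def by simp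
  have x: "second_point u = (\<lambda>j. e * x0 j)"
    unfolding second_point_def Let_def uv w e_def using x0(2) by simp
  have le: "lin (second_point u) = e" unfolding x lin_smult x0(3) by simp
  have sr: "scaled (second_point u) = x0" unfolding scaled_def le using x e0 by simp
  have src: "line u \<in> source" unfolding source_def Let_def using e0 Delta_x0 D9 by (simp add: du sr le)
  have a: "combination (parameters u) x0 = x0"
  proof -
    have "combination (parameters u) x0 = combination (coefficient x0 x0) x0"
      by (rule combination_cong) (simp add: parameters_def sr uv)
    then show ?thesis using combination_coefficient[OF Delta_x0 x0(1) x0(1)] by simp
  qed
  have da: "dehomogenise 6 (line (parameters u)) = parameters u"
    by (rule dehomogenise_id) (use parameters_coord in auto)
  have "coefficient x0 x0 1 = (if (1::nat) = 1 then 1 else 0)"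
    by (rule coefficient_eqI[OF Delta_x0]) (use combination_single[of 1 1 x0] frame_first[OF x0(1)] in auto)
  moreover have "line x0 \<in> quadric_lin" unfolding quadric_lin_def using x0 x0_nonzero by auto
  moreover have "line (parameters u) \<in> D 6" by (rule DI) (use parameters_coord in auto)
  ultimately have "to_product (line u) \<in> target"
    unfolding sourceE(7)[OF src] du sr target_def Let_def
    by (simp add: normalised_id[OF x0(1,3)] da a Delta_x0)
  with src show ?thesis by blast
qed

text \<open>
  The sum of the orthogonal representation and a trivial one of dimension 4.
\<close>

definition extended_rho :: "'g \<Rightarrow> (nat \<Rightarrow> 'k) \<Rightarrow> nat \<Rightarrow> 'k"
  where "extended_rho g z = (\<lambda>i. if i \<in> {1..5} then \<rho> g (restrict5 z) i else z i)"

lemma restrict5_add: "restrict5 (\<lambda>i. x i + y i) = (\<lambda>i. restrict5 x i + restrict5 y i)"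
  unfolding restrict5_def by auto

lemma restrict5_smult: "restrict5 (\<lambda>i. c * x i) = (\<lambda>i. c * restrict5 x i)"
  unfolding restrict5_def by auto

lemma restrict5_id: "x \<in> vspace \<Longrightarrow> restrict5 x = x"
  unfolding restrict5_def coord_space_def by auto

lemma restrict5_extended:
  assumes "g \<in> carrier G"
  shows "restrict5 (extended_rho g z) = \<rho> g (restrict5 z)"
proof -
  have "restrict5 (extended_rho g z) = restrict5 (\<rho> g (restrict5 z))"
    unfolding restrict5_def[of "extended_rho g z"] restrict5_def[of "\<rho> g (restrict5 z)"]
    unfolding extended_rho_def by (rule ext) (simp del: One_nat_def)
  then show ?thesis using restrict5_id[OF rho_vspace[OF assms restrict5_vspace, of z]] by simp
qed

lemma extended_rho_smult:
  "g \<in> carrier G \<Longrightarrow> extended_rho g (\<lambda>i. c * x i) = (\<lambda>i. c * extended_rho g x i)"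
  unfolding extended_rho_def restrict5_smult by (auto simp: rho_smult[OF _ restrict5_vspace])

lemma extended_representation: "linear_representation G {1..9} extended_rho"
  unfolding linear_representation_def
proof (intro conjI ballI allI)
  fix g and x :: "nat \<Rightarrow> 'k" assume g: "g \<in> carrier G" and x: "x \<in> coord_space {1..9}"
  show "extended_rho g x \<in> coord_space {1..9}"
    using x unfolding extended_rho_def coord_space_def by auto
  show "extended_rho g (\<lambda>i. c * x i) = (\<lambda>i. c * extended_rho g x i)" for c
    by (rule extended_rho_smult[OF g])
  show "extended_rho g (\<lambda>i. x i + y i) = (\<lambda>i. extended_rho g x i + extended_rho g y i)" for y
    unfolding extended_rho_def restrict5_add
    by (auto simp: rho_add[OF g restrict5_vspace restrict5_vspace])
next
  fix x :: "nat \<Rightarrow> 'k"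
  show "extended_rho \<one>\<^bsub>G\<^esub> x = x"
    unfolding extended_rho_def rho_one[OF restrict5_vspace] by (auto simp: restrict5_def)
next
  fix g h and x :: "nat \<Rightarrow> 'k" assume gh: "g \<in> carrier G" "h \<in> carrier G"
  have "extended_rho g (extended_rho h x) =
    (\<lambda>i. if i \<in> {1..5} then \<rho> g (\<rho> h (restrict5 x)) i else x i)"
    unfolding extended_rho_def[of g] restrict5_extended[OF gh(2)] by (auto simp: extended_rho_def)
  then show "extended_rho (g \<otimes>\<^bsub>G\<^esub> h) x = extended_rho g (extended_rho h x)"
    unfolding extended_rho_def[of "g \<otimes>\<^bsub>G\<^esub> h"] rho_mult[OF gh restrict5_vspace] by simp
qed

lemma extended_action:
  assumes g: "g \<in> carrier G" and u: "u \<in> coord_space {1..9}" "u \<noteq> (\<lambda>_. 0)"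
  shows "induced_action extended_rho P8 g (line u) = line (extended_rho g u)"
proof -
  have "line u \<in> points P8" using line_in_points[OF u] by simp
  moreover have "extended_rho g ` line u = line (extended_rho g u)"
    unfolding line_def by (simp add: image_image extended_rho_smult[OF g])
  ultimately show ?thesis unfolding induced_action_def by simp
qed

lemma slope_vector_equivariant:
  assumes g: "g \<in> carrier G"
  shows "slope_vector (extended_rho g u) = \<rho> g (slope_vector u)"
  unfolding slope_vector_def restrict5_extended[OF g] rho_combination[OF g restrict5_vspace]
  by (rule combination_cong) (auto simp: extended_rho_def)

lemma second_point_equivariant:
  assumes g: "g \<in> carrier G"
  shows "second_point (extended_rho g u) = \<rho> g (second_point u)"
proof -
  let ?f = "M 5 (restrict5 u)" and ?w = "slope_vector u"
  have f: "?f \<in> vspace" by (rule frame_vspace[OF _ restrict5_vspace]) simp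
  have w: "?w \<in> vspace" unfolding slope_vector_def by (rule combination_vspace[OF restrict5_vspace])
  have "M 5 (\<rho> g (restrict5 u)) = \<rho> g ?f" by (rule frame_equivariant[OF g _ restrict5_vspace]) simp
  then show ?thesis
    unfolding second_point_def Let_def slope_vector_equivariant[OF g] restrict5_extended[OF g]
    using f w
    by (simp add: orthogonal[OF g] rho_diff[OF g coord_space_smult coord_space_smult] rho_smult[OF g])
qed

lemma to_product_equivariant:
  assumes g: "g \<in> carrier G" and L: "L \<in> source" and gL: "induced_action extended_rho P8 g L \<in> source"
  shows "to_product (induced_action extended_rho P8 g L) =
    action_on_first quadric (induced_action \<rho> quadric) P5 g (to_product L)"
proof -
  define u where "u = dehomogenise 9 L"
  define r where "r = scaled (second_point u)"
  let ?u = "extended_rho g u"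
  note S = sourceE[OF L, folded u_def, folded r_def]
  have u0: "u \<noteq> (\<lambda>_. 0)" using S(3) by auto
  have act: "induced_action extended_rho P8 g L = line ?u" using extended_action[OF g S(2) u0] S(1) by simp
  have uc: "?u \<in> coord_space {1..9}" "?u 9 = 1"
    using S(2,3) unfolding extended_rho_def coord_space_def by auto
  have du: "dehomogenise 9 (line ?u) = ?u" by (rule dehomogenise_id) (use uc in auto)
  have x: "second_point ?u = \<rho> g (second_point u)" by (rule second_point_equivariant[OF g])
  have sc: "scaled (second_point ?u) = \<rho> g r"
    unfolding r_def x scaled_def lin_invariant[OF g second_point_vspace]
    using rho_smult[OF g second_point_vspace, of "inverse (lin (second_point u))" u]
    by (simp add: divide_inverse mult.commute)
  have rv: "r \<in> vspace" using S(4) by simp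
  have nz: "\<Delta> (\<rho> g r) \<noteq> 0" using sourceE(6)[OF gL] unfolding act du sc .
  have par: "parameters ?u = parameters u"
  proof
    fix i
    show "parameters ?u i = parameters u i"
      unfolding parameters_def sc restrict5_extended[OF g] r_def[symmetric]
      using coefficient_invariant[OF g rv restrict5_vspace S(6) nz, of i u] by simp
  qed
  have "to_product L \<in> points QP"
    using morphism_points[OF to_product_morphism, of L] L openin_subset[OF open_source] by auto
  then show ?thesis
    unfolding sourceE(7)[OF gL] S(7) unfolding act du sc par action_on_first_def
    by (simp add: quadric_action[OF g S(4)])
qed

theorem stably_linearizable_quadric: "stably_linearizable G quadric (induced_action \<rho> quadric)"
proof -
  have five: "(5::nat) + 1 = 6" by simp
  note X = field_sheaf_projective[of "{1..9}", where 'k='k]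
  have Y: "field_sheaf QP" by (rule field_sheaf_product[OF field_sheaf_quadric field_sheaf_projective])
  define U where "U = {L \<in> source. to_product L \<in> target}"
  define V where "V = {z \<in> target. from_product z \<in> source}"
  note iso = isomorphism_if_partial_inverses[OF X Y open_source open_target to_product_morphism
      from_product_morphism from_product_to_product to_product_from_product, folded U_def V_def]
  have "U \<noteq> {}" using source_target_meet unfolding U_def by blast
  moreover have "V \<noteq> {}"
  proof -
    obtain L where "L \<in> source" "to_product L \<in> target" using source_target_meet by blast
    then have "to_product L \<in> V" using from_product_to_product[of L] unfolding V_def by simp
    then show ?thesis by blast
  qed
  moreover have "\<forall>g\<in>carrier G. \<forall>p\<in>U. induced_action extended_rho P8 g p \<in> U \<longrightarrow>
      to_product (induced_action extended_rho P8 g p) =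
      action_on_first quadric (induced_action \<rho> quadric) P5 g (to_product p)"
    using to_product_equivariant unfolding U_def by blast
  ultimately have "equivariantly_birational G P8 (induced_action extended_rho P8) QP
      (action_on_first quadric (induced_action \<rho> quadric) P5)"
    unfolding equivariantly_birational_def using iso
    by (intro exI[of _ U] exI[of _ V] exI[of _ to_product]) blast
  then have "birational_to_representation G QP (action_on_first quadric (induced_action \<rho> quadric) P5)"
    unfolding birational_to_representation_def using extended_representation by blast
  then show ?thesis
    unfolding stably_linearizable_def using smooth_G_quadric
    by (intro conjI exI[of _ 5]) (simp_all only: five)
qed

end

section \<open>Permutations of coordinates\<close>

lemma sum5: "(\<Sum>i=1..5. f i) = f 1 + f 2 + f 3 + f 4 + f (5::nat)" for f :: "nat \<Rightarrow> 'k::field"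
  by (simp add: eval_nat_numeral)

lemma sum3: "(\<Sum>i=1..3. f i) = f 1 + f 2 + f (3::nat)" for f :: "nat \<Rightarrow> 'k::field"
  by (simp add: eval_nat_numeral)

lemma poly_fun_divide: "poly_fun I F \<Longrightarrow> poly_fun I (\<lambda>x. F x / c)"
  using poly_fun.mult[OF poly_fun.const[of I "inverse c"]] by (simp add: divide_inverse mult.commute)

lemma sum_perm_coords:
  assumes "\<sigma> permutes S"
  shows "(\<Sum>i\<in>S. h (perm_coords \<sigma> x i) (perm_coords \<sigma> y i)) = (\<Sum>i\<in>S. h (x i) (y i))"
  using sum.permute[OF permutes_inv[OF assms], of "\<lambda>i. h (x i) (y i)"]
  unfolding perm_coords_def by (simp add: comp_def)

lemma perm_coords_comp:
  assumes "\<sigma> permutes S" "\<tau> permutes S"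
  shows "perm_coords (\<sigma> \<circ> \<tau>) x = perm_coords \<sigma> (perm_coords \<tau> x)"
  unfolding perm_coords_def using permutes_inv_o o_inv_distrib[OF permutes_bij[OF assms(1)] permutes_bij[OF assms(2)]]
  by simp

lemma perm_coords_mem:
  assumes "\<sigma> permutes S" "S \<subseteq> {1..5}" "x \<in> vspace"
  shows "perm_coords \<sigma> x \<in> vspace"
proof -
  have "inv' \<sigma> i = i" if "i \<notin> {1..5}" for i
    using permutes_not_in[OF permutes_inv[OF assms(1)]] that assms(2) by blast
  then show ?thesis using assms(3) unfolding perm_coords_def coord_space_def by simp
qed

lemma perm_coords_faithful:
  assumes \<sigma>: "\<sigma> permutes S" and fixed: "\<And>j. j \<in> S \<Longrightarrow> perm_coords \<sigma> (std_basis j :: nat \<Rightarrow> 'k::field) j = 1"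
  shows "\<sigma> = id"
proof
  fix j
  show "\<sigma> j = id j"
  proof (cases "j \<in> S")
    case True
    have "(if inv' \<sigma> j = j then (1::'k) else 0) = 1"
      using fixed[OF True] unfolding perm_coords_def std_basis_def .
    then have "inv' \<sigma> j = j" by (simp split: if_splits)
    then show ?thesis using permutes_inverses(1)[OF \<sigma>, of j] by simp
  next
    case False
    then show ?thesis using permutes_not_in[OF \<sigma>] by simp
  qed
qed

section \<open>An isotropic vector for the trace form of a quintic\<close>

definition mean :: "(nat \<Rightarrow> 'k::field) \<Rightarrow> 'k"
  where "mean x = (\<Sum>i=1..5. x i) / 5"

definition moment :: "nat \<Rightarrow> (nat \<Rightarrow> 'k::field) \<Rightarrow> 'k"
  where "moment k x = (\<Sum>i=1..5. (x i - mean x) ^ k)"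

text \<open>
  Let \<open>P = Z^5 + 10 s Z^3 + 10 t Z^2 + d Z + e\<close> have roots \<open>y_j\<close>, and let \<open>c = 2\<iota> - 1\<close>, so that
  \<open>c^2 + 2c + 5 = 0\<close>. The vector with components \<open>P' + c P / (Z - y_j)\<close> interpolates, at the five roots,
  multiples of the isotropic vectors \<open>(1, ..., 1 + c, ..., 1)\<close>. The sum of the squares of its components
  is therefore divisible by \<open>P\<close>, and in fact equals \<open>- c^2 P P''\<close>. Reducing the components modulo the
  cubic \<open>P'' / 20 = Z^3 + 3 s Z + t\<close> gives quadratic polynomials in \<open>Z\<close>, whose three coefficients at
  \<open>y = y_j\<close> are the following functions.
\<close>

definition quad_coeff :: "'k \<Rightarrow> 'k \<Rightarrow> 'k::field \<Rightarrow> 'k"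
  where "quad_coeff c s y = c * y ^ 2 + (15 + 7 * c) * s"

definition lin_coeff :: "'k \<Rightarrow> 'k \<Rightarrow> 'k \<Rightarrow> 'k::field \<Rightarrow> 'k"
  where "lin_coeff c s t y = c * y ^ 3 + 7 * c * s * y + (15 + 9 * c) * t"

definition const_coeff :: "'k \<Rightarrow> 'k \<Rightarrow> 'k \<Rightarrow> 'k \<Rightarrow> 'k::field \<Rightarrow> 'k"
  where "const_coeff c s t d y = c * y ^ 4 + 10 * c * s * y ^ 2 + 9 * c * t * y + (1 + c) * d"

lemma depressed_quintic_root:
  fixes x1 x2 x3 x4 x5 z :: "'k::field"
  assumes "x1 + x2 + x3 + x4 + x5 = 0" and "(z - x1) * (z - x2) * (z - x3) * (z - x4) * (z - x5) = 0"
  shows "z ^ 5 = - ((x1 * x2 + x1 * x3 + x1 * x4 + x1 * x5 + x2 * x3 + x2 * x4 + x2 * x5 + x3 * x4 + x3 * x5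
      + x4 * x5) * z ^ 3
    - (x1 * x2 * x3 + x1 * x2 * x4 + x1 * x2 * x5 + x1 * x3 * x4 + x1 * x3 * x5 + x1 * x4 * x5
      + x2 * x3 * x4 + x2 * x3 * x5 + x2 * x4 * x5 + x3 * x4 * x5) * z ^ 2
    + (x1 * x2 * x3 * x4 + x1 * x2 * x3 * x5 + x1 * x2 * x4 * x5 + x1 * x3 * x4 * x5 + x2 * x3 * x4 * x5) * z
    - x1 * x2 * x3 * x4 * x5)"
    (is "_ = - ?r")
proof -
  have "(z - x1) * (z - x2) * (z - x3) * (z - x4) * (z - x5) =
      z ^ 5 - (x1 + x2 + x3 + x4 + x5) * z ^ 4 + ?r"
    by (simp add: eval_nat_numeral algebra_simps)
  then have "z ^ 5 + ?r = 0" using assms by simp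
  then show ?thesis by (rule eq_neg_iff_add_eq_0[THEN iffD2])
qed

text \<open>
  Newton's identities for the roots of a quintic without a term of degree 4.
\<close>

lemma quintic_power_sums:
  fixes y :: "nat \<Rightarrow> 'k::field_char_0" and s t d :: 'k
  defines "p \<equiv> \<lambda>k. \<Sum>j=1..5. y j ^ k"
  assumes p1: "p 1 = 0" and p2: "p 2 = - 20 * s" and p3: "p 3 = - 30 * t" and p4: "p 4 = 200 * s ^ 2 - 4 * d"
  shows "\<exists>e. p 5 = 500 * s * t - 5 * e \<and> (\<forall>k. p (k + 5) = - (10 * s * p (k + 3) + 10 * t * p (k + 2) + d * p (k + 1) + e * p k))"
proof -
  define e where "e = - (y 1 * y 2 * y 3 * y 4 * y 5)"
  have h: "y 1 + y 2 + y 3 + y 4 + y 5 = 0" using p1 unfolding p_def sum5 by simp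
  define e2 where "e2 = y 1 * y 2 + y 1 * y 3 + y 1 * y 4 + y 1 * y 5 + y 2 * y 3 + y 2 * y 4 + y 2 * y 5 +
    y 3 * y 4 + y 3 * y 5 + y 4 * y 5"
  define e3 where "e3 = y 1 * y 2 * y 3 + y 1 * y 2 * y 4 + y 1 * y 2 * y 5 + y 1 * y 3 * y 4 + y 1 * y 3 * y 5 +
    y 1 * y 4 * y 5 + y 2 * y 3 * y 4 + y 2 * y 3 * y 5 + y 2 * y 4 * y 5 + y 3 * y 4 * y 5"
  define e4 where "e4 = y 1 * y 2 * y 3 * y 4 + y 1 * y 2 * y 3 * y 5 + y 1 * y 2 * y 4 * y 5 +
    y 1 * y 3 * y 4 * y 5 + y 2 * y 3 * y 4 * y 5"
  have "y 5 = (y 1 + y 2 + y 3 + y 4 + y 5) - (y 1 + y 2 + y 3 + y 4)" by (simp only: add_diff_cancel_left')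
  \<comment> \<open>Eliminating one root turns the next three identities into identities of polynomials.\<close>
  then have y5: "y 5 = - (y 1 + y 2 + y 3 + y 4)" unfolding h by simp
  have E2: "p 2 = - 2 * e2" unfolding p_def sum5 e2_def y5 by (simp add: eval_nat_numeral algebra_simps)
  have E3: "p 3 = 3 * e3" unfolding p_def sum5 e3_def y5 by (simp add: eval_nat_numeral algebra_simps)
  have E4: "p 4 = 2 * e2 ^ 2 - 4 * e4" unfolding p_def sum5 e2_def e4_def y5 by (simp add: eval_nat_numeral algebra_simps)
  have s: "10 * s = e2" using E2 p2 by (simp add: field_simps)
  have "e3 = - (10 * t)" using E3 p3 by simp
  then have t: "10 * t = - e3" by simp
  have d: "d = e4"
  proof -
    have "4 * d = 4 * e4" using E4 p4 unfolding s[symmetric] by (simp add: power2_eq_square)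
    then show ?thesis by simp
  qed
  have root: "y j ^ 5 = - (10 * s * y j ^ 3 + 10 * t * y j ^ 2 + d * y j + e)" if "j \<in> {1..5}" for j
  proof -
    have "j = 1 \<or> j = 2 \<or> j = 3 \<or> j = 4 \<or> j = 5" using that by auto
    then have "(y j - y 1) * (y j - y 2) * (y j - y 3) * (y j - y 4) * (y j - y 5) = 0" by auto
    from depressed_quintic_root[OF h this] show ?thesis
      unfolding s t d e_def e2_def[symmetric] e3_def[symmetric] e4_def[symmetric] by simp
  qed
  have rec: "p (k + 5) = - (10 * s * p (k + 3) + 10 * t * p (k + 2) + d * p (k + 1) + e * p k)" for k
  proof -
    have "p (k + 5) = (\<Sum>j=1..5. - (10 * s * y j ^ (k + 3) + 10 * t * y j ^ (k + 2) + d * y j ^ (k + 1) + e * y j ^ k))"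
      unfolding p_def
    proof (rule sum.cong[OF refl])
      fix j :: nat assume "j \<in> {1..5}"
      note r = root[OF this]
      show "y j ^ (k + 5) =
          - (10 * s * y j ^ (k + 3) + 10 * t * y j ^ (k + 2) + d * y j ^ (k + 1) + e * y j ^ k)"
        unfolding power_add r by (simp add: algebra_simps)
    qed
    then show ?thesis unfolding p_def by (simp only: sum_negf sum.distrib sum_distrib_left)
  qed
  have "p 0 = 5" unfolding p_def sum5 by simp
  then have "p 5 = 500 * s * t - 5 * e"
    using rec[of 0] unfolding add_0 p1 p2 p3 by (simp add: algebra_simps)
  with rec show ?thesis by blast
qed

text \<open>
  The sum of the squares of the polynomials \<open>A_j Z^2 + B_j Z + C_j\<close> has degree 4 and is divisible by
  the cubic \<open>Z^3 + 3 s Z + t\<close>. Comparing the two leading coefficients, the other factor is linear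
  with coefficients \<open>T\<close> and \<open>S\<close>, so that its root \<open>- S / T\<close> makes the vector isotropic. Clearing the
  denominator gives the vector in the statement. The divisibility amounts to the three identities
  \<open>I1\<close>, \<open>I2\<close>, \<open>I3\<close> between the lower coefficients, which are checked in terms of power sums.
\<close>

lemma quintic_isotropic:
  fixes y :: "nat \<Rightarrow> 'k::field_char_0" and c s t d :: 'k
  defines "p \<equiv> \<lambda>k. \<Sum>j=1..5. y j ^ k"
  defines "A \<equiv> \<lambda>j. quad_coeff c s (y j)" and "B \<equiv> \<lambda>j. lin_coeff c s t (y j)"
    and "C \<equiv> \<lambda>j. const_coeff c s t d (y j)"
  defines "T \<equiv> \<Sum>j=1..5. A j ^ 2" and "S \<equiv> 2 * (\<Sum>j=1..5. A j * B j)"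
  assumes p1: "p 1 = 0" and p2: "p 2 = - 20 * s" and p3: "p 3 = - 30 * t" and p4: "p 4 = 200 * s ^ 2 - 4 * d"
    and c: "c ^ 2 + 2 * c + 5 = 0"
  shows "(\<Sum>j=1..5. (A j * S ^ 2 - B j * S * T + C j * T ^ 2) ^ 2) = 0"
proof -
  obtain e where p5: "p 5 = 500 * s * t - 5 * e"
    and rec: "\<And>k. p (k + 5) = - (10 * s * p (k + 3) + 10 * t * p (k + 2) + d * p (k + 1) + e * p k)"
    using quintic_power_sums[of y s t d] p1 p2 p3 p4 unfolding p_def by blast
  have p0: "p 0 = 5" unfolding p_def by simp
  have p6: "p 6 = - (10 * s * p 4 + 10 * t * p 3 + d * p 2)" using rec[of 1] p1 by (simp add: eval_nat_numeral)
  have p7: "p 7 = - (10 * s * p 5 + 10 * t * p 4 + d * p 3 + e * p 2)" using rec[of 2] by (simp add: eval_nat_numeral)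
  have p8: "p 8 = - (10 * s * p 6 + 10 * t * p 5 + d * p 4 + e * p 3)" using rec[of 3] by (simp add: eval_nat_numeral)
  have AA: "T = c ^ 2 * p 4 + 2 * c * (15 + 7 * c) * s * p 2 + 5 * ((15 + 7 * c) * s) ^ 2"
    unfolding T_def A_def quad_coeff_def p_def sum5 by (simp add: eval_nat_numeral algebra_simps)
  have AB: "(\<Sum>j=1..5. A j * B j) = c ^ 2 * p 5 + (7 * c ^ 2 * s + c * (15 + 7 * c) * s) * p 3 + c * (15 + 9 * c) * t * p 2
      + 7 * c * s * (15 + 7 * c) * s * p 1 + 5 * (15 + 7 * c) * s * (15 + 9 * c) * t"
    unfolding A_def B_def quad_coeff_def lin_coeff_def p_def sum5 by (simp add: eval_nat_numeral algebra_simps)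
  have BB: "(\<Sum>j=1..5. B j ^ 2) = c ^ 2 * p 6 + 14 * c ^ 2 * s * p 4 + 2 * c * (15 + 9 * c) * t * p 3 +
      49 * c ^ 2 * s ^ 2 * p 2 + 14 * c * s * (15 + 9 * c) * t * p 1 + 5 * ((15 + 9 * c) * t) ^ 2"
    unfolding B_def lin_coeff_def p_def sum5 by (simp add: eval_nat_numeral algebra_simps)
  have AC: "(\<Sum>j=1..5. A j * C j) = c ^ 2 * p 6 + (10 * c ^ 2 * s + c * (15 + 7 * c) * s) * p 4 + 9 * c ^ 2 * t * p 3 +
      (c * (1 + c) * d + (15 + 7 * c) * s * 10 * c * s) * p 2 + (15 + 7 * c) * s * 9 * c * t * p 1
      + 5 * (15 + 7 * c) * s * (1 + c) * d"
    unfolding A_def C_def quad_coeff_def const_coeff_def p_def sum5 by (simp add: eval_nat_numeral algebra_simps)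
  have BC: "(\<Sum>j=1..5. B j * C j) = c ^ 2 * p 7 + 17 * c ^ 2 * s * p 5 + (9 * c ^ 2 * t + c * (15 + 9 * c) * t) * p 4 +
      (c * (1 + c) * d + 70 * c ^ 2 * s ^ 2) * p 3 + (63 * c ^ 2 * s * t + (15 + 9 * c) * t * 10 * c * s) * p 2 +
      (7 * c * s * (1 + c) * d + (15 + 9 * c) * t * 9 * c * t) * p 1 + 5 * (15 + 9 * c) * t * (1 + c) * d"
    unfolding B_def C_def lin_coeff_def const_coeff_def p_def sum5 by (simp add: eval_nat_numeral algebra_simps)
  have CC: "(\<Sum>j=1..5. C j ^ 2) = c ^ 2 * p 8 + 20 * c ^ 2 * s * p 6 + 18 * c ^ 2 * t * p 5 +
      (2 * c * (1 + c) * d + 100 * c ^ 2 * s ^ 2) * p 4 + 180 * c ^ 2 * s * t * p 3 +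
      (20 * c * s * (1 + c) * d + 81 * c ^ 2 * t ^ 2) * p 2 + 18 * c * t * (1 + c) * d * p 1 + 5 * ((1 + c) * d) ^ 2"
    unfolding C_def const_coeff_def p_def sum5 by (simp add: eval_nat_numeral algebra_simps)
  have "c * c = (c ^ 2 + 2 * c + 5) - 2 * c - 5" by (simp add: power2_eq_square)
  then have cc: "c * c = - 2 * c - 5" unfolding c by simp
  then have cc': "c * (c * z) = (- 2 * c - 5) * z" for z by (simp add: mult.assoc[symmetric])
  note ps = p8 p7 p6 p5 p4 p3 p2 p1
  have I1: "(\<Sum>j=1..5. B j ^ 2) + 2 * (\<Sum>j=1..5. A j * C j) = 3 * s * T"
    unfolding BB AC AA ps by (simp add: eval_nat_numeral algebra_simps cc cc')
  have I2: "2 * (\<Sum>j=1..5. B j * C j) = 3 * s * S + t * T"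
    unfolding BC S_def AB AA ps by (simp add: eval_nat_numeral algebra_simps cc cc')
  have I3: "(\<Sum>j=1..5. C j ^ 2) = t * S"
    unfolding CC S_def AB ps by (simp add: eval_nat_numeral algebra_simps cc cc')
  have "(\<Sum>j=1..5. (A j * S ^ 2 - B j * S * T + C j * T ^ 2) ^ 2) =
      S ^ 4 * (\<Sum>j=1..5. A j ^ 2) - 2 * S ^ 3 * T * (\<Sum>j=1..5. A j * B j) +
      S ^ 2 * T ^ 2 * ((\<Sum>j=1..5. B j ^ 2) + 2 * (\<Sum>j=1..5. A j * C j)) -
      2 * S * T ^ 3 * (\<Sum>j=1..5. B j * C j) + T ^ 4 * (\<Sum>j=1..5. C j ^ 2)"
    unfolding sum5 by (simp add: eval_nat_numeral algebra_simps)
  also have "\<dots> = S ^ 4 * T - S ^ 3 * T * S + S ^ 2 * T ^ 2 * (3 * s * T) -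
      S * T ^ 3 * (3 * s * S + t * T) + T ^ 4 * (t * S)"
    unfolding I1 I3 I2[symmetric] unfolding T_def[symmetric] by (simp add: S_def)
  also have "\<dots> = 0" by (simp add: eval_nat_numeral algebra_simps)
  finally show ?thesis .
qed

section \<open>The symmetric group on five letters\<close>

definition isotropic_vector :: "'k \<Rightarrow> (nat \<Rightarrow> 'k::field) \<Rightarrow> nat \<Rightarrow> 'k"
  where "isotropic_vector c x = (let
      s = - moment 2 x / 20; t = - moment 3 x / 30; d = 50 * s ^ 2 - moment 4 x / 4;
      A = (\<lambda>j. quad_coeff c s (x j - mean x));
      B = (\<lambda>j. lin_coeff c s t (x j - mean x));
      C = (\<lambda>j. const_coeff c s t d (x j - mean x));
      T = (\<Sum>j=1..5. A j ^ 2); S = 2 * (\<Sum>j=1..5. A j * B j)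
    in restrict5 (\<lambda>j. A j * S ^ 2 - B j * S * T + C j * T ^ 2))"

text \<open>
  Up to the order, these are the powers 0 to 3 of the coordinates and a combination of the powers
  0 to 4: a Vandermonde matrix, if the coefficient of the fourth power is not zero.
\<close>

definition S5_frame :: "'k \<Rightarrow> nat \<Rightarrow> (nat \<Rightarrow> 'k::field) \<Rightarrow> nat \<Rightarrow> 'k"
  where "S5_frame c i x = (if i = 5 then isotropic_vector c x
    else restrict5 (\<lambda>j. if i = 1 then x j else if i = 2 then 1 else (x j - mean x) ^ (i - 1)))"

lemma dot_restrict5: "dot (restrict5 x) (restrict5 y) = dot x y"
  unfolding dot_def restrict5_def by (intro sum.cong) auto

lemma isotropic_vector_isotropic:
  fixes x :: "nat \<Rightarrow> 'k::field_char_0"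
  assumes c: "c ^ 2 + 2 * c + 5 = 0"
  shows "dot (isotropic_vector c x) (isotropic_vector c x) = 0"
proof -
  define y where "y = (\<lambda>j. x j - mean x)"
  define s where "s = - moment 2 x / 20"
  define t where "t = - moment 3 x / 30"
  define d where "d = 50 * s ^ 2 - moment 4 x / 4"
  have p1: "(\<Sum>j=1..5. y j ^ 1) = 0" unfolding y_def mean_def by (simp add: sum_subtractf)
  have p2: "(\<Sum>j=1..5. y j ^ 2) = - 20 * s" unfolding s_def y_def moment_def by simp
  have p3: "(\<Sum>j=1..5. y j ^ 3) = - 30 * t" unfolding t_def y_def moment_def by simp
  have p4: "(\<Sum>j=1..5. y j ^ 4) = 200 * s ^ 2 - 4 * d" unfolding d_def y_def moment_def by simp
  from quintic_isotropic[of y, OF p1 p2 p3 p4 c]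
  show ?thesis
    unfolding isotropic_vector_def Let_def dot_restrict5
    unfolding dot_def power2_eq_square[symmetric, of "_ - _ * _ * _ + _ * _"]
    unfolding s_def[symmetric] t_def[symmetric] unfolding d_def[symmetric] y_def by (simp add: power2_eq_square)
qed

lemma poly_fun_mean: "poly_fun {1..5} mean"
  unfolding mean_def[abs_def] by (intro poly_fun_intros poly_fun_divide)

lemma poly_fun_centred: "j \<in> {1..5} \<Longrightarrow> poly_fun {1..5} (\<lambda>x. x j - mean x)"
  by (intro poly_fun_diff poly_fun_mean poly_fun.coord)

lemma poly_fun_moment: "poly_fun {1..5} (moment k)"
  unfolding moment_def[abs_def] by (intro poly_fun_sum poly_fun_power poly_fun_centred)

lemma poly_fun_coeffs:
  assumes "poly_fun I s" "poly_fun I t" "poly_fun I d" "poly_fun I y"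
  shows "poly_fun I (\<lambda>x. quad_coeff c (s x) (y x))" "poly_fun I (\<lambda>x. lin_coeff c (s x) (t x) (y x))"
    "poly_fun I (\<lambda>x. const_coeff c (s x) (t x) (d x) (y x))"
  unfolding quad_coeff_def lin_coeff_def const_coeff_def
  using assms by (auto intro!: poly_fun.add poly_fun.mult poly_fun_power poly_fun.const)

lemma poly_fun_isotropic_vector:
  assumes j: "j \<in> {1..5}"
  shows "poly_fun {1..5} (\<lambda>x. isotropic_vector c x j)"
proof -
  define s :: "(nat \<Rightarrow> 'a) \<Rightarrow> 'a" where "s x = - moment 2 x / 20" for x
  define t :: "(nat \<Rightarrow> 'a) \<Rightarrow> 'a" where "t x = - moment 3 x / 30" for x
  define d :: "(nat \<Rightarrow> 'a) \<Rightarrow> 'a" where "d x = 50 * s x ^ 2 - moment 4 x / 4" for x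
  define A where "A j x = quad_coeff c (s x) (x j - mean x)" for j x
  define B where "B j x = lin_coeff c (s x) (t x) (x j - mean x)" for j x
  define C where "C j x = const_coeff c (s x) (t x) (d x) (x j - mean x)" for j x
  have s: "poly_fun {1..5} s" and t: "poly_fun {1..5} t"
    unfolding s_def[abs_def] t_def[abs_def] by (intro poly_fun_divide poly_fun_uminus poly_fun_moment)+
  have d: "poly_fun {1..5} d"
    unfolding d_def[abs_def]
    by (intro poly_fun_diff poly_fun.mult poly_fun_power s poly_fun_divide poly_fun_moment poly_fun.const)
  note ABC = poly_fun_coeffs[OF s t d poly_fun_centred, of _ c, folded A_def B_def C_def]
  define T where "T x = (\<Sum>j=1..5. A j x ^ 2)" for x
  define S where "S x = 2 * (\<Sum>j=1..5. A j x * B j x)" for x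
  have T: "poly_fun {1..5} T" unfolding T_def[abs_def] by (intro poly_fun_sum poly_fun_power ABC)
  have S: "poly_fun {1..5} S"
    unfolding S_def[abs_def] by (rule poly_fun.mult[OF poly_fun.const]) (intro poly_fun_sum poly_fun.mult ABC)
  have "poly_fun {1..5} (\<lambda>x. A j x * S x ^ 2 - B j x * S x * T x + C j x * T x ^ 2)"
    by (intro poly_fun.add poly_fun_diff poly_fun.mult poly_fun_power S T ABC j)
  moreover have "isotropic_vector c x j = A j x * S x ^ 2 - B j x * S x * T x + C j x * T x ^ 2" for x
    unfolding isotropic_vector_def Let_def s_def[symmetric] t_def[symmetric] d_def[symmetric]
      A_def[symmetric] B_def[symmetric] C_def[symmetric] T_def[symmetric] S_def[symmetric]
    using j by (simp add: restrict5_def)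
  ultimately show ?thesis by simp
qed

lemma mean_perm: "\<sigma> permutes {1..5} \<Longrightarrow> mean (perm_coords \<sigma> x) = mean x"
  unfolding mean_def using sum_perm_coords[of \<sigma> "{1..5}" "\<lambda>u _. u" x x] by simp

lemma moment_perm: "\<sigma> permutes {1..5} \<Longrightarrow> moment k (perm_coords \<sigma> x) = moment k x"
  unfolding moment_def mean_perm using sum_perm_coords[of \<sigma> "{1..5}" "\<lambda>u _. (u - mean x) ^ k" x x] by simp

lemma restrict5_perm:
  assumes "\<sigma> permutes S" "S \<subseteq> {1..5}"
  shows "restrict5 (perm_coords \<sigma> f) = perm_coords \<sigma> (restrict5 f)"
proof -
  have "\<sigma> permutes {1..5}" using permutes_subset[OF assms] .
  then have "inv' \<sigma> j \<in> {1..5} \<longleftrightarrow> j \<in> {1..5}" for j using permutes_in_image[OF permutes_inv] by metis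
  then show ?thesis unfolding restrict5_def perm_coords_def by simp
qed

lemma isotropic_vector_perm:
  assumes \<sigma>: "\<sigma> permutes {1..5}"
  shows "isotropic_vector c (perm_coords \<sigma> x) = perm_coords \<sigma> (isotropic_vector c x)"
proof -
  have sums: "(\<Sum>j=1..5. h (perm_coords \<sigma> x j)) = (\<Sum>j=1..5. h (x j))" for h :: "'a \<Rightarrow> 'a"
    using sum_perm_coords[OF \<sigma>, of "\<lambda>u _. h u" x x] .
  have comp: "(\<lambda>j. h (perm_coords \<sigma> x j)) = perm_coords \<sigma> (\<lambda>j. h (x j))" for h :: "'a \<Rightarrow> 'a"
    unfolding perm_coords_def ..
  define s where "s = - moment 2 x / 20"
  define t where "t = - moment 3 x / 30"
  define d where "d = 50 * s ^ 2 - moment 4 x / 4"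
  let ?A = "\<lambda>u. quad_coeff c s (u - mean x)"
  let ?B = "\<lambda>u. lin_coeff c s t (u - mean x)"
  let ?C = "\<lambda>u. const_coeff c s t d (u - mean x)"
  let ?T = "\<Sum>j=1..5. ?A (x j) ^ 2" and ?S = "2 * (\<Sum>j=1..5. ?A (x j) * ?B (x j))"
  have 1: "isotropic_vector c x = restrict5 (\<lambda>j. ?A (x j) * ?S ^ 2 - ?B (x j) * ?S * ?T + ?C (x j) * ?T ^ 2)"
    unfolding isotropic_vector_def Let_def s_def t_def d_def ..
  have "isotropic_vector c (perm_coords \<sigma> x) =
      restrict5 (\<lambda>j. ?A (perm_coords \<sigma> x j) * ?S ^ 2 - ?B (perm_coords \<sigma> x j) * ?S * ?T + ?C (perm_coords \<sigma> x j) * ?T ^ 2)"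
    unfolding isotropic_vector_def Let_def mean_perm[OF \<sigma>] moment_perm[OF \<sigma>]
    unfolding s_def[symmetric] t_def[symmetric] unfolding d_def[symmetric]
    unfolding sums[of "\<lambda>u. ?A u ^ 2"] sums[of "\<lambda>u. ?A u * ?B u"] ..
  also have "\<dots> = perm_coords \<sigma> (isotropic_vector c x)"
    unfolding 1 comp[of "\<lambda>u. ?A u * ?S ^ 2 - ?B u * ?S * ?T + ?C u * ?T ^ 2"]
    by (rule restrict5_perm[OF \<sigma> order_refl])
  finally show ?thesis .
qed

lemma S5_frame_perm:
  assumes \<sigma>: "\<sigma> permutes {1..5}"
  shows "S5_frame c i (perm_coords \<sigma> x) = perm_coords \<sigma> (S5_frame c i x)"
proof (cases "i = 5")
  case True
  then show ?thesis unfolding S5_frame_def by (simp add: isotropic_vector_perm[OF \<sigma>])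
next
  case False
  define h where "h u = (if i = 1 then u else if i = 2 then 1 else (u - mean x) ^ (i - 1))" for u
  have "(\<lambda>j. h (perm_coords \<sigma> x j)) = perm_coords \<sigma> (\<lambda>j. h (x j))" unfolding perm_coords_def ..
  then have "restrict5 (\<lambda>j. h (perm_coords \<sigma> x j)) = perm_coords \<sigma> (restrict5 (\<lambda>j. h (x j)))"
    using restrict5_perm[OF \<sigma> order_refl, of "\<lambda>j. h (x j)"] by simp
  then show ?thesis using False unfolding S5_frame_def mean_perm[OF \<sigma>] h_def by simp
qed

lemma S5_linear_representation: "linear_representation (sym_group 5) {1..5} (perm_coords :: _ \<Rightarrow> (nat \<Rightarrow> 'k::field) \<Rightarrow> _)"
  unfolding linear_representation_def sym_group_carrier sym_group_mult sym_group_one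
  by (intro conjI ballI allI; (rule perm_coords_mem[OF _ order_refl] perm_coords_comp)?)
     (auto simp: sym_group_carrier perm_coords_def[of id] perm_coords_def[of _ "\<lambda>i. _ i + _ i"]
       perm_coords_def[of _ "\<lambda>i. _ * _ i"] inv_id perm_coords_def)

text \<open>
  The centred coordinates are \<open>-2, -1, 0, 1, 2\<close>, whose odd moments vanish. In \<open>isotropic_vector\<close> this
  makes \<open>S = 0\<close>, so that only its last term survives. The vector is isotropic if \<open>m^2 = - 2\<close>.
\<close>

definition S5_point :: "'k \<Rightarrow> nat \<Rightarrow> 'k::field"
  where "S5_point m = (\<lambda>j. if j \<in> {1..5} then of_nat j - 3 + m else 0)"

lemma S5_point_coords:
  fixes m :: "'k::field_char_0"
  shows "S5_point m 1 = m - 2" "S5_point m 2 = m - 1" "S5_point m 3 = m" "S5_point m 4 = m + 1" "S5_point m 5 = m + 2"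
  unfolding S5_point_def by (simp_all add: algebra_simps)

lemma S5_point_mean: "mean (S5_point (m :: 'k::field_char_0)) = m"
  unfolding mean_def sum5 S5_point_coords by (simp add: algebra_simps)

lemma S5_point_moments:
  fixes m :: "'k::field_char_0"
  shows "moment 2 (S5_point m) = 10" "moment 3 (S5_point m) = 0" "moment 4 (S5_point m) = 34"
  unfolding moment_def sum5 S5_point_mean S5_point_coords by (simp_all add: algebra_simps eval_nat_numeral)

lemma isotropic_vector_S5_point:
  fixes m :: "'k::field_char_0"
  assumes c: "c ^ 2 + 2 * c + 5 = 0"
  shows "\<exists>e. e \<noteq> 0 \<and> isotropic_vector c (S5_point m) =
    restrict5 (\<lambda>j. if j = 3 then e * (1 + c) else e)"
proof -
  have "c * c = (c ^ 2 + 2 * c + 5) - 2 * c - 5" by (simp add: power2_eq_square)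
  then have cc: "c * c = - 2 * c - 5" unfolding c by simp
  have ccz: "c * (c * z) = (- 2 * c - 5) * z" for z using cc by (simp add: mult.assoc[symmetric])
  let ?x = "S5_point m"
  define A where "A j = quad_coeff c (- 1 / 2) (?x j - m)" for j
  define B where "B j = lin_coeff c (- 1 / 2) 0 (?x j - m)" for j
  define C where "C j = const_coeff c (- 1 / 2) 0 4 (?x j - m)" for j
  define T where "T = (\<Sum>j=1..5. A j ^ 2)"
  have Tv: "T = 62 * c + 155"
    unfolding T_def sum5 A_def quad_coeff_def S5_point_coords
    by (simp add: power2_eq_square field_simps cc ccz)
  have T0: "T \<noteq> 0"
  proof
    assume "T = 0"
    then have "31 * (2 * c + 5) = 0" unfolding Tv by (simp add: algebra_simps)
    then have "2 * c + 5 = 0" by (metis mult_eq_0_iff zero_neq_numeral)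
    moreover have "4 * (c ^ 2 + 2 * c + 5) = (2 * c + 5) * (2 * c - 1) + 25"
      by (simp add: power2_eq_square algebra_simps)
    ultimately show False unfolding c by simp
  qed
  have S: "(\<Sum>j=1..5. A j * B j) = 0"
    unfolding sum5 A_def B_def quad_coeff_def lin_coeff_def S5_point_coords
    by (simp add: eval_nat_numeral algebra_simps)
  have sv: "- (10::'k) / 20 = - 1 / 2" "50 * (- 1 / 2 :: 'k) ^ 2 - 34 / 4 = 4" "- (0::'k) / 30 = 0"
    by (simp_all add: power2_eq_square field_simps)
  have "isotropic_vector c ?x = restrict5 (\<lambda>j. C j * T ^ 2)"
    unfolding isotropic_vector_def Let_def S5_point_moments S5_point_mean sv
    unfolding A_def[symmetric] B_def[symmetric] C_def[symmetric] T_def[symmetric] S by simp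
  also have "\<dots> = restrict5 (\<lambda>j. if j = 3 then 4 * T ^ 2 * (1 + c) else 4 * T ^ 2)"
  proof -
    have "C j = (if j = 3 then 4 * (1 + c) else 4)" if "j \<in> {1..5}" for j
    proof -
      have "j = 1 \<or> j = 2 \<or> j = 3 \<or> j = 4 \<or> j = 5" using that by auto
      then show ?thesis
        unfolding C_def const_coeff_def
        by (elim disjE) (simp_all only: S5_point_coords, simp_all add: eval_nat_numeral algebra_simps)
    qed
    then show ?thesis unfolding restrict5_def by (auto simp: fun_eq_iff)
  qed
  finally show ?thesis using T0 by (intro exI[of _ "4 * T ^ 2"]) simp
qed

text \<open>
  The centred coordinates come in pairs \<open>y\<close> and \<open>- y\<close>, and even and odd powers separate after adding
  and subtracting the corresponding rows.
\<close>

lemma S5_point_independent: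
  fixes m :: "'k::field_char_0"
  assumes c: "c ^ 2 + 2 * c + 5 = 0"
    and b: "\<And>j. j \<in> {1..5} \<Longrightarrow> (\<Sum>i=1..5. b i * S5_frame c i (S5_point m) j) = 0"
    and i: "i \<in> {1..5}"
  shows "b i = 0"
proof -
  obtain e where e: "e \<noteq> 0" "isotropic_vector c (S5_point m) = restrict5 (\<lambda>j. if j = 3 then e * (1 + c) else e)"
    using isotropic_vector_S5_point[OF c] by blast
  have row: "b 1 * S5_point m j + b 2 + b 3 * (S5_point m j - m) ^ 2 + b 4 * (S5_point m j - m) ^ 3
      + b 5 * (if j = 3 then e * (1 + c) else e) = 0" if "j \<in> {1..5}" for j
    using b[OF that] that unfolding sum5 by (simp add: S5_frame_def S5_point_mean e(2) restrict5_def)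
  have c0: "c \<noteq> 0" using c by auto
  have r1: "b 1 * (m - 2) + b 2 + 4 * b 3 - 8 * b 4 + b 5 * e = 0" using row[of 1] by (simp add: S5_point_coords[unfolded One_nat_def] S5_point_coords mult.commute)
  have r2: "b 1 * (m - 1) + b 2 + b 3 - b 4 + b 5 * e = 0" using row[of 2] by (simp add: S5_point_coords)
  have r3: "b 1 * m + b 2 + b 5 * e + b 5 * e * c = 0" using row[of 3] by (simp add: S5_point_coords algebra_simps)
  have r4: "b 1 * (m + 1) + b 2 + b 3 + b 4 + b 5 * e = 0" using row[of 4] by (simp add: S5_point_coords)
  have r5: "b 1 * (m + 2) + b 2 + 4 * b 3 + 8 * b 4 + b 5 * e = 0" using row[of 5] by (simp add: S5_point_coords mult.commute)
  have "6 * b 3 = (b 1 * (m - 2) + b 2 + 4 * b 3 - 8 * b 4 + b 5 * e) + (b 1 * (m + 2) + b 2 + 4 * b 3 + 8 * b 4 + b 5 * e)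
     - (b 1 * (m - 1) + b 2 + b 3 - b 4 + b 5 * e) - (b 1 * (m + 1) + b 2 + b 3 + b 4 + b 5 * e)"
    by (simp add: algebra_simps)
  then have b3: "b 3 = 0" unfolding r1 r2 r4 r5 by simp
  have "12 * b 4 = ((b 1 * (m + 2) + b 2 + 4 * b 3 + 8 * b 4 + b 5 * e) - (b 1 * (m - 2) + b 2 + 4 * b 3 - 8 * b 4 + b 5 * e))
     - 2 * ((b 1 * (m + 1) + b 2 + b 3 + b 4 + b 5 * e) - (b 1 * (m - 1) + b 2 + b 3 - b 4 + b 5 * e))"
    by (simp add: algebra_simps)
  then have b4: "b 4 = 0" unfolding r1 r2 r4 r5 by simp
  have "2 * b 1 = (b 1 * (m + 1) + b 2 + b 3 + b 4 + b 5 * e) - (b 1 * (m - 1) + b 2 + b 3 - b 4 + b 5 * e) - 2 * b 4"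
    by (simp add: algebra_simps)
  then have b1: "b 1 = 0" unfolding r2 r4 unfolding b4 by simp
  have "b 2 + b 5 * e = 0" "b 2 + b 5 * e + b 5 * e * c = 0" using r2 r3 b1 b3 b4 by auto
  then have b5: "b 5 = 0" and "b 2 = 0" using e(1) c0 by auto
  moreover have "i = 1 \<or> i = 2 \<or> i = 3 \<or> i = 4 \<or> i = 5" using i by auto
  ultimately show ?thesis using b1 b3 b4 by auto
qed

text \<open>
  The invariant linear form is the sum of the coordinates, rescaled so that it is 1 at \<open>S5_point m\<close>.
\<close>

lemma S5_equivariant_frame:
  fixes m c :: "'k::{alg_closed_field, field_char_0}"
  assumes m: "m ^ 2 = - 2" and c: "c ^ 2 + 2 * c + 5 = 0"
  shows "equivariant_frame (sym_group 5) perm_coords (\<lambda>x. (\<Sum>i=1..5. x i) / (5 * m)) (S5_frame c) (S5_point m)"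
proof (rule equivariant_frame.intro)
  have m0: "m \<noteq> 0" using m by auto
  show "group (sym_group 5)" by (rule sym_group_is_group)
  show "finite (carrier (sym_group 5))" unfolding sym_group_def by (simp add: finite_permutations)
  show "linear_representation (sym_group 5) {1..5} (perm_coords :: _ \<Rightarrow> (nat \<Rightarrow> 'k) \<Rightarrow> _)"
    by (rule S5_linear_representation)
  show "dot (perm_coords g x) (perm_coords g y) = dot x y" if "g \<in> carrier (sym_group 5)" for g and x y :: "nat \<Rightarrow> 'k"
    unfolding dot_def by (rule sum_perm_coords) (use that in \<open>simp add: sym_group_carrier\<close>)
  show "g = \<one>\<^bsub>sym_group 5\<^esub>" if g: "g \<in> carrier (sym_group 5)" and fixed: "\<And>x :: nat \<Rightarrow> 'k. x \<in> vspace \<Longrightarrow> perm_coords g x = x" for g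
    unfolding sym_group_one
  proof (rule perm_coords_faithful[where S="{1..5}" and 'k='k])
    fix j :: nat assume "j \<in> {1..5}"
    from fixed[OF std_basis_vspace[OF this]]
    show "perm_coords g (std_basis j :: nat \<Rightarrow> 'k) j = 1" by (simp add: std_basis_def)
  qed (use g in \<open>simp add: sym_group_carrier\<close>)
  show "homogeneous_fun {1..5} 1 (\<lambda>x :: nat \<Rightarrow> 'k. (\<Sum>i=1..5. x i) / (5 * m))"
    unfolding homogeneous_fun_def
    by (auto intro!: poly_fun_divide poly_fun_sum poly_fun.coord simp: sum_distrib_left simp del: One_nat_def)
  show "(\<Sum>i=1..5. perm_coords g x i) / (5 * m) = (\<Sum>i=1..5. x i) / (5 * m)"
    if "g \<in> carrier (sym_group 5)" for g and x :: "nat \<Rightarrow> 'k"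
    using sum_perm_coords[of g "{1..5}" "\<lambda>u _. u" x x] that by (simp add: sym_group_carrier)
  show "poly_fun {1..5} (\<lambda>x :: nat \<Rightarrow> 'k. S5_frame c i x j)" if "i \<in> {1..5}" "j \<in> {1..5}" for i j
  proof -
    consider "i = 5" | "i = 1" | "i = 2" | "i \<notin> {1, 2, 5}" by blast
    then show ?thesis
      unfolding S5_frame_def using that(2)
      by cases (auto simp: restrict5_def simp del: One_nat_def intro!: poly_fun_isotropic_vector poly_fun.intros
          poly_fun_power poly_fun_centred)
  qed
  show "S5_frame c i x \<in> vspace" for i x
    unfolding S5_frame_def isotropic_vector_def Let_def by (simp add: restrict5_vspace del: One_nat_def)
  show "S5_frame c i (perm_coords g x) = perm_coords g (S5_frame c i x)" if "g \<in> carrier (sym_group 5)" for g i x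
    by (rule S5_frame_perm) (use that in \<open>simp add: sym_group_carrier\<close>)
  show "S5_frame c 1 x = x" if "x \<in> vspace" for x
    using that unfolding S5_frame_def restrict5_def coord_space_def by auto
  show "dot (S5_frame c 5 x) (S5_frame c 5 x) = 0" for x
    unfolding S5_frame_def using isotropic_vector_isotropic[OF c] by simp
  show "S5_point m \<in> vspace" unfolding S5_point_def coord_space_def by simp
  show "dot (S5_point m) (S5_point m) = 0"
    unfolding dot_def sum5 S5_point_coords using m by (simp add: algebra_simps power2_eq_square)
  have s: "(\<Sum>i=1..5. S5_point m i) = 5 * m" unfolding sum5 S5_point_coords by simp
  show "(\<Sum>i=1..5. S5_point m i) / (5 * m) = 1" unfolding s using m0 by simp
  obtain e where e: "e \<noteq> 0" "isotropic_vector c (S5_point m) = restrict5 (\<lambda>j. if j = 3 then e * (1 + c) else e)"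
    using isotropic_vector_S5_point[OF c] by blast
  have "dot (S5_frame c 5 (S5_point m)) (S5_point m) = e * m * (c + 5)"
    unfolding dot_def sum5 S5_point_coords by (simp add: S5_frame_def e(2) restrict5_def algebra_simps)
  moreover have "c + 5 \<noteq> 0"
  proof
    assume "c + 5 = 0"
    moreover have "c ^ 2 + 2 * c + 5 = (c + 5) * (c - 3) + 20" by (simp add: power2_eq_square algebra_simps)
    ultimately show False using c by simp
  qed
  ultimately show "dot (S5_frame c 5 (S5_point m)) (S5_point m) \<noteq> 0" using e m0 by simp
  show "b i = 0" if "\<And>j. j \<in> {1..5} \<Longrightarrow> (\<Sum>i=1..5. b i * S5_frame c i (S5_point m) j) = 0" "i \<in> {1..5}" for b i
    using S5_point_independent[OF c that] .
qed

section \<open>Three letters and two sign changes\<close>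

definition mean3 :: "(nat \<Rightarrow> 'k::field) \<Rightarrow> 'k"
  where "mean3 x = (\<Sum>i=1..3. x i) / 3"

text \<open>
  For \<open>y_1 + y_2 + y_3 = 0\<close> the sum of the fourth powers is half the square of the sum \<open>p\<close> of the
  squares. Hence the squares of the components \<open>y_j^2 + \<kappa> p\<close> add up to
  \<open>p^2 (1 + 4 \<kappa> + 6 \<kappa>^2) / 2\<close>.
\<close>

definition S3_isotropic_vector :: "'k \<Rightarrow> (nat \<Rightarrow> 'k::field) \<Rightarrow> nat \<Rightarrow> 'k"
  where "S3_isotropic_vector \<kappa> x = (\<lambda>j. if j \<in> {1..3}
    then (x j - mean3 x) ^ 2 + \<kappa> * (\<Sum>i=1..3. (x i - mean3 x) ^ 2) else 0)"

text \<open>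
  The identity, the constant vector on the first three coordinates, the projections to the two
  coordinates with sign changes (as \<open>M 3\<close> and \<open>M 4\<close>), and the isotropic vector.
\<close>

definition S3_frame :: "'k \<Rightarrow> nat \<Rightarrow> (nat \<Rightarrow> 'k::field) \<Rightarrow> nat \<Rightarrow> 'k"
  where "S3_frame \<kappa> i x = (if i = 5 then S3_isotropic_vector \<kappa> x else (\<lambda>j.
    if i = 1 then restrict5 x j else if i = 2 then (if j \<in> {1..3} then 1 else 0)
    else if j = i + 1 then x j else 0))"

lemma S3_isotropic_vector_isotropic:
  fixes x :: "nat \<Rightarrow> 'k::field_char_0"
  assumes \<kappa>: "6 * \<kappa> ^ 2 + 4 * \<kappa> + 1 = 0"
  shows "dot (S3_isotropic_vector \<kappa> x) (S3_isotropic_vector \<kappa> x) = 0"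
proof -
  define y1 where "y1 = x 1 - mean3 x"
  define y2 where "y2 = x 2 - mean3 x"
  define y3 where "y3 = x 3 - mean3 x"
  have y: "y3 = - (y1 + y2)" unfolding y1_def y2_def y3_def mean3_def sum3 by (simp add: field_simps)
  define p where "p = y1 ^ 2 + y2 ^ 2 + y3 ^ 2"
  have "dot (S3_isotropic_vector \<kappa> x) (S3_isotropic_vector \<kappa> x) =
      (y1 ^ 2 + \<kappa> * p) ^ 2 + (y2 ^ 2 + \<kappa> * p) ^ 2 + (y3 ^ 2 + \<kappa> * p) ^ 2"
    unfolding dot_def sum5 S3_isotropic_vector_def sum3 p_def y1_def y2_def y3_def
    by (simp add: power2_eq_square)
  also have "2 * \<dots> = p ^ 2 * (6 * \<kappa> ^ 2 + 4 * \<kappa> + 1)"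
    unfolding p_def y by (simp add: eval_nat_numeral algebra_simps)
  finally show ?thesis unfolding \<kappa> by simp
qed

lemma mean3_perm_sign:
  assumes "\<sigma> permutes {1..3}"
  shows "mean3 (perm_sign_coords (\<sigma>, s, t) x) = mean3 x"
proof -
  have "(\<Sum>i=1..3. perm_sign_coords (\<sigma>, s, t) x i) = (\<Sum>i=1..3. perm_coords \<sigma> x i)"
    unfolding perm_sign_coords_def by (intro sum.cong) auto
  then show ?thesis unfolding mean3_def using sum_perm_coords[OF assms, of "\<lambda>u _. u" x x] by simp
qed

lemma perm_sign_low:
  assumes "\<sigma> permutes {1..3}" "j \<in> {1..3}"
  shows "perm_sign_coords (\<sigma>, s, t) x j = x (inv' \<sigma> j)" "inv' \<sigma> j \<in> {1..3}"
  using assms(2) permutes_in_image[OF permutes_inv[OF assms(1)], of j]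
  unfolding perm_sign_coords_def perm_coords_def by auto

lemma perm_sign_high:
  assumes "\<sigma> permutes {1..3}"
  shows "perm_sign_coords (\<sigma>, s, t) x 4 = of_int s * x 4" "perm_sign_coords (\<sigma>, s, t) x 5 = of_int t * x 5"
    "j \<notin> {1..5} \<Longrightarrow> perm_sign_coords (\<sigma>, s, t) x j = x j"
  using permutes_not_in[OF permutes_inv[OF assms], of j]
  unfolding perm_sign_coords_def perm_coords_def by auto

lemma perm_sign_eqI:
  assumes \<sigma>: "\<sigma> permutes {1..3}"
    and "\<And>j. j \<in> {1..3} \<Longrightarrow> y j = x (inv' \<sigma> j)" "y 4 = of_int s * x 4" "y 5 = of_int t * x 5"
    "\<And>j. j \<notin> {1..5} \<Longrightarrow> y j = x j"
  shows "y = perm_sign_coords (\<sigma>, s, t) x"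
proof
  fix j :: nat
  consider "j \<in> {1..3}" | "j = 4" | "j = 5" | "j \<notin> {1..5}" by fastforce
  then show "y j = perm_sign_coords (\<sigma>, s, t) x j"
    by cases (simp_all add: assms(2-) perm_sign_low[OF \<sigma>] perm_sign_high[OF \<sigma>] del: One_nat_def)
qed

lemma sum_perm_sign:
  assumes "\<sigma> permutes {1..3}"
  shows "(\<Sum>i=1..3. h (perm_sign_coords (\<sigma>, s, t) x i) (perm_sign_coords (\<sigma>, s, t) y i)) = (\<Sum>i=1..3. h (x i) (y i))"
proof -
  have "(\<Sum>i=1..3. h (perm_sign_coords (\<sigma>, s, t) x i) (perm_sign_coords (\<sigma>, s, t) y i)) =
      (\<Sum>i=1..3. h (perm_coords \<sigma> x i) (perm_coords \<sigma> y i))"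
    unfolding perm_sign_coords_def by (intro sum.cong) auto
  then show ?thesis using sum_perm_coords[OF assms] by simp
qed

lemma S3_frame_perm_sign:
  assumes \<sigma>: "\<sigma> permutes {1..3}" and i: "i \<in> {1..5}"
  shows "S3_frame \<kappa> i (perm_sign_coords (\<sigma>, s, t) x) = perm_sign_coords (\<sigma>, s, t) (S3_frame \<kappa> i x)"
proof (rule perm_sign_eqI[OF \<sigma>])
  note sums = sum_perm_sign[OF \<sigma>, where h="\<lambda>u _. (u - mean3 x) ^ 2" and x=x and y=x and s=s and t=t]
  have ic: "i = 1 \<or> i = 2 \<or> i = 3 \<or> i = 4 \<or> i = 5" using i by auto
  show "S3_frame \<kappa> i (perm_sign_coords (\<sigma>, s, t) x) j = S3_frame \<kappa> i x (inv' \<sigma> j)" if j: "j \<in> {1..3}" for j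
  proof -
    have "inv' \<sigma> j \<in> {1..3}" "perm_sign_coords (\<sigma>, s, t) x j = x (inv' \<sigma> j)" using perm_sign_low[OF \<sigma> j] by auto
    then show ?thesis
      using j ic unfolding S3_frame_def S3_isotropic_vector_def mean3_perm_sign[OF \<sigma>] sums restrict5_def
      by auto
  qed
  show "S3_frame \<kappa> i (perm_sign_coords (\<sigma>, s, t) x) 4 = of_int s * S3_frame \<kappa> i x 4"
    "S3_frame \<kappa> i (perm_sign_coords (\<sigma>, s, t) x) 5 = of_int t * S3_frame \<kappa> i x 5"
    using ic unfolding S3_frame_def S3_isotropic_vector_def restrict5_def
    by (auto simp: perm_sign_high[OF \<sigma>])
  show "S3_frame \<kappa> i (perm_sign_coords (\<sigma>, s, t) x) j = S3_frame \<kappa> i x j" if "j \<notin> {1..5}" for j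
    using ic that unfolding S3_frame_def S3_isotropic_vector_def restrict5_def by auto
qed

lemma S3_C2_C2_carrier: "(\<sigma>, s, t) \<in> carrier S3_C2_C2 \<longleftrightarrow> \<sigma> permutes {1..3} \<and> s \<in> {-1, 1} \<and> t \<in> {-1, 1}"
  unfolding S3_C2_C2_def by (auto simp: DirProd_def sym_group_carrier sign_img_def)

lemma S3_C2_C2_mult: "(\<sigma>, s, t) \<otimes>\<^bsub>S3_C2_C2\<^esub> (\<sigma>', s', t') = (\<sigma> \<circ> \<sigma>', s * s', t * t')"
  unfolding S3_C2_C2_def by (simp add: DirProd_def sym_group_mult sign_img_def)

lemma S3_C2_C2_one: "\<one>\<^bsub>S3_C2_C2\<^esub> = (id, 1, 1)"
  unfolding S3_C2_C2_def by (simp add: DirProd_def sym_group_one sign_img_def)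

lemma S3_linear_representation:
  "linear_representation S3_C2_C2 {1..5} (perm_sign_coords :: _ \<Rightarrow> (nat \<Rightarrow> 'k::field) \<Rightarrow> _)"
  unfolding linear_representation_def
proof (intro conjI ballI allI)
  fix g and x :: "nat \<Rightarrow> 'k" assume "g \<in> carrier S3_C2_C2" and x: "x \<in> vspace"
  then obtain \<sigma> s t where g: "g = (\<sigma>, s, t)" "\<sigma> permutes {1..3}" by (cases g) (auto simp: S3_C2_C2_carrier)
  show "perm_sign_coords g x \<in> vspace"
    using x unfolding g(1) coord_space_def by (simp add: perm_sign_high[OF g(2)] del: One_nat_def)
  show "perm_sign_coords g (\<lambda>i. x i + y i) = (\<lambda>i. perm_sign_coords g x i + perm_sign_coords g y i)" for y
    unfolding g(1) perm_sign_coords_def perm_coords_def by (auto simp: algebra_simps)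
  show "perm_sign_coords g (\<lambda>i. a * x i) = (\<lambda>i. a * perm_sign_coords g x i)" for a
    unfolding g(1) perm_sign_coords_def perm_coords_def by auto
next
  fix x :: "nat \<Rightarrow> 'k"
  show "perm_sign_coords \<one>\<^bsub>S3_C2_C2\<^esub> x = x"
    unfolding S3_C2_C2_one perm_sign_coords_def perm_coords_def by (auto simp: inv_id)
next
  fix g h and x :: "nat \<Rightarrow> 'k" assume "g \<in> carrier S3_C2_C2" "h \<in> carrier S3_C2_C2"
  then obtain \<sigma> s t \<tau> u v where g: "g = (\<sigma>, s, t)" "\<sigma> permutes {1..3}" and h: "h = (\<tau>, u, v)" "\<tau> permutes {1..3}"
    by (cases g; cases h) (auto simp: S3_C2_C2_carrier)
  have comp: "\<sigma> \<circ> \<tau> permutes {1..3}" using permutes_compose[OF h(2) g(2)] .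
  have inv: "inv' (\<sigma> \<circ> \<tau>) = inv' \<tau> \<circ> inv' \<sigma>"
    using o_inv_distrib[OF permutes_bij[OF g(2)] permutes_bij[OF h(2)]] .
  show "perm_sign_coords (g \<otimes>\<^bsub>S3_C2_C2\<^esub> h) x = perm_sign_coords g (perm_sign_coords h x)"
    unfolding g(1) h(1) S3_C2_C2_mult
  proof (rule perm_sign_eqI[OF comp, symmetric])
    show "perm_sign_coords (\<sigma>, s, t) (perm_sign_coords (\<tau>, u, v) x) j = x (inv' (\<sigma> \<circ> \<tau>) j)" if "j \<in> {1..3}" for j
      by (simp add: inv perm_sign_low(1)[OF g(2) that] perm_sign_low(1)[OF h(2) perm_sign_low(2)[OF g(2) that]])
  qed (simp_all add: perm_sign_high[OF g(2)] perm_sign_high[OF h(2)] del: One_nat_def)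
qed

text \<open>
  The first three centred coordinates are \<open>-1, 0, 1\<close>; the last two are nonzero and make the vector
  isotropic if \<open>\<iota>^2 = - 1\<close>.
\<close>

definition S3_point :: "'k \<Rightarrow> nat \<Rightarrow> 'k::field"
  where "S3_point \<iota> = (\<lambda>j. if j = 2 then 1 else if j = 3 then 2 else if j = 4 then 2 else if j = 5 then 3 * \<iota> else 0)"

lemma S3_point_coords: "S3_point \<iota> 1 = 0" "S3_point \<iota> 2 = 1" "S3_point \<iota> 3 = 2" "S3_point \<iota> 4 = 2" "S3_point \<iota> 5 = 3 * \<iota>"
  unfolding S3_point_def by auto

lemma S3_point_mean: "mean3 (S3_point (\<iota> :: 'k::field_char_0)) = 1"
  unfolding mean3_def sum3 S3_point_coords by simp

lemma S3_vector_point: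
  fixes \<iota> \<kappa> :: "'k::field_char_0"
  defines "f \<equiv> S3_isotropic_vector \<kappa> (S3_point \<iota>)"
  shows "f 1 = 1 + 2 * \<kappa>" "f 2 = 2 * \<kappa>" "f 3 = 1 + 2 * \<kappa>" "f 4 = 0" "f 5 = 0"
proof -
  have p: "(\<Sum>i=1..3. (S3_point \<iota> i - 1) ^ 2) = 2" unfolding sum3 S3_point_coords by simp
  show "f 1 = 1 + 2 * \<kappa>" "f 2 = 2 * \<kappa>" "f 3 = 1 + 2 * \<kappa>" "f 4 = 0" "f 5 = 0"
    unfolding f_def S3_isotropic_vector_def S3_point_mean p S3_point_coords by auto
qed

lemma S3_point_independent:
  fixes \<iota> :: "'k::field_char_0"
  assumes \<iota>: "\<iota> ^ 2 = - 1"
    and b: "\<And>j. j \<in> {1..5} \<Longrightarrow> (\<Sum>i=1..5. b i * S3_frame \<kappa> i (S3_point \<iota>) j) = 0"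
    and i: "i \<in> {1..5}"
  shows "b i = 0"
proof -
  note f = S3_vector_point[of \<kappa> \<iota>] S3_point_coords[of \<iota>]
  have r1: "b 2 + b 5 * (1 + 2 * \<kappa>) = 0"
    using b[of 1] unfolding sum5 by (simp add: S3_frame_def restrict5_def f f[unfolded One_nat_def])
  have r2: "b 1 + b 2 + b 5 * (2 * \<kappa>) = 0"
    using b[of 2] unfolding sum5 by (simp add: S3_frame_def restrict5_def f)
  have r3: "2 * b 1 + b 2 + b 5 * (1 + 2 * \<kappa>) = 0"
    using b[of 3] unfolding sum5 by (simp add: S3_frame_def restrict5_def f mult.commute)
  have r4: "2 * b 1 + 2 * b 3 = 0"
    using b[of 4] unfolding sum5 by (simp add: S3_frame_def restrict5_def f mult.commute)
  have r5: "3 * \<iota> * (b 1 + b 4) = 0"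
    using b[of 5] unfolding sum5 by (simp add: S3_frame_def restrict5_def f algebra_simps)
  have "2 * b 1 = (2 * b 1 + b 2 + b 5 * (1 + 2 * \<kappa>)) - (b 2 + b 5 * (1 + 2 * \<kappa>))" by simp
  then have b1: "b 1 = 0" unfolding r1 r3 by simp
  have "b 5 = (b 2 + b 5 * (1 + 2 * \<kappa>)) - (b 1 + b 2 + b 5 * (2 * \<kappa>)) + b 1" by (simp add: algebra_simps)
  then have b5: "b 5 = 0" unfolding r1 r2 unfolding b1 by simp
  have b2: "b 2 = 0" using r1 b5 by simp
  have b3: "b 3 = 0" using r4 b1 by simp
  have "\<iota> \<noteq> 0" using \<iota> by auto
  then have b4: "b 4 = 0" using r5 b1 by simp
  have "i = 1 \<or> i = 2 \<or> i = 3 \<or> i = 4 \<or> i = 5" using i by auto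
  then show ?thesis using b1 b2 b3 b4 b5 by auto
qed

lemma S3_equivariant_frame:
  fixes \<iota> \<kappa> :: "'k::{alg_closed_field, field_char_0}"
  assumes \<iota>: "\<iota> ^ 2 = - 1" and \<kappa>: "6 * \<kappa> ^ 2 + 4 * \<kappa> + 1 = 0"
  shows "equivariant_frame S3_C2_C2 perm_sign_coords mean3 (S3_frame \<kappa>) (S3_point \<iota>)"
proof (rule equivariant_frame.intro)
  have gE: "\<exists>\<sigma> s t. g = (\<sigma>, s, t) \<and> \<sigma> permutes {1..3} \<and> s \<in> {-1, 1} \<and> t \<in> {-1, 1}" if "g \<in> carrier S3_C2_C2" for g
    using that by (cases g) (auto simp: S3_C2_C2_carrier)
  show "group S3_C2_C2"
    unfolding S3_C2_C2_def by (intro DirProd_group sym_group_is_group sign_img_is_group)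
  show "finite (carrier S3_C2_C2)"
    unfolding S3_C2_C2_def sym_group_def sign_img_def DirProd_def by (simp add: finite_permutations)
  show "linear_representation S3_C2_C2 {1..5} (perm_sign_coords :: _ \<Rightarrow> (nat \<Rightarrow> 'k) \<Rightarrow> _)"
    by (rule S3_linear_representation)
  show "dot (perm_sign_coords g x) (perm_sign_coords g y) = dot x y" if gc: "g \<in> carrier S3_C2_C2" for g and x y :: "nat \<Rightarrow> 'k"
  proof -
    obtain \<sigma> s t where g: "g = (\<sigma>, s, t)" "\<sigma> permutes {1..3}" "s \<in> {-1, 1}" "t \<in> {-1, 1}" using gE[OF gc] by blast
    have split: "dot z w = (\<Sum>i=1..3. z i * w i) + z 4 * w 4 + z 5 * w 5" for z w :: "nat \<Rightarrow> 'k"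
      unfolding dot_def sum5 sum3 ..
    show ?thesis
      unfolding split g(1) sum_perm_sign[OF g(2), where h="(*)"] perm_sign_high[OF g(2)] using g(3,4) by auto
  qed
  show "g = \<one>\<^bsub>S3_C2_C2\<^esub>" if gc: "g \<in> carrier S3_C2_C2" and fixed: "\<And>x :: nat \<Rightarrow> 'k. x \<in> vspace \<Longrightarrow> perm_sign_coords g x = x" for g
  proof -
    obtain \<sigma> s t where g: "g = (\<sigma>, s, t)" "\<sigma> permutes {1..3}" "s \<in> {-1, 1}" "t \<in> {-1, 1}" using gE[OF gc] by blast
    have fx: "perm_sign_coords (\<sigma>, s, t) (std_basis j) = (std_basis j :: nat \<Rightarrow> 'k)" if "j \<in> {1..5}" for j
      using fixed[OF std_basis_vspace[OF that]] g(1) by simp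
    have "\<sigma> = id"
    proof (rule perm_coords_faithful[OF g(2), where 'k='k])
      fix j :: nat assume j: "j \<in> {1..3}"
      have "perm_coords \<sigma> (std_basis j :: nat \<Rightarrow> 'k) j = perm_sign_coords (\<sigma>, s, t) (std_basis j) j"
        using perm_sign_low(1)[OF g(2) j, of s t "std_basis j :: nat \<Rightarrow> 'k"] unfolding perm_coords_def by simp
      then show "perm_coords \<sigma> (std_basis j :: nat \<Rightarrow> 'k) j = 1" using fx[of j] j by (simp add: std_basis_def)
    qed
    moreover have "of_int s = (1::'k)"
      using perm_sign_high(1)[OF g(2), of s t "std_basis 4 :: nat \<Rightarrow> 'k"] fx[of 4] by (simp add: std_basis_def)
    moreover have "of_int t = (1::'k)"
      using perm_sign_high(2)[OF g(2), of s t "std_basis 5 :: nat \<Rightarrow> 'k"] fx[of 5] by (simp add: std_basis_def)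
    ultimately show ?thesis unfolding g(1) S3_C2_C2_one by simp
  qed
  have pm: "poly_fun {1..5} (mean3 :: (nat \<Rightarrow> 'k) \<Rightarrow> 'k)"
    unfolding mean3_def[abs_def] by (intro poly_fun_divide poly_fun_sum poly_fun.coord) auto
  have pc: "poly_fun {1..5} (\<lambda>x :: nat \<Rightarrow> 'k. x j)" if "j \<in> {1..3}" for j
    by (rule poly_fun.coord) (use that in auto)
  show "homogeneous_fun {1..5} 1 (mean3 :: (nat \<Rightarrow> 'k) \<Rightarrow> 'k)"
    unfolding homogeneous_fun_def using pm by (simp add: mean3_def sum_distrib_left[symmetric])
  show "mean3 (perm_sign_coords g x) = mean3 x" if "g \<in> carrier S3_C2_C2" for g and x :: "nat \<Rightarrow> 'k"
    using gE[OF that] mean3_perm_sign by blast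
  show "poly_fun {1..5} (\<lambda>x :: nat \<Rightarrow> 'k. S3_frame \<kappa> i x j)" if "i \<in> {1..5}" "j \<in> {1..5}" for i j
  proof -
    have x: "poly_fun {1..5} (\<lambda>x :: nat \<Rightarrow> 'k. x j)" by (rule poly_fun.coord[OF that(2)])
    have "poly_fun {1..5} (\<lambda>x :: nat \<Rightarrow> 'k. (x j - mean3 x) ^ 2 + \<kappa> * (\<Sum>i=1..3. (x i - mean3 x) ^ 2))"
      by (intro poly_fun.add poly_fun.mult poly_fun.const poly_fun_sum poly_fun_power poly_fun_diff pm pc x)
    then have v: "poly_fun {1..5} (\<lambda>x :: nat \<Rightarrow> 'k. S3_isotropic_vector \<kappa> x j)"
      unfolding S3_isotropic_vector_def by (cases "j \<in> {1..3}") (simp_all only: if_True if_False poly_fun.const)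
    consider "i = 5" | "i \<noteq> 5" "i = 1 \<or> (i \<noteq> 2 \<and> j = i + 1)" | "i = 2 \<and> j \<in> {1..3}"
      | "i \<noteq> 5" "i \<noteq> 1" "\<not> (i = 2 \<and> j \<in> {1..3})" "\<not> (i \<noteq> 2 \<and> j = i + 1)" by blast
    then show ?thesis
    proof cases
      case 1
      then have "(\<lambda>x. S3_frame \<kappa> i x j) = (\<lambda>x :: nat \<Rightarrow> 'k. S3_isotropic_vector \<kappa> x j)"
        by (simp add: S3_frame_def)
      then show ?thesis using v by simp
    next
      case 2
      then have "(\<lambda>x. S3_frame \<kappa> i x j) = (\<lambda>x :: nat \<Rightarrow> 'k. x j)"
        using that(2) unfolding S3_frame_def restrict5_def by (auto simp: fun_eq_iff)
      then show ?thesis using x by simp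
    next
      case 3
      then have "(\<lambda>x. S3_frame \<kappa> i x j) = (\<lambda>x :: nat \<Rightarrow> 'k. 1)" by (simp add: S3_frame_def)
      then show ?thesis using poly_fun.const by simp
    next
      case 4
      then have "(\<lambda>x. S3_frame \<kappa> i x j) = (\<lambda>x :: nat \<Rightarrow> 'k. 0)"
        unfolding S3_frame_def by (auto simp: fun_eq_iff)
      then show ?thesis using poly_fun.const by simp
    qed
  qed
  show "S3_frame \<kappa> i x \<in> vspace" if "i \<in> {1..5}" for i x
    using that unfolding S3_frame_def S3_isotropic_vector_def restrict5_def coord_space_def by auto
  show "S3_frame \<kappa> i (perm_sign_coords g x) = perm_sign_coords g (S3_frame \<kappa> i x)"
    if "g \<in> carrier S3_C2_C2" "i \<in> {1..5}" for g i x
    using gE[OF that(1)] S3_frame_perm_sign[OF _ that(2)] by blast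
  show "S3_frame \<kappa> 1 x = x" if "x \<in> vspace" for x
    using that unfolding S3_frame_def restrict5_def coord_space_def by auto
  show "dot (S3_frame \<kappa> 5 x) (S3_frame \<kappa> 5 x) = 0" for x
    unfolding S3_frame_def using S3_isotropic_vector_isotropic[OF \<kappa>] by simp
  show "S3_point \<iota> \<in> vspace" unfolding S3_point_def coord_space_def by simp
  show "dot (S3_point \<iota>) (S3_point \<iota>) = 0"
    unfolding dot_def sum5 S3_point_coords using \<iota> by (simp add: power2_eq_square)
  show "mean3 (S3_point \<iota>) = 1" by (rule S3_point_mean)
  have "dot (S3_frame \<kappa> 5 (S3_point \<iota>)) (S3_point \<iota>) = 2 * (1 + 3 * \<kappa>)"
    unfolding dot_def sum5 S3_point_coords by (simp add: S3_frame_def S3_vector_point algebra_simps)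
  moreover have "1 + 3 * \<kappa> \<noteq> 0"
  proof
    assume "1 + 3 * \<kappa> = 0"
    moreover have "3 * (6 * \<kappa> ^ 2 + 4 * \<kappa> + 1) = (1 + 3 * \<kappa>) * (6 * \<kappa> + 2) + 1"
      by (simp add: power2_eq_square algebra_simps)
    ultimately show False unfolding \<kappa> by simp
  qed
  ultimately show "dot (S3_frame \<kappa> 5 (S3_point \<iota>)) (S3_point \<iota>) \<noteq> 0"
    by (metis mult_eq_0_iff zero_neq_numeral)
  show "b i = 0" if "\<And>j. j \<in> {1..5} \<Longrightarrow> (\<Sum>i=1..5. b i * S3_frame \<kappa> i (S3_point \<iota>) j) = 0" "i \<in> {1..5}" for b i
    using S3_point_independent[OF \<iota> that] .
qed

theorem proposition6p2:
  shows "stably_linearizable (sym_group 5)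
           (quadric :: ((nat \<Rightarrow> 'k::{alg_closed_field, field_char_0}) set, 'k) fspace)
           (induced_action perm_coords quadric) \<and>
         stably_linearizable S3_C2_C2
           (quadric :: ((nat \<Rightarrow> 'k) set, 'k) fspace)
           (induced_action perm_sign_coords quadric)"
proof
  obtain \<iota> :: 'k where \<iota>: "\<iota> ^ 2 = - 1" using nth_root_exists[of 2 "- 1 :: 'k"] by auto
  obtain m :: 'k where m: "m ^ 2 = - 2" using nth_root_exists[of 2 "- 2 :: 'k"] by auto
  \<comment> \<open>The vector (2 i, 1, 1, 1, 1), which is isotropic, has first component 1 + c for c = 2 i - 1.\<close>
  have "(2 * \<iota> - 1) ^ 2 + 2 * (2 * \<iota> - 1) + 5 = 4 * (\<iota> ^ 2 + 1)"
    by (simp add: power2_eq_square algebra_simps)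
  then have "(2 * \<iota> - 1) ^ 2 + 2 * (2 * \<iota> - 1) + 5 = 0" using \<iota> by simp
  from equivariant_frame.stably_linearizable_quadric[OF S5_equivariant_frame[OF m this]]
  show "stably_linearizable (sym_group 5) (quadric :: ((nat \<Rightarrow> 'k) set, 'k) fspace) (induced_action perm_coords quadric)" .
  define \<kappa> where "\<kappa> = (m - 2) / 6"
  have m_eq: "m = 6 * \<kappa> + 2" unfolding \<kappa>_def by (simp add: field_simps)
  have "6 * (6 * \<kappa> ^ 2 + 4 * \<kappa> + 1) = m ^ 2 + 2"
    unfolding m_eq by (simp add: power2_eq_square algebra_simps)
  then have "6 * (6 * \<kappa> ^ 2 + 4 * \<kappa> + 1) = 0" unfolding m by simp
  then have "6 * \<kappa> ^ 2 + 4 * \<kappa> + 1 = 0" by (metis mult_eq_0_iff zero_neq_numeral)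
  from equivariant_frame.stably_linearizable_quadric[OF S3_equivariant_frame[OF \<iota> this]]
  show "stably_linearizable S3_C2_C2 (quadric :: ((nat \<Rightarrow> 'k) set, 'k) fspace) (induced_action perm_sign_coords quadric)" .
qed

end
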